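(* Let $n=\binom{s+N}{N}$ (with $N\ge 1$, $s\ge 0$ integers), and let $Z\subset\mathbf{P}^N$ be the reduced subscheme consisting of the union of $n$ distinct generic points. Then $$\rho(Z)=\frac{s+1}{n\,(\varepsilon(N,Z))^{N-1}}.$$ If in addition $N=2$ and $n$ is a perfect square, then $$\rho(Z)=\frac{s+1}{\sqrt{n}}=\sqrt{2}\,\sqrt{\frac{s+1}{s+2}}.$$
   Context: $k$ is an algebraically closed field of arbitrary characteristic and $k[\mathbf{P}^N]=k[x_0,\dots,x_N]$. For a reduced finite set of points $Z=\{p_1,\dots,p_n\}\subset\mathbf{P}^N$, let $I=I(Z)$ be its radical homogeneous ideal. The symbolic power $I^{(m)}$ is $\bigcap_i I(p_i)^m$, i.e. the ideal generated by all forms vanishing to order at least $m$ at each $p_i$. The resurgence is $\rho(Z)=\rho(I)=\sup\{m/r : m,r\ge 1 \text{ integers},\ I^{(m)}\not\subseteq I^r\}$. The codimension $1$ multipoint Seshadri constant of $Z$ is $$\varepsilon(N,Z)=\sqrt[N-1]{\inf\left\{\frac{\deg(H)}{\sum_{i=1}^n\mathrm{mult}_{p_i}H}\right\}},$$ the infimum being over all hypersurfaces $H\subset\mathbf{P}^N$ passing through at least one of the points $p_i$; thus $(\varepsilon(N,Z))^{N-1}$ is this infimum (and is read as this infimum when $N=1$). "Generic points" means points whose affine coordinates (the $nN$ coordinates all together) are algebraically independent over the prime field of $k$, where $k$ is assumed to have large enough transcendence degree for such points to exist. *)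

theory Defs
  imports
    Complex_Main
    "HOL-Library.Poly_Mapping"
    "HOL-Library.Extended_Real"
    "HOL-Library.Cardinality"
    "HOL-Computational_Algebra.Computational_Algebra"
begin

text \<open>The polynomial ring over \<open>'a\<close> in variables indexed by \<open>'v\<close>;
  an exponent vector is a finitely supported function.\<close>

type_synonym ('v, 'a) mpol = "('v \<Rightarrow>\<^sub>0 nat) \<Rightarrow>\<^sub>0 'a"

definition mpol_eval :: "('v \<Rightarrow> 'a::comm_ring_1) \<Rightarrow> ('v, 'a) mpol \<Rightarrow> 'a" where
  "mpol_eval a F =
     (\<Sum>t\<in>Poly_Mapping.keys F. Poly_Mapping.lookup F t *
        (\<Prod>i\<in>Poly_Mapping.keys t. a i ^ Poly_Mapping.lookup t i))"

definition monom_deg :: "('v \<Rightarrow>\<^sub>0 nat) \<Rightarrow> nat" where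
  "monom_deg t = (\<Sum>i\<in>Poly_Mapping.keys t. Poly_Mapping.lookup t i)"

definition homogeneous :: "nat \<Rightarrow> ('v, 'a::zero) mpol \<Rightarrow> bool" where
  "homogeneous d F \<longleftrightarrow> (\<forall>t\<in>Poly_Mapping.keys F. monom_deg t = d)"

text \<open>The ideals of a commutative ring are its submodules as a module over itself.\<close>

definition ideal_gen :: "'a::comm_ring_1 set \<Rightarrow> 'a set" where
  "ideal_gen S = module.span (*) S"

definition ideal_mult :: "'a::comm_ring_1 set \<Rightarrow> 'a set \<Rightarrow> 'a set" where
  "ideal_mult I J = ideal_gen {a * b |a b. a \<in> I \<and> b \<in> J}"

primrec ideal_power :: "'a::comm_ring_1 set \<Rightarrow> nat \<Rightarrow> 'a set" where
  "ideal_power I 0 = UNIV"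
| "ideal_power I (Suc m) = ideal_mult I (ideal_power I m)"

text \<open>For a finite type \<open>'n\<close> with \<open>N\<close> elements, \<open>('k, 'n) proj\<close> is the projective space
  \<open>P\<^sup>N\<close> over \<open>'k\<close>. Its \<open>N + 1\<close> homogeneous coordinates are indexed by \<open>'n option\<close>: the index
  \<open>None\<close> is that of \<open>x\<^sub>0\<close>, and \<open>Some j\<close> for \<open>j :: 'n\<close> are the indices of the others.\<close>

definition proportional :: "('i \<Rightarrow> 'k::field) \<Rightarrow> ('i \<Rightarrow> 'k) \<Rightarrow> bool" where
  "proportional v w \<longleftrightarrow> v \<noteq> (\<lambda>_. 0) \<and> (\<exists>c. c \<noteq> 0 \<and> w = (\<lambda>i. c * v i))"

lemma part_equivp_proportional:
  "part_equivp (proportional :: ('i \<Rightarrow> 'k::field) \<Rightarrow> ('i \<Rightarrow> 'k) \<Rightarrow> bool)"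
proof (rule part_equivpI)
  show "\<exists>v :: 'i \<Rightarrow> 'k. proportional v v"
    unfolding proportional_def by (intro exI[of _ "\<lambda>_. 1"] conjI) (auto simp: fun_eq_iff)
  show "symp (proportional :: ('i \<Rightarrow> 'k) \<Rightarrow> _)"
  proof (rule sympI)
    fix v w :: "'i \<Rightarrow> 'k" assume "proportional v w"
    then obtain c where v: "v \<noteq> (\<lambda>_. 0)" and c: "c \<noteq> 0" "w = (\<lambda>i. c * v i)"
      by (auto simp: proportional_def)
    have "v = (\<lambda>i. inverse c * w i)" using c by (simp add: fun_eq_iff)
    moreover have "w \<noteq> (\<lambda>_. 0)" using v c by (auto simp: fun_eq_iff)
    ultimately show "proportional w v" using c(1)
      unfolding proportional_def by (intro conjI exI[of _ "inverse c"]) auto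
  qed
  show "transp (proportional :: ('i \<Rightarrow> 'k) \<Rightarrow> _)"
  proof (rule transpI)
    fix u v w :: "'i \<Rightarrow> 'k" assume uv: "proportional u v" and vw: "proportional v w"
    from uv obtain c where u: "u \<noteq> (\<lambda>_. 0)" and c: "c \<noteq> 0" "v = (\<lambda>i. c * u i)"
      unfolding proportional_def by (elim conjE exE)
    from vw obtain d where d: "d \<noteq> 0" "w = (\<lambda>i. d * v i)"
      unfolding proportional_def by (elim conjE exE)
    have "w = (\<lambda>i. d * c * u i)" "d * c \<noteq> 0"
      using c d by (simp_all add: mult.assoc)
    with u show "proportional u w"
      unfolding proportional_def by (intro conjI exI[of _ "d * c"])
  qed
qed

quotient_type (overloaded) ('k, 'n) proj = "'n option \<Rightarrow> 'k::field" / partial: proportional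
  by (rule part_equivp_proportional)

lift_definition hom_coords :: "('k::field, 'n) proj \<Rightarrow> ('n option \<Rightarrow> 'k) set" is
  "\<lambda>v. {w. proportional v w}"
proof -
  fix v w :: "'n option \<Rightarrow> 'k" assume vw: "proportional v w"
  have sym: "symp (proportional :: ('n option \<Rightarrow> 'k) \<Rightarrow> _)"
    and trans: "transp (proportional :: ('n option \<Rightarrow> 'k) \<Rightarrow> _)"
    using part_equivp_proportional by (auto elim: part_equivpE)
  show "{u. proportional v u} = {u. proportional w u}"
    using vw sympD[OF sym] transpD[OF trans] by blast
qed

text \<open>The point \<open>[1 : a\<^sub>1 : \<dots> : a\<^sub>N]\<close> with affine coordinates \<open>a\<close>.\<close>

lift_definition affine_point :: "('n \<Rightarrow> 'k::field) \<Rightarrow> ('k, 'n) proj" is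
  "case_option 1"
proof -
  fix a :: "'n \<Rightarrow> 'k"
  have "case_option 1 a \<noteq> (\<lambda>_. 0)" by (auto dest: fun_cong[of _ _ None])
  then show "proportional (case_option 1 a) (case_option 1 a)"
    unfolding proportional_def by (intro conjI exI[of _ 1]) simp_all
qed

definition vanishes_at :: "('n option, 'k::field) mpol \<Rightarrow> ('k, 'n) proj \<Rightarrow> bool" where
  "vanishes_at F P \<longleftrightarrow> (\<forall>v\<in>hom_coords P. mpol_eval v F = 0)"

definition ideal_of :: "('k::field, 'n) proj set \<Rightarrow> ('n option, 'k) mpol set" where
  "ideal_of Z = ideal_gen {F. (\<exists>d. homogeneous d F) \<and> (\<forall>P\<in>Z. vanishes_at F P)}"

definition symbolic_power :: "('k::field, 'n) proj set \<Rightarrow> nat \<Rightarrow> ('n option, 'k) mpol set" where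
  "symbolic_power Z m = (\<Inter>P\<in>Z. ideal_power (ideal_of {P}) m)"

text \<open>The supremum is taken in \<^typ>\<open>ereal\<close>, so that it is meaningful without assuming boundedness.\<close>

definition resurgence :: "('k::field, 'n) proj set \<Rightarrow> ereal" where
  "resurgence Z = Sup {ereal (real m / real r) |m r.
     m \<ge> 1 \<and> r \<ge> 1 \<and> \<not> symbolic_power Z m \<subseteq> ideal_power (ideal_of Z) r}"

text \<open>The multiplicity at \<open>P\<close> of the hypersurface \<open>F = 0\<close>, i.e. its order of vanishing at \<open>P\<close>:
  \<open>F\<close> vanishes to order at least \<open>m\<close> at \<open>P\<close> iff \<open>F \<in> I(P)\<^sup>m\<close>. Only meaningful for \<open>F \<noteq> 0\<close>, where
  the set below is finite.\<close>

definition mult_at :: "('k::field, 'n) proj \<Rightarrow> ('n option, 'k) mpol \<Rightarrow> nat" where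
  "mult_at P F = Max {m. F \<in> ideal_power (ideal_of {P}) m}"

text \<open>Hypersurfaces are given by nonzero forms; a nonzero form vanishing at a point has positive
  degree.\<close>

definition seshadri_inf :: "('k::field, 'n) proj set \<Rightarrow> real" where
  "seshadri_inf Z = Inf {real d / real (\<Sum>P\<in>Z. mult_at P F) |d F.
     F \<noteq> 0 \<and> homogeneous d F \<and> (\<exists>P\<in>Z. vanishes_at F P)}"

definition seshadri :: "('k::field, 'n::finite) proj set \<Rightarrow> real" where
  "seshadri Z = root (CARD('n) - 1) (seshadri_inf Z)"

text \<open>The power \<open>\<epsilon>(N, Z)\<^bsup>N - 1\<^esup>\<close>, by convention the infimum itself if \<open>N = 1\<close>, where there is no
  root to take.\<close>

definition seshadri_pow :: "('k::field, 'n::finite) proj set \<Rightarrow> real" where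
  "seshadri_pow Z =
     (if CARD('n) = 1 then seshadri_inf Z else seshadri Z ^ (CARD('n) - 1))"

definition is_subfield :: "'k::field set \<Rightarrow> bool" where
  "is_subfield K \<longleftrightarrow> 0 \<in> K \<and> 1 \<in> K \<and>
     (\<forall>x\<in>K. \<forall>y\<in>K. x - y \<in> K \<and> x * y \<in> K) \<and> (\<forall>x\<in>K. inverse x \<in> K)"

definition prime_field :: "'k::field set" where
  "prime_field = \<Inter>{K. is_subfield K}"

definition alg_independent :: "'k::field set \<Rightarrow> 'v set \<Rightarrow> ('v \<Rightarrow> 'k) \<Rightarrow> bool" where
  "alg_independent K V a \<longleftrightarrow>
     (\<forall>F :: ('v, 'k) mpol.
        (\<forall>t\<in>Poly_Mapping.keys F. Poly_Mapping.lookup F t \<in> K \<and> Poly_Mapping.keys t \<subseteq> V) \<and>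
        mpol_eval a F = 0 \<longrightarrow> F = 0)"

definition generic_points :: "nat \<Rightarrow> (nat \<Rightarrow> ('k::field, 'n) proj) \<Rightarrow> bool" where
  "generic_points n p \<longleftrightarrow>
     (\<exists>a :: nat \<Rightarrow> 'n \<Rightarrow> 'k. (\<forall>i<n. p i = affine_point (a i)) \<and>
        alg_independent prime_field ({..<n} \<times> UNIV) (\<lambda>(i, j). a i j))"

end

theory Submission
  imports Defs "HOL-Library.FuncSet"
begin

text \<open>Write \<open>I\<close> for the ideal of the points, \<open>e = s + 1\<close>, and \<open>\<gamma>\<close> for the infimum of \<open>d/m\<close> over
  nonzero forms of degree \<open>d\<close> with multiplicity at least \<open>m \<ge> 1\<close> at every point.

  Generic points impose independent conditions on forms of degree \<open>s\<close>, and their number equals the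
  number of monomials of that degree, so \<open>I\<close> starts in degree \<open>e\<close> and modulo \<open>x\<^sub>0\<close> becomes
  \<open>(x\<^sub>1, \<dots>, x\<^sub>N)\<^sup>e\<close>. Lifting the linear syzygies of this power shows that \<open>I\<^sup>r\<close> agrees with the symbolic
  power \<open>I\<^bsup>(r)\<^esup>\<close> in all degrees \<open>\<ge> r e\<close>. As a form in \<open>I\<^bsup>(m)\<^esup>\<close> has degree at least \<open>m \<gamma>\<close>, this gives
  \<open>\<rho> \<le> e/\<gamma>\<close>. Conversely a form in \<open>I\<^bsup>(m)\<^esup>\<close> of degree less than \<open>r e\<close> is not in \<open>I\<^sup>r\<close>; powers of nearly
  optimal forms give \<open>\<rho> \<ge> e/\<gamma>\<close>.

  If a form of degree \<open>d\<close> has multiplicities \<open>m\<^sub>i\<close> at generic points, then there is such a form at any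
  other points (specialization). Applied to permutations of the points this gives \<open>\<gamma> = n \<epsilon>\<^bsup>N-1\<^esup>\<close>.
  In the plane with \<open>n = q\<^sup>2\<close>, applied to a \<open>q \<times> q\<close> grid it gives \<open>\<gamma> \<ge> q\<close>, by splitting off lines;
  \<open>\<gamma> \<le> q\<close> is a dimension count.\<close>

text \<open>The hard point is the comparison of \<open>I\<^sup>r\<close> with the symbolic power in
  degrees at least \<open>r e\<close>. Some power of \<open>x\<^sub>0\<close> multiplies the
  symbolic power into \<open>I\<^sup>r\<close>, and \<open>x\<^sub>0\<close> is then cancelled one
  factor at a time. Modulo \<open>x\<^sub>0\<close> a product of \<open>r\<close> lifted generators
  is a monomial; cancellation requires that two products with the same monomial agree modulo
  \<open>x\<^sub>0 I\<^sup>r\<close>, not merely modulo \<open>x\<^sub>0\<close>. Linear syzygies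
  achieve this as long as a variable is left over to be moved, that is in degree greater than
  \<open>r e\<close>. Since \<open>x\<^sub>0 F\<close> has degree one more than \<open>F\<close>,
  this covers every \<open>F\<close> of degree at least \<open>r e\<close>. Orders of vanishing are
  expressed by Hasse derivatives, which keep their meaning in positive characteristic. They turn a
  multiplicity condition into linear equations for the coefficients, with entries that are integer
  polynomials in the coordinates of the point; specialization rests on this. The factor
  \<open>n\<close> between the two infima arises by multiplying the \<open>n\<close> cyclic shifts
  of a form: the degree is multiplied by \<open>n\<close>, and the multiplicity at each point
  becomes the sum of the original ones.\<close>

abbreviation lookup :: "('a \<Rightarrow>\<^sub>0 'b::zero) \<Rightarrow> 'a \<Rightarrow> 'b" where "lookup \<equiv> Poly_Mapping.lookup"
abbreviation keys :: "('a \<Rightarrow>\<^sub>0 'b::zero) \<Rightarrow> 'a set" where "keys \<equiv> Poly_Mapping.keys"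
abbreviation single :: "'a \<Rightarrow> 'b::zero \<Rightarrow> ('a \<Rightarrow>\<^sub>0 'b)" where "single \<equiv> Poly_Mapping.single"

subsection \<open>Ring homomorphisms and evaluation\<close>

locale ring_map =
  fixes \<phi> :: "'a::comm_ring_1 \<Rightarrow> 'b::comm_ring_1"
  assumes add: "\<phi> (x + y) = \<phi> x + \<phi> y"
    and mult: "\<phi> (x * y) = \<phi> x * \<phi> y"
    and one: "\<phi> 1 = 1"
begin

lemma zero [simp]: "\<phi> 0 = 0"
  using add[of 0 0] by simp

lemma uminus: "\<phi> (- x) = - \<phi> x"
  using add[of x "- x"] by (simp add: eq_neg_iff_add_eq_0 add.commute)

lemma diff: "\<phi> (x - y) = \<phi> x - \<phi> y"
  using add[of x "- y"] by (simp add: uminus)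

lemma sum: "\<phi> (sum f S) = (\<Sum>x\<in>S. \<phi> (f x))"
  by (induction S rule: infinite_finite_induct) (simp_all add: add)

lemma prod: "\<phi> (prod f S) = (\<Prod>x\<in>S. \<phi> (f x))"
  by (induction S rule: infinite_finite_induct) (simp_all add: mult one)

lemma power: "\<phi> (x ^ n) = \<phi> x ^ n"
  by (induction n) (simp_all add: mult one)

lemma of_nat: "\<phi> (of_nat n) = of_nat n"
  by (induction n) (simp_all add: add one)

end

lemma ring_map_id: "ring_map (\<lambda>x. x)"
  by unfold_locales simp_all

lemma sum_single: "(F :: 't \<Rightarrow>\<^sub>0 'a::comm_monoid_add) = (\<Sum>t\<in>keys F. single t (lookup F t))"
proof (rule poly_mapping_eqI)
  fix t
  have "lookup (\<Sum>t\<in>keys F. single t (lookup F t)) t = (\<Sum>t'\<in>keys F. if t' = t then lookup F t' else 0)"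
    unfolding lookup_sum by (rule sum.cong) (auto simp: lookup_single)
  also have "\<dots> = lookup F t"
    by (simp add: sum.delta in_keys_iff)
  finally show "lookup F t = lookup (\<Sum>t\<in>keys F. single t (lookup F t)) t" by simp
qed

text \<open>In the single-term case \<open>t\<close> stays in the support of the original
  \<open>F\<close>, so that homogeneity of \<open>F\<close> remains usable inside the
  induction.\<close>

lemma poly_mapping_sum_induct [case_names zero single add]:
  fixes F :: "'t \<Rightarrow>\<^sub>0 'a::comm_monoid_add"
  assumes "P 0" "\<And>t c. t \<in> keys F \<Longrightarrow> P (single t c)" "\<And>F G. P F \<Longrightarrow> P G \<Longrightarrow> P (F + G)"
  shows "P F"
proof -
  have "P (\<Sum>t\<in>S. single t (lookup F t))" if "S \<subseteq> keys F" for S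
    using finite_subset[OF that finite_keys] that by (induction S rule: finite_induct) (auto intro: assms)
  from this[of "keys F"] show ?thesis using sum_single[of F] by simp
qed

text \<open>Evaluation, Hasse derivatives and substitution into univariate polynomials are all of
  this shape; they differ in the map on coefficients and in the values prescribed on
  monomials.\<close>

definition mlin :: "('a::comm_ring_1 \<Rightarrow> 'b::comm_ring_1) \<Rightarrow> ('t \<Rightarrow> 'b) \<Rightarrow> ('t \<Rightarrow>\<^sub>0 'a) \<Rightarrow> 'b" where
  "mlin \<phi> c F = (\<Sum>t\<in>keys F. \<phi> (lookup F t) * c t)"

definition mon :: "('v \<Rightarrow> 'a::comm_ring_1) \<Rightarrow> ('v \<Rightarrow>\<^sub>0 nat) \<Rightarrow> 'a" where
  "mon a t = (\<Prod>i\<in>keys t. a i ^ lookup t i)"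

lemma mpol_eval_mlin: "mpol_eval a F = mlin (\<lambda>x. x) (mon a) F"
  by (simp add: mpol_eval_def mlin_def mon_def)

lemma mon_superset: "finite S \<Longrightarrow> keys t \<subseteq> S \<Longrightarrow> mon a t = (\<Prod>i\<in>S. a i ^ lookup t i)"
  unfolding mon_def by (rule prod.mono_neutral_left) (auto simp: in_keys_iff)

lemma mon_add: "mon a (s + t) = mon a s * mon a t"
proof -
  have "mon a (s + t) = (\<Prod>i\<in>keys s \<union> keys t. a i ^ lookup (s + t) i)"
    by (rule mon_superset) (use Poly_Mapping.keys_add[of s t] in auto)
  moreover have "mon a s = (\<Prod>i\<in>keys s \<union> keys t. a i ^ lookup s i)"
    "mon a t = (\<Prod>i\<in>keys s \<union> keys t. a i ^ lookup t i)"
    by (rule mon_superset; auto)+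
  ultimately show ?thesis by (simp add: lookup_add power_add prod.distrib)
qed

lemma mon_zero [simp]: "mon a 0 = 1"
  by (simp add: mon_def)

lemma mon_single [simp]: "mon a (single i n) = a i ^ n"
  by (simp add: mon_def)

context ring_map
begin

lemma mlin_superset: "finite S \<Longrightarrow> keys F \<subseteq> S \<Longrightarrow> mlin \<phi> c F = (\<Sum>t\<in>S. \<phi> (lookup F t) * c t)"
  unfolding mlin_def by (rule sum.mono_neutral_left) (auto simp: in_keys_iff)

lemma mlin_add: "mlin \<phi> c (F + G) = mlin \<phi> c F + mlin \<phi> c G"
proof -
  have "mlin \<phi> c (F + G) = (\<Sum>i\<in>keys F \<union> keys G. \<phi> (lookup (F + G) i) * c i)"
    by (rule mlin_superset) (use Poly_Mapping.keys_add[of F G] in auto)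
  moreover have "mlin \<phi> c F = (\<Sum>i\<in>keys F \<union> keys G. \<phi> (lookup F i) * c i)"
    "mlin \<phi> c G = (\<Sum>i\<in>keys F \<union> keys G. \<phi> (lookup G i) * c i)"
    by (rule mlin_superset; auto)+
  ultimately show ?thesis by (simp add: lookup_add add sum.distrib algebra_simps)
qed

lemma mlin_zero [simp]: "mlin \<phi> c 0 = 0"
  by (simp add: mlin_def)

lemma mlin_single [simp]: "mlin \<phi> c (single t x) = \<phi> x * c t"
  by (simp add: mlin_def)

lemma mlin_sum: "mlin \<phi> c (sum f S) = (\<Sum>x\<in>S. mlin \<phi> c (f x))"
  by (induction S rule: infinite_finite_induct) (simp_all add: mlin_add)

lemma mlin_uminus: "mlin \<phi> c (- F) = - mlin \<phi> c F"
  using mlin_add[of c F "- F"] by (simp add: eq_neg_iff_add_eq_0 add.commute)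

lemma mlin_diff: "mlin \<phi> c (F - G) = mlin \<phi> c F - mlin \<phi> c G"
  using mlin_add[of c F "- G"] by (simp add: mlin_uminus)

lemma ring_map_mlin:
  assumes c: "\<And>s t. c (s + t) = c s * c t" "c 0 = 1"
  shows "ring_map (mlin \<phi> c :: ('t::comm_monoid_add \<Rightarrow>\<^sub>0 'a) \<Rightarrow> 'b)"
proof
  fix F G :: "'t \<Rightarrow>\<^sub>0 'a"
  show "mlin \<phi> c (F + G) = mlin \<phi> c F + mlin \<phi> c G" by (rule mlin_add)
  have *: "mlin \<phi> c (single t x * G) = \<phi> x * c t * mlin \<phi> c G" for t x
    by (induction G rule: poly_mapping_sum_induct)
       (simp_all add: distrib_left mlin_add mult_single mult c algebra_simps)
  show "mlin \<phi> c (F * G) = mlin \<phi> c F * mlin \<phi> c G"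
    by (induction F rule: poly_mapping_sum_induct) (simp_all add: distrib_right mlin_add *)
  show "mlin \<phi> c (1 :: 't \<Rightarrow>\<^sub>0 'a) = 1"
    using mlin_single[of c 0 1] by (simp add: c one)
qed

lemma ring_map_mlin_mon: "ring_map (mlin \<phi> (mon a))"
  by (rule ring_map_mlin) (simp_all add: mon_add)

end

lemma ring_map_mpol_eval: "ring_map (mpol_eval a)"
  unfolding mpol_eval_mlin[abs_def] by (rule ring_map.ring_map_mlin_mon[OF ring_map_id])

lemma mpol_eval_single [simp]: "mpol_eval a (single t x) = x * mon a t"
  by (simp add: mpol_eval_def mon_def)

subsection \<open>Ideals\<close>

lemma module_mult: "module ((*) :: 'a::comm_ring_1 \<Rightarrow> 'a \<Rightarrow> 'a)"
  by unfold_locales (simp_all add: algebra_simps)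

lemma ideal_gen_base: "x \<in> S \<Longrightarrow> x \<in> ideal_gen S"
  unfolding ideal_gen_def by (rule module.span_base[OF module_mult])

lemma ideal_gen_zero [simp]: "0 \<in> ideal_gen S"
  unfolding ideal_gen_def by (rule module.span_zero[OF module_mult])

lemma ideal_gen_add: "x \<in> ideal_gen S \<Longrightarrow> y \<in> ideal_gen S \<Longrightarrow> x + y \<in> ideal_gen S"
  unfolding ideal_gen_def by (rule module.span_add[OF module_mult])

lemma ideal_gen_mult: "x \<in> ideal_gen S \<Longrightarrow> c * x \<in> ideal_gen S"
  unfolding ideal_gen_def by (rule module.span_scale[OF module_mult])

lemma ideal_gen_induct [consumes 1, case_names zero gen add]:
  assumes "x \<in> ideal_gen S" "P 0" "\<And>c x. x \<in> S \<Longrightarrow> P (c * x)" "\<And>x y. P x \<Longrightarrow> P y \<Longrightarrow> P (x + y)"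
  shows "P x"
proof (rule module.span_induct_alt[OF module_mult])
  show "x \<in> module.span (*) S" using assms(1) by (simp add: ideal_gen_def)
qed (use assms(2-4) in auto)

definition is_ideal :: "'a::comm_ring_1 set \<Rightarrow> bool" where
  "is_ideal I \<longleftrightarrow> 0 \<in> I \<and> (\<forall>x\<in>I. \<forall>y\<in>I. x + y \<in> I) \<and> (\<forall>x\<in>I. \<forall>c. c * x \<in> I)"

lemma is_idealD:
  assumes "is_ideal I"
  shows "0 \<in> I" "x \<in> I \<Longrightarrow> y \<in> I \<Longrightarrow> x + y \<in> I" "x \<in> I \<Longrightarrow> c * x \<in> I" "x \<in> I \<Longrightarrow> x * c \<in> I"
    "x \<in> I \<Longrightarrow> - x \<in> I" "x \<in> I \<Longrightarrow> y \<in> I \<Longrightarrow> x - y \<in> I"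
proof -
  show *: "0 \<in> I" "x \<in> I \<Longrightarrow> y \<in> I \<Longrightarrow> x + y \<in> I" "x \<in> I \<Longrightarrow> c * x \<in> I" for x y c
    using assms by (auto simp: is_ideal_def)
  show "x \<in> I \<Longrightarrow> x * c \<in> I" using *(3) by (metis mult.commute)
  show **: "x \<in> I \<Longrightarrow> - x \<in> I" for x using *(3)[of x "-1"] by simp
  show "x \<in> I \<Longrightarrow> y \<in> I \<Longrightarrow> x - y \<in> I" using *(2)[of x "- y"] **[of y] by simp
qed

lemma is_ideal_sum: "is_ideal I \<Longrightarrow> (\<And>x. x \<in> S \<Longrightarrow> f x \<in> I) \<Longrightarrow> sum f S \<in> I"
  by (induction S rule: infinite_finite_induct) (auto intro: is_idealD)

lemma is_ideal_gen: "is_ideal (ideal_gen S)"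
  unfolding is_ideal_def by (auto intro: ideal_gen_add ideal_gen_mult)

lemma ideal_gen_minimal: "S \<subseteq> I \<Longrightarrow> is_ideal I \<Longrightarrow> ideal_gen S \<subseteq> I"
proof
  fix x assume "S \<subseteq> I" "is_ideal I" "x \<in> ideal_gen S"
  from this(3,1,2) show "x \<in> I"
    by (induction rule: ideal_gen_induct) (auto intro: is_idealD)
qed

lemma is_ideal_power: "is_ideal (ideal_power I m)"
  by (cases m) (simp_all add: is_ideal_def[of UNIV] ideal_mult_def is_ideal_gen)

lemma is_ideal_of: "is_ideal (ideal_of Z)"
  by (simp add: ideal_of_def is_ideal_gen)

lemma ideal_power_SucI: "x \<in> I \<Longrightarrow> y \<in> ideal_power I m \<Longrightarrow> x * y \<in> ideal_power I (Suc m)"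
  by (auto simp: ideal_mult_def intro!: ideal_gen_base)

lemma ideal_power_add:
  assumes "x \<in> ideal_power I m" "y \<in> ideal_power I l"
  shows "x * y \<in> ideal_power I (m + l)"
  using assms(1)
proof (induction m arbitrary: x)
  case 0
  then show ?case using assms(2) by (auto intro: is_idealD is_ideal_power)
next
  case (Suc m)
  from Suc.prems have "x \<in> ideal_gen {a * b |a b. a \<in> I \<and> b \<in> ideal_power I m}"
    by (simp add: ideal_mult_def)
  then show ?case
  proof (induction rule: ideal_gen_induct)
    case zero then show ?case using is_idealD(1)[OF is_ideal_power] by (simp del: ideal_power.simps)
  next
    case (gen c x)
    then obtain a b where ab: "x = a * b" "a \<in> I" "b \<in> ideal_power I m" by blast
    then have "c * (a * (b * y)) \<in> ideal_power I (Suc (m + l))"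
      by (intro is_idealD(3)[OF is_ideal_power] ideal_power_SucI Suc.IH)
    moreover have "c * x * y = c * (a * (b * y))" by (simp add: ab(1) mult.assoc)
    ultimately show ?case by (simp only: add_Suc)
  next
    case (add x x')
    then show ?case using is_idealD(2)[OF is_ideal_power] by (simp add: distrib_right del: ideal_power.simps)
  qed
qed

lemma ideal_power_1: "is_ideal I \<Longrightarrow> ideal_power I (Suc 0) = I"
proof -
  assume I: "is_ideal I"
  have "ideal_power I (Suc 0) \<subseteq> I"
    unfolding ideal_power.simps ideal_mult_def by (rule ideal_gen_minimal) (auto intro: is_idealD I)
  moreover have "x \<in> ideal_power I (Suc 0)" if "x \<in> I" for x
    using ideal_power_SucI[OF that, of 1 0] by simp
  ultimately show ?thesis by blast
qed

lemma ideal_power_Suc_subset: "ideal_power I (Suc m) \<subseteq> ideal_power I m"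
  unfolding ideal_power.simps ideal_mult_def
  by (rule ideal_gen_minimal) (auto intro: is_idealD is_ideal_power)

lemma ideal_power_antimono: "m \<le> l \<Longrightarrow> ideal_power I l \<subseteq> ideal_power I m"
  by (induction rule: dec_induct) (use ideal_power_Suc_subset in blast)+

lemma power_in_ideal_power: "x \<in> ideal_power I m \<Longrightarrow> x ^ k \<in> ideal_power I (m * k)"
  by (induction k) (simp_all add: ideal_power_add)

lemma prod_in_ideal_power:
  "(\<And>i. i \<in> S \<Longrightarrow> f i \<in> ideal_power I (m i)) \<Longrightarrow> prod f S \<in> ideal_power I (sum m S)"
  by (induction S rule: infinite_finite_induct) (simp_all add: ideal_power_add)

lemma prod_list_in_ideal_power:
  "(\<And>x. x \<in> set xs \<Longrightarrow> x \<in> I) \<Longrightarrow> prod_list xs \<in> ideal_power I (length xs)"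
  by (induction xs) (simp_all add: ideal_power_SucI del: ideal_power.simps(2))

text \<open>Every term of the binomial expansion of \<open>(x + y) ^ (k + l)\<close> contains at
  least \<open>k\<close> factors \<open>x\<close> or at least \<open>l\<close> factors
  \<open>y\<close>.\<close>

lemma radical_add:
  assumes J: "is_ideal J" and "x ^ k \<in> J" "y ^ l \<in> J"
  shows "\<exists>m. (x + y) ^ m \<in> J"
proof -
  have "(of_nat (k + l choose i) * x ^ i) * y ^ (k + l - i) \<in> J" if "i \<le> k + l" for i
  proof (cases "k \<le> i")
    case True
    then have "x ^ i = x ^ (i - k) * x ^ k" by (simp flip: power_add)
    then have "x ^ i \<in> J" using is_idealD(3)[OF J assms(2)] by simp
    then show ?thesis by (intro is_idealD(3,4)[OF J])
  next
    case False
    then have "y ^ (k + l - i) = y ^ (k - i) * y ^ l" by (simp flip: power_add)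
    then have "y ^ (k + l - i) \<in> J" using is_idealD(3)[OF J assms(3)] by simp
    then show ?thesis by (intro is_idealD(3)[OF J])
  qed
  then have "(x + y) ^ (k + l) \<in> J"
    unfolding binomial_ring by (intro is_ideal_sum[OF J]) simp
  then show ?thesis by blast
qed

lemma radical_sum:
  assumes J: "is_ideal J" and "finite S" "\<And>i. i \<in> S \<Longrightarrow> \<exists>k. f i ^ k \<in> J"
  shows "\<exists>m. (sum f S) ^ m \<in> J"
  using assms(2,3)
proof (induction S rule: finite_induct)
  case empty
  have "(0::'a) ^ 1 \<in> J" using is_idealD(1)[OF J] by simp
  then show ?case by (metis sum.empty)
next
  case (insert i S)
  then obtain k l where "f i ^ k \<in> J" "sum f S ^ l \<in> J" by blast
  from radical_add[OF J this] show ?case using insert by simp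
qed

subsection \<open>Forms\<close>

lemma monom_deg_superset: "finite S \<Longrightarrow> keys t \<subseteq> S \<Longrightarrow> monom_deg t = (\<Sum>i\<in>S. lookup t i)"
  unfolding monom_deg_def by (rule sum.mono_neutral_left) (auto simp: in_keys_iff)

lemma monom_deg_add: "monom_deg (s + t) = monom_deg s + monom_deg t"
proof -
  have "monom_deg (s + t) = (\<Sum>i\<in>keys s \<union> keys t. lookup (s + t) i)"
    by (rule monom_deg_superset) (use Poly_Mapping.keys_add[of s t] in auto)
  moreover have "monom_deg s = (\<Sum>i\<in>keys s \<union> keys t. lookup s i)"
    "monom_deg t = (\<Sum>i\<in>keys s \<union> keys t. lookup t i)"
    by (rule monom_deg_superset; auto)+
  ultimately show ?thesis by (simp add: lookup_add sum.distrib)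
qed

lemma monom_deg_zero [simp]: "monom_deg 0 = 0"
  by (simp add: monom_deg_def)

lemma monom_deg_single [simp]: "monom_deg (single i n) = n"
  by (simp add: monom_deg_def)

lemma monom_deg_UNIV: "monom_deg (t :: 'v::finite \<Rightarrow>\<^sub>0 nat) = (\<Sum>i\<in>UNIV. lookup t i)"
  by (rule monom_deg_superset) auto

lemma monom_deg_option:
  "monom_deg (t :: 'n::finite option \<Rightarrow>\<^sub>0 nat) = lookup t None + (\<Sum>j\<in>UNIV. lookup t (Some j))"
  by (simp add: monom_deg_UNIV UNIV_option_conv sum.reindex)

lemma homogeneous_zero [simp]: "homogeneous d 0"
  by (simp add: homogeneous_def)

lemma homogeneous_single: "monom_deg t = d \<Longrightarrow> homogeneous d (single t c)"
  by (simp add: homogeneous_def)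

lemma homogeneous_add:
  "homogeneous d F \<Longrightarrow> homogeneous d G \<Longrightarrow> homogeneous d (F + G)"
  using Poly_Mapping.keys_add[of F G] by (auto simp: homogeneous_def)

lemma homogeneous_uminus: "homogeneous d F \<Longrightarrow> homogeneous d (- F :: ('v, 'a::ab_group_add) mpol)"
  by (auto simp: homogeneous_def in_keys_iff)

lemma homogeneous_diff:
  "homogeneous d F \<Longrightarrow> homogeneous d G \<Longrightarrow> homogeneous d (F - G :: ('v, 'a::ab_group_add) mpol)"
  using homogeneous_add[of d F "- G"] homogeneous_uminus[of d G] by simp

lemma homogeneous_sum: "(\<And>x. x \<in> S \<Longrightarrow> homogeneous d (f x)) \<Longrightarrow> homogeneous d (sum f S)"
  by (induction S rule: infinite_finite_induct) (auto intro: homogeneous_add)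

lemma homogeneous_mult:
  "homogeneous d F \<Longrightarrow> homogeneous e G \<Longrightarrow> homogeneous (d + e) (F * G :: ('v, 'a::semiring_0) mpol)"
  using Poly_Mapping.keys_mult[of F G] by (fastforce simp: homogeneous_def monom_deg_add)

lemma homogeneous_one [simp]: "homogeneous 0 (1 :: ('v, 'a::comm_ring_1) mpol)"
  by (simp add: homogeneous_def)

lemma homogeneous_prod:
  "(\<And>x. x \<in> S \<Longrightarrow> homogeneous (d x) (f x)) \<Longrightarrow>
    homogeneous (sum d S) (prod f S :: ('v, 'a::comm_ring_1) mpol)"
  by (induction S rule: infinite_finite_induct) (auto intro: homogeneous_mult)

lemma homogeneous_power:
  "homogeneous d F \<Longrightarrow> homogeneous (k * d) (F ^ k :: ('v, 'a::comm_ring_1) mpol)"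
  by (induction k) (auto intro: homogeneous_mult)

definition var :: "'v \<Rightarrow> ('v, 'a::comm_ring_1) mpol" where
  "var i = single (single i 1) 1"

lemma var_mult_single: "var i * single t c = single (single i 1 + t) c"
  by (simp add: var_def mult_single)

lemma var_power: "var i ^ n = single (single i n) 1"
  by (induction n) (simp_all add: var_def mult_single single_one flip: single_add)

lemma homogeneous_var: "homogeneous 1 (var i)"
  by (simp add: var_def homogeneous_single)

lemma const_mult_single: "single 0 c * single t x = single t (c * x)"
  by (simp add: mult_single)

lemma homogeneous_const_mult:
  "homogeneous d F \<Longrightarrow> homogeneous d (single 0 c * F :: ('v, 'a::comm_ring_1) mpol)"
  using homogeneous_mult[of 0 "single 0 c" d F] by (simp add: homogeneous_single)

lemma single_prod: "(\<Prod>x\<in>S. single (f x) (c x)) = single (sum f S) (prod c S)"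
  for c :: "'x \<Rightarrow> 'a::comm_ring_1" and f :: "'x \<Rightarrow> 't::comm_monoid_add"
  by (induction S rule: infinite_finite_induct) (simp_all add: mult_single)

lemma sum_single_lookup: "(\<Sum>i\<in>UNIV. single i (lookup t i)) = t"
  for t :: "'v::finite \<Rightarrow>\<^sub>0 nat"
proof -
  have "(\<Sum>i\<in>UNIV. single i (lookup t i)) = (\<Sum>i\<in>keys t. single i (lookup t i))"
    by (rule sum.mono_neutral_right) (auto simp: in_keys_iff)
  then show ?thesis using sum_single[of t] by simp
qed

lemma single_eq_prod_var:
  "single t 1 = (var None ^ lookup t None * (\<Prod>j\<in>UNIV. var (Some j) ^ lookup t (Some j)) :: ('n::finite option, 'a::comm_ring_1) mpol)"
proof -
  have "(\<Prod>i\<in>UNIV. var i ^ lookup t i) = (single t 1 :: ('n option, 'a) mpol)"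
    by (simp add: var_power single_prod sum_single_lookup)
  then show ?thesis
    by (simp add: UNIV_option_conv prod.reindex)
qed

lemma prod_option: "prod f (UNIV :: 'n::finite option set) = f None * (\<Prod>j\<in>UNIV. f (Some j))"
  by (simp add: UNIV_option_conv prod.reindex)

subsection \<open>Hasse derivatives and the ideal of a point\<close>

text \<open>The value at \<open>x\<close> of the \<open>m\<close>-th Hasse derivative of \<open>X\<^sup>u\<close>; dividing by factorials is avoided, so
  that the definition works in every characteristic.\<close>

definition hasse1 :: "'a::comm_ring_1 \<Rightarrow> nat \<Rightarrow> nat \<Rightarrow> 'a" where
  "hasse1 x m u = of_nat (u choose m) * x ^ (u - m)"

definition hcoef :: "('n::finite \<Rightarrow> 'a::comm_ring_1) \<Rightarrow> ('n \<Rightarrow> nat) \<Rightarrow> ('n option \<Rightarrow>\<^sub>0 nat) \<Rightarrow> 'a" where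
  "hcoef a w t = (\<Prod>j\<in>UNIV. hasse1 (a j) (w j) (lookup t (Some j)))"

text \<open>Only the coordinates \<open>Some j\<close> are differentiated and
  \<open>x\<^sub>0\<close> is set to 1: these are the Taylor coefficients at \<open>a\<close> of the
  dehomogenized polynomial.\<close>

definition hasse :: "('n::finite \<Rightarrow> 'a::comm_ring_1) \<Rightarrow> ('n \<Rightarrow> nat) \<Rightarrow> ('n option, 'a) mpol \<Rightarrow> 'a" where
  "hasse a w F = mlin (\<lambda>x. x) (hcoef a w) F"

lemmas hasse_add = ring_map.mlin_add[OF ring_map_id, of "hcoef a w" for a w, folded hasse_def]
lemmas hasse_diff = ring_map.mlin_diff[OF ring_map_id, of "hcoef a w" for a w, folded hasse_def]
lemmas hasse_zero [simp] = ring_map.mlin_zero[OF ring_map_id, of "hcoef a w" for a w, folded hasse_def]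
lemmas hasse_single [simp] = ring_map.mlin_single[OF ring_map_id, of "hcoef a w" for a w, folded hasse_def]
lemma hasse_const_mult: "hasse a w (single 0 c * F) = c * hasse a w F"
  by (induction F rule: poly_mapping_sum_induct)
     (simp_all add: distrib_left hasse_add mult_single mult.assoc)

lemma hasse_var_None: "hasse a w (var None * F) = hasse a w F"
  by (induction F rule: poly_mapping_sum_induct)
     (simp_all add: distrib_left hasse_add var_mult_single hcoef_def lookup_add lookup_single)

text \<open>Pascal's rule. It says that multiplication by \<open>X - x\<close> shifts the Taylor
  coefficients at \<open>x\<close> by one; the case distinction serves the truncated
  exponents.\<close>

lemma hasse1_Suc: "hasse1 x m (Suc u) - x * hasse1 x m u = (if m = 0 then 0 else hasse1 x (m - 1) u)"
proof (cases m)
  case (Suc l)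
  consider "u < l" | "u = l" | "u > l" by linarith
  then show ?thesis
  proof cases
    case 3
    then have "Suc u - m = Suc (u - m)" "u - l = Suc (u - m)" using Suc by auto
    then show ?thesis using Suc by (simp add: hasse1_def algebra_simps)
  qed (simp_all add: hasse1_def Suc binomial_eq_0)
qed (simp add: hasse1_def)

definition linform :: "('n \<Rightarrow> 'a::comm_ring_1) \<Rightarrow> 'n \<Rightarrow> ('n option, 'a) mpol" where
  "linform a j = var (Some j) - single 0 (a j) * var None"

lemma homogeneous_linform: "homogeneous 1 (linform a j)"
  unfolding linform_def by (intro homogeneous_diff homogeneous_const_mult homogeneous_var)

text \<open>After setting \<open>x\<^sub>0 = 1\<close>, \<open>linform a j\<close> is a local
  coordinate at \<open>a\<close>, so multiplying by it shifts the Taylor expansion by one step in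
  direction \<open>j\<close>.\<close>

lemma hasse_linform:
  "hasse a w (linform a j * F) = (if w j = 0 then 0 else hasse a (w(j := w j - 1)) F)"
proof (induction F rule: poly_mapping_sum_induct)
  case (single t c)
  have rest: "(\<Prod>k\<in>UNIV - {j}. hasse1 (a k) (w k) (lookup (single (Some j) 1 + t) (Some k))) =
      (\<Prod>k\<in>UNIV - {j}. hasse1 (a k) (w k) (lookup t (Some k)))"
    "(\<Prod>k\<in>UNIV - {j}. hasse1 (a k) ((w(j := w j - 1)) k) (lookup t (Some k))) =
      (\<Prod>k\<in>UNIV - {j}. hasse1 (a k) (w k) (lookup t (Some k)))"
    by (auto intro!: prod.cong simp: lookup_add lookup_single when_def)
  have split: "hcoef a v s = hasse1 (a j) (v j) (lookup s (Some j)) *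
      (\<Prod>k\<in>UNIV - {j}. hasse1 (a k) (v k) (lookup s (Some k)))" for v s
    unfolding hcoef_def by (rule prod.remove) auto
  have "hcoef a w (single (Some j) 1 + t) - a j * hcoef a w t =
      (hasse1 (a j) (w j) (Suc (lookup t (Some j))) - a j * hasse1 (a j) (w j) (lookup t (Some j))) *
      (\<Prod>k\<in>UNIV - {j}. hasse1 (a k) (w k) (lookup t (Some k)))"
    unfolding split[of w] rest by (simp add: lookup_add algebra_simps)
  also have "\<dots> = (if w j = 0 then 0 else hcoef a (w(j := w j - 1)) t)"
    unfolding hasse1_Suc using split[of "w(j := w j - 1)" t] unfolding rest by simp
  finally have *: "hcoef a w (single (Some j) 1 + t) - a j * hcoef a w t =
    (if w j = 0 then 0 else hcoef a (w(j := w j - 1)) t)" .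
  have "hasse a w (linform a j * single t c) = c * (hcoef a w (single (Some j) 1 + t) - a j * hcoef a w t)"
  proof -
    have "linform a j * single t c = single (single (Some j) 1 + t) c - single 0 (a j) * (var None * single t c)"
      by (simp add: linform_def left_diff_distrib var_mult_single mult.assoc)
    then show ?thesis by (simp only: hasse_diff hasse_const_mult hasse_var_None hasse_single) (simp add: algebra_simps)
  qed
  then show ?case unfolding * by (cases "w j = 0") simp_all
qed (cases "w j = 0"; simp add: distrib_left hasse_add)+

lemma hasse_eval: "hasse (a :: 'n::finite \<Rightarrow> 'a::comm_ring_1) (\<lambda>_. 0) F = mpol_eval (case_option 1 a) F"
proof -
  have "hcoef a (\<lambda>_. 0) t = mon (case_option 1 a) t" for t
    by (subst mon_superset[of UNIV]) (simp_all add: hcoef_def hasse1_def prod_option)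
  then show ?thesis by (simp add: hasse_def mpol_eval_mlin mlin_def)
qed

text \<open>Taylor expansion at \<open>a\<close>, made homogeneous again by powers of
  \<open>x\<^sub>0\<close>. The sum runs over a box for convenience: indices of total degree above
  \<open>d\<close> have coefficient 0, so the truncated exponent of \<open>x\<^sub>0\<close> does no
  harm there.\<close>

lemma hasse_taylor:
  fixes F :: "('n::finite option, 'a::comm_ring_1) mpol"
  assumes "homogeneous d F"
  shows "F = (\<Sum>w\<in>PiE UNIV (\<lambda>_. {..d}). single 0 (hasse a w F) * var None ^ (d - sum w UNIV) *
    (\<Prod>j\<in>UNIV. linform a j ^ w j))" (is "F = ?T F")
proof -
  have mono: "single t c = ?T (single t c)" if t: "monom_deg t = d" for t and c :: 'a
  proof -
    let ?u = "\<lambda>j. lookup t (Some j)"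
    let ?a = "\<lambda>j. single 0 (a j) :: ('n option, 'a) mpol"
    have ud: "?u j \<le> d" for j
    proof -
      have "?u j \<le> (\<Sum>j\<in>UNIV. ?u j)" by (rule member_le_sum) auto
      then show ?thesis using t by (simp add: monom_deg_option)
    qed
    \<comment> \<open>The variable is written as \<open>linform a j\<close> plus \<open>a j\<close>
      times \<open>x\<^sub>0\<close>. Extending the binomial sum to the common range up to
      \<open>d\<close> allows the product over \<open>j\<close> to be expanded over a box.\<close>
    have pw: "var (Some j) ^ ?u j = (\<Sum>i\<le>d. single 0 (hasse1 (a j) i (?u j)) * var None ^ (?u j - i) * linform a j ^ i)" for j
    proof -
      have "var (Some j) ^ ?u j = (linform a j + ?a j * var None) ^ ?u j"
        by (simp add: linform_def)
      also have "\<dots> = (\<Sum>i\<le>?u j. of_nat (?u j choose i) * linform a j ^ i * (?a j * var None) ^ (?u j - i))"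
        by (rule binomial_ring)
      also have "\<dots> = (\<Sum>i\<le>d. of_nat (?u j choose i) * linform a j ^ i * (?a j * var None) ^ (?u j - i))"
        by (rule sum.mono_neutral_left) (use ud in \<open>auto simp: binomial_eq_0\<close>)
      also have "\<dots> = (\<Sum>i\<le>d. single 0 (hasse1 (a j) i (?u j)) * var None ^ (?u j - i) * linform a j ^ i)"
      proof (rule sum.cong)
        fix i
        have "?a j ^ k = single 0 (a j ^ k)" for k
          by (induction k) (simp_all add: mult_single)
        then have "(of_nat (?u j choose i) :: ('n option, 'a) mpol) * ?a j ^ (?u j - i) = single 0 (hasse1 (a j) i (?u j))"
          by (simp add: hasse1_def mult_single flip: single_of_nat)
        then show "of_nat (?u j choose i) * linform a j ^ i * (?a j * var None) ^ (?u j - i) =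
          single 0 (hasse1 (a j) i (?u j)) * var None ^ (?u j - i) * linform a j ^ i"
          by (simp add: power_mult_distrib mult_ac)
      qed simp
      finally show ?thesis .
    qed
    have "single t c = single 0 c * var None ^ lookup t None * (\<Prod>j\<in>UNIV. var (Some j) ^ ?u j)"
      using const_mult_single[of c t 1] by (simp add: single_eq_prod_var[of t] mult.assoc)
    also have "\<dots> = (\<Sum>w\<in>PiE UNIV (\<lambda>_. {..d}). single 0 c * var None ^ lookup t None *
       (\<Prod>j\<in>UNIV. single 0 (hasse1 (a j) (w j) (?u j)) * var None ^ (?u j - w j) * linform a j ^ w j))"
      unfolding pw by (subst prod_sum_PiE) (simp_all add: sum_distrib_left)
    also have "\<dots> = ?T (single t c)"
    proof (rule sum.cong)
      fix w :: "'n \<Rightarrow> nat"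
      have eq: "(\<Prod>j\<in>UNIV. single 0 (hasse1 (a j) (w j) (?u j)) * var None ^ (?u j - w j) * linform a j ^ w j)
        = single 0 (hcoef a w t) * var None ^ (\<Sum>j\<in>UNIV. ?u j - w j) * (\<Prod>j\<in>UNIV. linform a j ^ w j)"
        by (simp add: prod.distrib single_prod hcoef_def power_sum)
      have e1: "single 0 (hcoef a w t) * var None ^ (lookup t None + (\<Sum>j\<in>UNIV. ?u j - w j))
        = (single 0 (hcoef a w t) * var None ^ (d - sum w UNIV) :: ('n option, 'a) mpol)"
      proof (cases "\<forall>j. w j \<le> ?u j")
        case True
        then have "(\<Sum>j\<in>UNIV. ?u j - w j) = sum ?u UNIV - sum w UNIV" "sum w UNIV \<le> sum ?u UNIV"
          by (auto intro: sum_subtractf_nat sum_mono)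
        then show ?thesis using t by (simp add: monom_deg_option)
      next
        case False
        then obtain j where "?u j < w j" by (auto simp: not_le)
        then have "hasse1 (a j) (w j) (?u j) = 0" by (simp add: hasse1_def binomial_eq_0)
        then have "hcoef a w t = 0"
          unfolding hcoef_def by (intro prod_zero) auto
        then show ?thesis by simp
      qed
      have e2: "single 0 c * var None ^ lookup t None * (single 0 (hcoef a w t) * var None ^ (\<Sum>j\<in>UNIV. ?u j - w j) * (\<Prod>j\<in>UNIV. linform a j ^ w j))
        = single 0 c * (single 0 (hcoef a w t) * var None ^ (lookup t None + (\<Sum>j\<in>UNIV. ?u j - w j))) * (\<Prod>j\<in>UNIV. linform a j ^ w j)"
        by (simp add: power_add mult_ac)
      have e3: "single 0 (hasse a w (single t c)) = single 0 c * single 0 (hcoef a w t)"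
        by (simp add: mult_single)
      show "single 0 c * var None ^ lookup t None *
         (\<Prod>j\<in>UNIV. single 0 (hasse1 (a j) (w j) (?u j)) * var None ^ (?u j - w j) * linform a j ^ w j)
        = single 0 (hasse a w (single t c)) * var None ^ (d - sum w UNIV) * (\<Prod>j\<in>UNIV. linform a j ^ w j)"
        unfolding eq e2 e1 e3 by (simp only: mult.assoc)
    qed simp
    finally show ?thesis .
  qed
  have Tadd: "?T (G + H) = ?T G + ?T H" for G H
    by (simp add: hasse_add single_add distrib_right sum.distrib)
  have "F = ?T F"
  proof (induction F rule: poly_mapping_sum_induct)
    case zero show ?case by simp
  next
    case (single t c) then show ?case by (intro mono) (use assms in \<open>auto simp: homogeneous_def\<close>)
  next
    case (add F G) then show ?case using Tadd[of F G] by simp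
  qed
  then show ?thesis .
qed

lemma mpol_eval_homogeneous:
  assumes "homogeneous d F"
  shows "mpol_eval (\<lambda>i. c * v i) F = c ^ d * mpol_eval v F"
proof -
  have "mon (\<lambda>i. c * v i) t = c ^ monom_deg t * mon v t" for t
    by (simp add: mon_def monom_deg_def power_mult_distrib prod.distrib power_sum)
  then show ?thesis using assms
    by (auto simp: mpol_eval_def homogeneous_def sum_distrib_left mult_ac simp flip: mon_def intro!: sum.cong)
qed

lemma hom_coords_affine_point:
  "hom_coords (affine_point a) = {w. proportional (case_option 1 a) w}"
  by transfer simp

lemma vanishes_at_affine_point:
  assumes "homogeneous d F"
  shows "vanishes_at F (affine_point a) \<longleftrightarrow> mpol_eval (case_option 1 a) F = 0"
proof -
  have "case_option 1 a \<noteq> (\<lambda>_. 0)" by (auto dest: fun_cong[of _ _ None])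
  then have "proportional (case_option 1 a) (case_option 1 a)"
    unfolding proportional_def by (intro conjI exI[of _ 1]) simp_all
  then show ?thesis unfolding vanishes_at_def hom_coords_affine_point
    by (auto simp: proportional_def mpol_eval_homogeneous[OF assms])
qed

definition point_ideal :: "('n \<Rightarrow> 'k::field) \<Rightarrow> ('n option, 'k) mpol set" where
  "point_ideal a = ideal_of {affine_point a}"

lemma is_ideal_point_ideal: "is_ideal (point_ideal a)"
  by (simp add: point_ideal_def is_ideal_of)

lemma linform_in_point_ideal: "linform a j \<in> point_ideal a" for a :: "'n::finite \<Rightarrow> 'k::field"
proof -
  have "hasse a (\<lambda>_. 0) (linform a j) = 0" using hasse_linform[of a "\<lambda>_. 0" j 1] by simp
  then have "vanishes_at (linform a j) (affine_point a)"
    using vanishes_at_affine_point[OF homogeneous_linform[of a j], of a] by (simp add: hasse_eval)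
  then show ?thesis unfolding point_ideal_def ideal_of_def
    using homogeneous_linform[of a j] by (intro ideal_gen_base) auto
qed

text \<open>In the Taylor expansion only terms with at least \<open>m\<close> linear factors
  survive. The ideal is kept general because the case \<open>m = 1\<close> is first applied to the
  ideal generated by the linear forms, to identify it with the ideal of the point.\<close>

lemma hasse_zero_imp_ideal_power:
  fixes F :: "('n::finite option, 'k::field) mpol"
  assumes hom: "homogeneous d F" and I: "is_ideal I" "\<And>j. linform a j \<in> I"
    and z: "\<And>w. sum w UNIV < m \<Longrightarrow> hasse a w F = 0"
  shows "F \<in> ideal_power I m"
proof -
  have "single 0 (hasse a w F) * var None ^ (d - sum w UNIV) * (\<Prod>j\<in>UNIV. linform a j ^ w j) \<in> ideal_power I m" for w
  proof (cases "sum w UNIV < m")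
    case True
    then show ?thesis using z[of w] is_idealD(1)[OF is_ideal_power] by simp
  next
    case False
    have "linform a j ^ w j \<in> ideal_power I (w j)" for j
      using power_in_ideal_power[of "linform a j" I 1 "w j"] I(2) ideal_power_1[OF I(1)] by simp
    then have "(\<Prod>j\<in>UNIV. linform a j ^ w j) \<in> ideal_power I (sum w UNIV)"
      by (rule prod_in_ideal_power)
    then have "(\<Prod>j\<in>UNIV. linform a j ^ w j) \<in> ideal_power I m"
      using False ideal_power_antimono[of m "sum w UNIV" I] by auto
    then show ?thesis by (rule is_idealD(3)[OF is_ideal_power])
  qed
  then show ?thesis
    by (subst hasse_taylor[OF hom, of a]) (intro is_ideal_sum is_ideal_power)
qed

lemma point_ideal_eq: "point_ideal a = ideal_gen (range (linform a))" for a :: "'n::finite \<Rightarrow> 'k::field"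
proof
  show "ideal_gen (range (linform a)) \<subseteq> point_ideal a"
    by (rule ideal_gen_minimal) (auto intro: linform_in_point_ideal is_ideal_point_ideal)
  show "point_ideal a \<subseteq> ideal_gen (range (linform a))"
    unfolding point_ideal_def ideal_of_def
  proof (rule ideal_gen_minimal, safe)
    fix F :: "('n option, 'k) mpol" and d
    assume F: "homogeneous d F" and "\<forall>P\<in>{affine_point a}. vanishes_at F P"
    then have "hasse a (\<lambda>_. 0) F = 0"
      using vanishes_at_affine_point[OF F, of a] by (simp add: hasse_eval)
    moreover have "w = (\<lambda>_. 0)" if "sum w UNIV < Suc 0" for w :: "'n \<Rightarrow> nat"
      using that by (simp add: fun_eq_iff)
    ultimately have "hasse a w F = 0" if "sum w UNIV < Suc 0" for w
      using that by blast
    then have "F \<in> ideal_power (ideal_gen (range (linform a))) (Suc 0)"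
      by (intro hasse_zero_imp_ideal_power[OF F is_ideal_gen]) (auto intro: ideal_gen_base)
    then show "F \<in> ideal_gen (range (linform a))"
      by (simp add: ideal_power_1 is_ideal_gen del: ideal_power.simps)
  qed (rule is_ideal_gen)
qed

text \<open>Peeling off one linear form turns a derivative of order below \<open>m + 1\<close> into
  one of order below \<open>m\<close>, or into zero.\<close>

lemma hasse_ideal_power:
  fixes a :: "'n::finite \<Rightarrow> 'k::field"
  assumes "G \<in> ideal_power (point_ideal a) m" "sum w UNIV < m"
  shows "hasse a w G = 0"
  using assms
proof (induction m arbitrary: G w)
  case (Suc m)
  have *: "\<forall>g\<in>ideal_power (point_ideal a) m. hasse a w (f * g) = 0" if "f \<in> ideal_gen (range (linform a))" for f
    using that
  proof (induction rule: ideal_gen_induct)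
    case (gen c x)
    then obtain j where x: "x = linform a j" by blast
    show ?case
    proof
      fix g assume "g \<in> ideal_power (point_ideal a) m"
      then have cg: "c * g \<in> ideal_power (point_ideal a) m" by (intro is_idealD(3)[OF is_ideal_power])
      have "c * x * g = linform a j * (c * g)" by (simp add: x mult_ac)
      moreover have "hasse a (w(j := w j - 1)) (c * g) = 0" if "w j \<noteq> 0"
      proof (rule Suc.IH[OF cg])
        have "sum w UNIV = w j + sum w (UNIV - {j})" by (rule sum.remove) auto
        moreover have "sum (w(j := w j - 1)) UNIV = (w j - 1) + sum (w(j := w j - 1)) (UNIV - {j})"
          by (subst sum.remove[of _ j]) auto
        moreover have "sum (w(j := w j - 1)) (UNIV - {j}) = sum w (UNIV - {j})"
          by (rule sum.cong) auto
        ultimately show "sum (w(j := w j - 1)) UNIV < m" using that Suc.prems by linarith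
      qed
      ultimately show "hasse a w (c * x * g) = 0" by (simp add: hasse_linform)
    qed
  qed (simp_all add: distrib_right hasse_add)
  from Suc.prems(1) have "G \<in> ideal_gen {f * g |f g. f \<in> point_ideal a \<and> g \<in> ideal_power (point_ideal a) m}"
    by (simp add: ideal_mult_def)
  then show ?case
  proof (induction rule: ideal_gen_induct)
    case (gen c x)
    then obtain f g where fg: "x = f * g" "f \<in> point_ideal a" "g \<in> ideal_power (point_ideal a) m" by blast
    have "hasse a w (f * (c * g)) = 0"
      using * fg(2,3) is_idealD(3)[OF is_ideal_power] unfolding point_ideal_eq by blast
    then show ?case by (simp add: fg(1) mult_ac)
  qed (simp_all add: hasse_add)
qed simp

lemma ideal_power_point_iff:
  fixes F :: "('n::finite option, 'k::field) mpol"
  assumes "homogeneous d F"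
  shows "F \<in> ideal_power (point_ideal a) m \<longleftrightarrow> (\<forall>w. sum w UNIV < m \<longrightarrow> hasse a w F = 0)"
  using hasse_ideal_power hasse_zero_imp_ideal_power[OF assms is_ideal_point_ideal linform_in_point_ideal]
  by blast

lemma mpol_eval_point_ideal:
  fixes a :: "'n::finite \<Rightarrow> 'k::field"
  shows "F \<in> point_ideal a \<Longrightarrow> mpol_eval (case_option 1 a) F = 0"
  using hasse_ideal_power[of F a "Suc 0" "\<lambda>_. 0"]
  by (simp add: hasse_eval ideal_power_1 is_ideal_point_ideal del: ideal_power.simps)

lemma point_ideal_iff:
  fixes F :: "('n::finite option, 'k::field) mpol"
  assumes "homogeneous d F"
  shows "F \<in> point_ideal a \<longleftrightarrow> mpol_eval (case_option 1 a) F = 0"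
  using mpol_eval_point_ideal assms vanishes_at_affine_point[OF assms]
  by (auto simp: point_ideal_def ideal_of_def intro!: ideal_gen_base)

subsection \<open>Homogeneous linear systems\<close>

text \<open>The restriction to \<open>R\<close> is what makes solutions specializable:
  \<open>R\<close> will consist of the values of prime field polynomials at the generic
  coordinates.\<close>

definition solvable_in :: "'a::idom set \<Rightarrow> ('e \<Rightarrow> 'u \<Rightarrow> 'a) \<Rightarrow> 'e set \<Rightarrow> 'u set \<Rightarrow> bool" where
  "solvable_in R M E U \<longleftrightarrow>
     (\<exists>c. (\<forall>u\<in>U. c u \<in> R) \<and> (\<exists>u\<in>U. c u \<noteq> 0) \<and> (\<forall>e\<in>E. (\<Sum>u\<in>U. M e u * c u) = 0))"

definition subring_set :: "'a::comm_ring_1 set \<Rightarrow> bool" where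
  "subring_set R \<longleftrightarrow> 0 \<in> R \<and> 1 \<in> R \<and> (\<forall>x\<in>R. - x \<in> R) \<and> (\<forall>x\<in>R. \<forall>y\<in>R. x + y \<in> R \<and> x * y \<in> R)"

lemma subring_setD:
  assumes "subring_set R"
  shows "0 \<in> R" "1 \<in> R" "x \<in> R \<Longrightarrow> - x \<in> R" "x \<in> R \<Longrightarrow> y \<in> R \<Longrightarrow> x + y \<in> R"
    "x \<in> R \<Longrightarrow> y \<in> R \<Longrightarrow> x * y \<in> R" "x \<in> R \<Longrightarrow> y \<in> R \<Longrightarrow> x - y \<in> R"
proof -
  show *: "0 \<in> R" "1 \<in> R" "x \<in> R \<Longrightarrow> - x \<in> R" "x \<in> R \<Longrightarrow> y \<in> R \<Longrightarrow> x + y \<in> R"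
    "x \<in> R \<Longrightarrow> y \<in> R \<Longrightarrow> x * y \<in> R" for x y
    using assms by (auto simp: subring_set_def)
  show "x \<in> R \<Longrightarrow> y \<in> R \<Longrightarrow> x - y \<in> R" using *(4)[of x "- y"] *(3)[of y] by simp
qed

lemma subring_set_sum: "subring_set R \<Longrightarrow> (\<And>x. x \<in> S \<Longrightarrow> f x \<in> R) \<Longrightarrow> sum f S \<in> R"
  by (induction S rule: infinite_finite_induct) (auto intro: subring_setD)

lemma subring_set_prod: "subring_set R \<Longrightarrow> (\<And>x. x \<in> S \<Longrightarrow> f x \<in> R) \<Longrightarrow> prod f S \<in> R"
  by (induction S rule: infinite_finite_induct) (auto intro: subring_setD)

lemma subring_set_power: "subring_set R \<Longrightarrow> x \<in> R \<Longrightarrow> x ^ n \<in> R"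
  by (induction n) (auto intro: subring_setD)

lemma subring_set_of_nat: "subring_set R \<Longrightarrow> of_nat n \<in> R"
  by (induction n) (auto intro: subring_setD)

text \<open>Gaussian elimination without division: cross-multiplication with the pivot
  \<open>M e u0\<close> keeps everything inside the ring \<open>R\<close>.\<close>

lemma elimination_step:
  fixes M :: "'e \<Rightarrow> 'u \<Rightarrow> 'a::idom"
  assumes R: "subring_set R" and U: "finite U" "u0 \<in> U"
    and M: "\<And>u. u \<in> U \<Longrightarrow> M e u \<in> R" "M e u0 \<noteq> 0"
    and sol: "solvable_in R (\<lambda>e' u. M e u0 * M e' u - M e' u0 * M e u) E (U - {u0})"
  shows "solvable_in R M (insert e E) U"
proof -
  let ?U = "U - {u0}"
  from sol obtain c where c: "\<And>u. u \<in> ?U \<Longrightarrow> c u \<in> R" "\<exists>u\<in>?U. c u \<noteq> 0"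
    "\<And>e'. e' \<in> E \<Longrightarrow> (\<Sum>u\<in>?U. (M e u0 * M e' u - M e' u0 * M e u) * c u) = 0"
    unfolding solvable_in_def by blast
  \<comment> \<open>Scaling the solution of the reduced system by the pivot lets equation
    \<open>e\<close> be solved for the unknown \<open>u0\<close> without dividing.\<close>
  define c' where "c' u = (if u = u0 then - (\<Sum>u\<in>?U. M e u * c u) else M e u0 * c u)" for u
  have sum: "(\<Sum>u\<in>U. M e' u * c' u) = (\<Sum>u\<in>?U. (M e u0 * M e' u - M e' u0 * M e u) * c u)" for e'
  proof -
    have "(\<Sum>u\<in>U. M e' u * c' u) = M e' u0 * c' u0 + (\<Sum>u\<in>?U. M e' u * c' u)"
      by (rule sum.remove[OF U])
    also have "(\<Sum>u\<in>?U. M e' u * c' u) = (\<Sum>u\<in>?U. M e' u * (M e u0 * c u))"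
      by (rule sum.cong) (auto simp: c'_def)
    also have "M e' u0 * c' u0 + \<dots> = (\<Sum>u\<in>?U. M e' u * (M e u0 * c u)) - (\<Sum>u\<in>?U. M e' u0 * (M e u * c u))"
      by (simp add: c'_def sum_distrib_left)
    also have "\<dots> = (\<Sum>u\<in>?U. (M e u0 * M e' u - M e' u0 * M e u) * c u)"
      unfolding sum_subtractf[symmetric] by (rule sum.cong) (auto simp: algebra_simps)
    finally show ?thesis .
  qed
  have "c' u \<in> R" if "u \<in> U" for u
    using that M(1) c(1) U(2) unfolding c'_def
    by (auto intro!: subring_setD[OF R] subring_set_sum[OF R])
  moreover have "\<exists>u\<in>U. c' u \<noteq> 0" using c(2) M(2) unfolding c'_def by auto
  moreover have "(\<Sum>u\<in>U. M e' u * c' u) = 0" if "e' \<in> insert e E" for e'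
  proof (cases "e' = e")
    case True then show ?thesis unfolding sum by (simp add: mult.commute)
  next
    case False then show ?thesis unfolding sum using that c(3) by blast
  qed
  ultimately show ?thesis unfolding solvable_in_def by blast
qed

lemma solvable_in_trivial_equation:
  "solvable_in R M E U \<Longrightarrow> (\<And>u. u \<in> U \<Longrightarrow> M e u = 0) \<Longrightarrow> solvable_in R M (insert e E) U"
  unfolding solvable_in_def by auto

text \<open>The given solution is carried through the division-free elimination, which shows that
  every reduced system still has a nonzero solution; back substitution then stays in
  \<open>R\<close>.\<close>

lemma solvable_in_subring:
  fixes M :: "'e \<Rightarrow> 'u \<Rightarrow> 'a::idom"
  assumes R: "subring_set R" and "finite E" "finite U"
    and "\<And>e u. e \<in> E \<Longrightarrow> u \<in> U \<Longrightarrow> M e u \<in> R" "solvable_in UNIV M E U"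
  shows "solvable_in R M E U"
  using assms(2-)
proof (induction E arbitrary: M U rule: finite_induct)
  case empty
  then show ?case unfolding solvable_in_def
    by (intro exI[of _ "\<lambda>_. 1"]) (auto intro: subring_setD[OF R])
next
  case (insert e E)
  from insert.prems(3) obtain f where f: "\<exists>u\<in>U. f u \<noteq> 0"
    "\<And>e'. e' \<in> insert e E \<Longrightarrow> (\<Sum>u\<in>U. M e' u * f u) = 0"
    unfolding solvable_in_def by blast
  show ?case
  proof (cases "\<forall>u\<in>U. M e u = 0")
    case True
    have "solvable_in R M E U"
      by (rule insert.IH) (use insert.prems f in \<open>auto simp: solvable_in_def\<close>)
    then show ?thesis by (rule solvable_in_trivial_equation) (use True in blast)
  next
    case False
    then obtain u0 where u0: "u0 \<in> U" "M e u0 \<noteq> 0" by blast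
    let ?M = "\<lambda>e' u. M e u0 * M e' u - M e' u0 * M e u"
    have "(\<Sum>u\<in>U - {u0}. ?M e' u * f u) = 0" if "e' \<in> E" for e'
    proof -
      have "(\<Sum>u\<in>U - {u0}. ?M e' u * f u) = (\<Sum>u\<in>U. ?M e' u * f u)"
        by (rule sum.mono_neutral_left) (use insert.prems in auto)
      also have "\<dots> = M e u0 * (\<Sum>u\<in>U. M e' u * f u) - M e' u0 * (\<Sum>u\<in>U. M e u * f u)"
        by (simp add: sum_distrib_left sum_subtractf algebra_simps)
      finally show ?thesis using f(2) that by simp
    qed
    \<comment> \<open>If only the unknown \<open>u0\<close> were nonzero, equation \<open>e\<close>
      would say that its product with the pivot is zero.\<close>
    moreover have "\<exists>u\<in>U - {u0}. f u \<noteq> 0"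
    proof (rule ccontr)
      assume *: "\<not> ?thesis"
      have "(\<Sum>u\<in>U. M e u * f u) = M e u0 * f u0 + (\<Sum>u\<in>U - {u0}. M e u * f u)"
        by (rule sum.remove) (use insert.prems u0 in auto)
      with * f(2)[of e] u0 have "f u0 = 0" by simp
      with * f(1) show False by blast
    qed
    ultimately have "solvable_in UNIV ?M E (U - {u0})"
      unfolding solvable_in_def by blast
    then have "solvable_in R ?M E (U - {u0})"
      by (intro insert.IH) (use insert.prems u0 in \<open>auto intro!: subring_setD[OF R]\<close>)
    then show ?thesis
      by (intro elimination_step[OF R]) (use insert.prems u0 in auto)
  qed
qed

lemma solvable_more_unknowns:
  fixes M :: "'e \<Rightarrow> 'u \<Rightarrow> 'a::idom"
  assumes "finite E" "finite U" "card E < card U"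
  shows "\<exists>c. (\<exists>u\<in>U. c u \<noteq> 0) \<and> (\<forall>e\<in>E. (\<Sum>u\<in>U. M e u * c u) = 0)"
proof -
  have R: "subring_set UNIV" by (simp add: subring_set_def)
  from assms have "solvable_in UNIV M E U"
  proof (induction E arbitrary: M U rule: finite_induct)
    case empty
    then have "U \<noteq> {}" by auto
    then show ?case unfolding solvable_in_def by (intro exI[of _ "\<lambda>_. 1"]) auto
  next
    case (insert e E)
    show ?case
    proof (cases "\<forall>u\<in>U. M e u = 0")
      case True
      then show ?thesis using insert by (intro solvable_in_trivial_equation) auto
    next
      case False
      then obtain u0 where u0: "u0 \<in> U" "M e u0 \<noteq> 0" by blast
      show ?thesis
        by (rule elimination_step[OF R insert.prems(1) u0(1)]) (use insert u0 in auto)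
    qed
  qed
  then show ?thesis by (simp add: solvable_in_def)
qed

subsection \<open>Counting monomials\<close>

text \<open>Stars and bars: an enumeration of the variables identifies monomials of degree
  \<open>d\<close> with lists of fixed length and sum \<open>d\<close>.\<close>

lemma card_monom_deg:
  "card {t :: 'v::finite \<Rightarrow>\<^sub>0 nat. monom_deg t = d} = (d + CARD('v) - 1) choose d"
proof -
  let ?m = "CARD('v)"
  from ex_bij_betw_nat_finite[of "UNIV :: 'v set"] obtain h :: "nat \<Rightarrow> 'v"
    where h: "bij_betw h {0..<?m} UNIV" by auto
  have sum: "monom_deg t = sum_list (map (\<lambda>i. lookup t (h i)) [0..<?m])" for t
    unfolding monom_deg_UNIV sum.reindex_bij_betw[OF h, symmetric]
    by (simp add: interv_sum_list_conv_sum_set_nat)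
  have "bij_betw (\<lambda>t. map (\<lambda>i. lookup t (h i)) [0..<?m]) {t. monom_deg t = d}
    {l. length l = ?m \<and> sum_list l = d}"
  proof (rule bij_betw_imageI)
    show "inj_on (\<lambda>t. map (\<lambda>i. lookup t (h i)) [0..<?m]) {t. monom_deg t = d}"
    proof (rule inj_onI, rule poly_mapping_eqI)
      fix s t :: "'v \<Rightarrow>\<^sub>0 nat" and v
      assume eq: "map (\<lambda>i. lookup s (h i)) [0..<?m] = map (\<lambda>i. lookup t (h i)) [0..<?m]"
      from h have "v \<in> h ` {0..<?m}" by (simp add: bij_betw_def)
      then obtain i where "i < ?m" "v = h i" by auto
      then show "lookup s v = lookup t v" using eq by (simp add: map_eq_conv)
    qed
    have "l \<in> (\<lambda>t. map (\<lambda>i. lookup t (h i)) [0..<?m]) ` {t. monom_deg t = d}"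
      if l: "length l = ?m" "sum_list l = d" for l
    proof
      let ?t = "Abs_poly_mapping (\<lambda>v. l ! inv_into {0..<?m} h v)"
      have "lookup ?t (h i) = l ! i" if "i < ?m" for i
        using that h by (simp add: lookup_Abs_poly_mapping bij_betw_def inv_into_f_f)
      then show *: "l = map (\<lambda>i. lookup ?t (h i)) [0..<?m]"
        using l by (intro nth_equalityI) auto
      show "?t \<in> {t. monom_deg t = d}" using l(2) by (subst (asm) *) (simp add: sum)
    qed
    then show "(\<lambda>t. map (\<lambda>i. lookup t (h i)) [0..<?m]) ` {t. monom_deg t = d} =
      {l. length l = ?m \<and> sum_list l = d}" by (auto simp: sum)
  qed
  then show ?thesis using card_length_sum_list[of ?m d] by (simp add: bij_betw_same_card)
qed

lemma finite_monom_deg [simp]: "finite {t :: 'v::finite \<Rightarrow>\<^sub>0 nat. monom_deg t = d}"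
proof (rule card_ge_0_finite)
  have "0 < CARD('v)" by simp
  then have "d \<le> d + CARD('v) - 1" by linarith
  then show "0 < card {t :: 'v \<Rightarrow>\<^sub>0 nat. monom_deg t = d}"
    unfolding card_monom_deg by (rule zero_less_binomial)
qed

lemma finite_sum_less: "finite {w :: 'n::finite \<Rightarrow> nat. sum w UNIV < m}"
proof (rule finite_subset)
  have "w j \<le> sum w UNIV" for w :: "'n \<Rightarrow> nat" and j by (rule member_le_sum) auto
  then show "{w :: 'n \<Rightarrow> nat. sum w UNIV < m} \<subseteq> PiE UNIV (\<lambda>_. {..<m})"
    by (auto intro: le_less_trans)
  show "finite (PiE (UNIV :: 'n set) (\<lambda>_. {..<m}))" by (rule finite_PiE) auto
qed

lemma (in ring_map) mlin_homogeneous: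
  fixes F :: "('v::finite \<Rightarrow>\<^sub>0 nat) \<Rightarrow>\<^sub>0 'a"
  assumes "homogeneous d F"
  shows "mlin \<phi> c F = (\<Sum>t\<in>{t. monom_deg t = d}. \<phi> (lookup F t) * c t)"
  using assms by (intro mlin_superset) (auto simp: homogeneous_def)

lemma hasse_homogeneous:
  fixes F :: "('n::finite option, 'a::comm_ring_1) mpol"
  assumes "homogeneous d F"
  shows "hasse a w F = (\<Sum>t\<in>{t. monom_deg t = d}. hcoef a w t * lookup F t)"
  unfolding hasse_def ring_map.mlin_homogeneous[OF ring_map_id assms] by (simp add: mult.commute)

lemma lookup_sum_single:
  "finite S \<Longrightarrow> lookup (\<Sum>t\<in>S. single t (c t)) t = (if t \<in> S then c t else 0)"
  unfolding lookup_sum lookup_single when_def by (simp add: sum.delta)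

subsection \<open>Nonvanishing of forms\<close>

lemma digits_unique:
  fixes f g :: "nat \<Rightarrow> nat"
  assumes "\<And>i. i < N \<Longrightarrow> f i < D" "\<And>i. i < N \<Longrightarrow> g i < D" "(\<Sum>i<N. f i * D ^ i) = (\<Sum>i<N. g i * D ^ i)"
  shows "\<forall>i<N. f i = g i"
  using assms
proof (induction N arbitrary: f g)
  case (Suc N)
  have D: "D > 0" using Suc.prems(1)[of 0] by simp
  have split: "(\<Sum>i<Suc N. f i * D ^ i) = f 0 + D * (\<Sum>i<N. f (Suc i) * D ^ i)" for f :: "nat \<Rightarrow> nat"
    unfolding sum.lessThan_Suc_shift by (simp add: sum_distrib_left mult_ac)
  have eq: "f 0 + D * (\<Sum>i<N. f (Suc i) * D ^ i) = g 0 + D * (\<Sum>i<N. g (Suc i) * D ^ i)"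
    using Suc.prems(3) unfolding split .
  have "f 0 = (f 0 + D * (\<Sum>i<N. f (Suc i) * D ^ i)) mod D" using Suc.prems(1)[of 0] by simp
  moreover have "g 0 = (g 0 + D * (\<Sum>i<N. g (Suc i) * D ^ i)) mod D" using Suc.prems(2)[of 0] by simp
  ultimately have 0: "f 0 = g 0" using eq by simp
  with eq D have "(\<Sum>i<N. f (Suc i) * D ^ i) = (\<Sum>i<N. g (Suc i) * D ^ i)" by simp
  then have "\<forall>i<N. f (Suc i) = g (Suc i)" using Suc.prems by (intro Suc.IH) auto
  with 0 show ?case by (auto simp: less_Suc_eq_0_disj)
qed simp

text \<open>Restricted to forms, the substitution \<open>x\<^sub>0 = 1\<close>, \<open>x\<^sub>j = t\<^bsup>D\<^sup>i\<^esup>\<close> (\<open>i\<close> the index of \<open>j\<close>) is injective as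
  soon as \<open>D\<close> exceeds the degree. This reduces nonvanishing questions to univariate polynomials.\<close>

definition kronecker_exp :: "nat \<Rightarrow> 'n::finite \<Rightarrow> nat" where
  "kronecker_exp D j = D ^ inv_into {0..<CARD('n)} (SOME h. bij_betw h {0..<CARD('n)} UNIV) j"

lemma kronecker_exp_unique:
  fixes f g :: "'n::finite \<Rightarrow> nat"
  assumes "\<And>j. f j < D" "\<And>j. g j < D"
    "(\<Sum>j\<in>UNIV. f j * kronecker_exp D j) = (\<Sum>j\<in>UNIV. g j * kronecker_exp D j)"
  shows "f = g"
proof
  define h :: "nat \<Rightarrow> 'n" where "h = (SOME h. bij_betw h {0..<CARD('n)} UNIV)"
  have h: "bij_betw h {0..<CARD('n)} UNIV"
    unfolding h_def by (rule someI_ex[OF ex_bij_betw_nat_finite[OF finite]])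
  have exp: "kronecker_exp D (h i) = D ^ i" if "i < CARD('n)" for i
  proof -
    have "inv_into {0..<CARD('n)} h (h i) = i"
      using that bij_betw_imp_inj_on[OF h] by (intro inv_into_f_f) auto
    then show ?thesis by (simp only: kronecker_exp_def h_def)
  qed
  have "(\<Sum>j\<in>UNIV. f j * kronecker_exp D j) = (\<Sum>i<CARD('n). f (h i) * D ^ i)" for f
  proof -
    have "(\<Sum>j\<in>UNIV. f j * kronecker_exp D j) = (\<Sum>i\<in>{0..<CARD('n)}. f (h i) * kronecker_exp D (h i))"
      by (rule sum.reindex_bij_betw[OF h, symmetric])
    also have "\<dots> = (\<Sum>i<CARD('n). f (h i) * D ^ i)"
      by (rule sum.cong) (auto simp: exp)
    finally show ?thesis .
  qed
  then have "\<forall>i<CARD('n). f (h i) = g (h i)"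
    using assms by (intro digits_unique[of _ _ D]) auto
  moreover fix j
  from h have "j \<in> h ` {0..<CARD('n)}" by (simp add: bij_betw_def)
  then obtain i where "i < CARD('n)" "j = h i" by auto
  ultimately show "f j = g j" by simp
qed

lemma ring_map_const_poly: "ring_map (\<lambda>c :: 'a::comm_ring_1. [:c:])"
  by unfold_locales (simp_all add: one_pCons)

lemma ring_map_poly: "ring_map (\<lambda>p. poly p (x :: 'a::comm_ring_1))"
  by unfold_locales simp_all

definition kronecker :: "nat \<Rightarrow> ('n::finite option, 'a::comm_ring_1) mpol \<Rightarrow> 'a poly" where
  "kronecker D = mlin (\<lambda>c. [:c:]) (mon (case_option 1 (\<lambda>j. monom 1 (kronecker_exp D j))))"

lemma ring_map_kronecker: "ring_map (kronecker D)"
  unfolding kronecker_def by (rule ring_map.ring_map_mlin_mon[OF ring_map_const_poly])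

text \<open>Two monomials of the form with the same image agree in all affine exponents by
  uniqueness of digits in base \<open>D\<close>, and then in the exponent of
  \<open>x\<^sub>0\<close> because their degrees agree. Hence nothing cancels.\<close>

lemma kronecker_nonzero:
  fixes F :: "('n::finite option, 'a::comm_ring_1) mpol"
  assumes F: "F \<noteq> 0" "homogeneous d F" and D: "d < D"
  shows "kronecker D F \<noteq> 0"
proof -
  let ?e = "\<lambda>t. \<Sum>j\<in>UNIV. lookup t (Some j) * kronecker_exp D j"
  have mon: "mon (case_option 1 (\<lambda>j. monom 1 (kronecker_exp D j))) t = monom (1::'a) (?e t)"
    for t :: "'n option \<Rightarrow>\<^sub>0 nat"
  proof -
    have "(\<Prod>j\<in>S. monom (1::'a) (g j)) = monom 1 (sum g S)" if "finite S" for g and S :: "'n set"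
      using that by (induction S rule: finite_induct) (simp_all add: mult_monom)
    then show ?thesis
      by (subst mon_superset[of UNIV]) (simp_all add: prod_option monom_power mult.commute)
  qed
  have bound: "lookup t (Some j) < D" if "t \<in> keys F" for t j
  proof -
    have "lookup t (Some j) \<le> (\<Sum>j\<in>UNIV. lookup t (Some j))" by (rule member_le_sum) auto
    also have "\<dots> \<le> monom_deg t" by (simp add: monom_deg_option)
    finally show ?thesis using F(2) D that by (auto simp: homogeneous_def)
  qed
  have inj: "s = t" if "s \<in> keys F" "t \<in> keys F" "?e s = ?e t" for s t
  proof -
    have "(\<lambda>j. lookup s (Some j)) = (\<lambda>j. lookup t (Some j))"
      by (rule kronecker_exp_unique[of _ D]) (use that bound in auto)
    then have *: "lookup s (Some j) = lookup t (Some j)" for j by (rule fun_cong)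
    moreover have "monom_deg s = monom_deg t" using that F(2) by (auto simp: homogeneous_def)
    ultimately have "lookup s None = lookup t None" by (simp add: monom_deg_option)
    with * show ?thesis by (intro poly_mapping_eqI) (metis not_None_eq)
  qed
  obtain t where t: "t \<in> keys F" using F(1) by (metis keys_eq_empty ex_in_conv)
  have "coeff (kronecker D F) (?e t) = (\<Sum>s\<in>keys F. if ?e s = ?e t then lookup F s else 0)"
    unfolding kronecker_def mlin_def coeff_sum mon by (intro sum.cong) auto
  also have "\<dots> = (\<Sum>s\<in>keys F. if s = t then lookup F s else 0)"
    by (rule sum.cong) (use inj t in auto)
  also have "\<dots> = lookup F t" using t by simp
  finally show ?thesis using t by (auto simp: in_keys_iff)
qed

text \<open>With a base above both degrees the Kronecker substitution kills neither factor, and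
  univariate polynomials over a domain have no zero divisors.\<close>

lemma form_mult_nonzero:
  fixes F G :: "('n::finite option, 'a::idom) mpol"
  assumes "F \<noteq> 0" "homogeneous d F" "G \<noteq> 0" "homogeneous e G"
  shows "F * G \<noteq> 0"
proof
  assume "F * G = 0"
  then have "kronecker (Suc (d + e)) F * kronecker (Suc (d + e)) G = 0"
    by (simp flip: ring_map.mult[OF ring_map_kronecker] add: ring_map.zero[OF ring_map_kronecker])
  then show False using kronecker_nonzero[of F d "Suc (d + e)"] kronecker_nonzero[of G e "Suc (d + e)"] assms by simp
qed

lemma form_prod_nonzero:
  fixes F :: "'x \<Rightarrow> ('n::finite option, 'a::idom) mpol"
  assumes "finite S" "\<And>x. x \<in> S \<Longrightarrow> F x \<noteq> 0" "\<And>x. x \<in> S \<Longrightarrow> homogeneous (d x) (F x)"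
  shows "prod F S \<noteq> 0"
  using assms
proof (induction S rule: finite_induct)
  case (insert x S)
  then have "F x * prod F S \<noteq> 0"
    by (intro form_mult_nonzero[of _ "d x" _ "sum d S"] homogeneous_prod) auto
  then show ?case using insert by simp
qed simp

text \<open>Over a finite field, one plus the product of all \<open>X - c\<close> would be a
  nonconstant polynomial without a root.\<close>

lemma infinite_alg_closed: "infinite (UNIV :: 'k::alg_closed_field set)"
proof
  assume fin: "finite (UNIV :: 'k set)"
  let ?p = "(\<Prod>c\<in>UNIV. [:- c, 1:]) + 1 :: 'k poly"
  have "degree (\<Prod>c\<in>UNIV. [:- c, 1:] :: 'k poly) = card (UNIV :: 'k set)"
    by (subst degree_prod_eq_sum_degree) auto
  moreover have "card (UNIV :: 'k set) > 0" using fin by (simp add: card_gt_0_iff)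
  ultimately have "degree ?p > 0" by (subst degree_add_eq_left) auto
  then obtain x where "poly ?p x = 0" using alg_closed_imp_poly_has_root by blast
  moreover have "poly (\<Prod>c\<in>UNIV. [:- c, 1:]) x = 0"
    unfolding poly_prod by (rule prod_zero) (use fin in auto)
  ultimately show False by simp
qed

lemma (in ring_map) mon: "\<phi> (mon a t) = mon (\<lambda>i. \<phi> (a i)) t"
  by (simp add: mon_def prod power)

lemma form_nonvanishing_point:
  fixes F :: "('n::finite option, 'k::idom) mpol"
  assumes inf: "infinite (UNIV :: 'k set)" and F: "F \<noteq> 0" "homogeneous d F"
  shows "\<exists>b. mpol_eval (case_option 1 b) F \<noteq> 0"
proof -
  have "kronecker (Suc d) F \<noteq> 0" using kronecker_nonzero[OF F, of "Suc d"] by simp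
  then have "finite {x. poly (kronecker (Suc d) F) x = 0}" by (rule poly_roots_finite)
  then obtain x where x: "poly (kronecker (Suc d) F) x \<noteq> 0"
    using inf by (metis (mono_tags, lifting) UNIV_eq_I mem_Collect_eq)
  define b where "b j = x ^ kronecker_exp (Suc d) j" for j :: 'n
  have "(\<lambda>i. poly (case i of None \<Rightarrow> 1 | Some j \<Rightarrow> monom 1 (kronecker_exp (Suc d) j)) x) = case_option 1 b"
    by (auto simp: b_def poly_monom split: option.split)
  then have "poly (kronecker (Suc d) F) x = mpol_eval (case_option 1 b) F"
    by (simp add: kronecker_def mlin_def poly_sum ring_map.mon[OF ring_map_poly] mpol_eval_mlin)
  with x show ?thesis by auto
qed

subsection \<open>Specialization of generic points\<close>

lemma subring_set_prime_field: "subring_set (prime_field :: 'k::field set)"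
proof -
  have uminus: "- x \<in> K" if "is_subfield K" "x \<in> K" for K and x :: 'k
  proof -
    have "0 - x \<in> K" using that unfolding is_subfield_def by blast
    then show ?thesis by simp
  qed
  have add: "x + y \<in> K" if "is_subfield K" "x \<in> K" "y \<in> K" for K and x y :: 'k
  proof -
    have "x - (- y) \<in> K" using that uminus[OF that(1,3)] unfolding is_subfield_def by blast
    then show ?thesis by simp
  qed
  show ?thesis unfolding subring_set_def prime_field_def
    using uminus add by (auto simp: is_subfield_def)
qed

text \<open>The polynomials on which evaluation at generic coordinates is injective.\<close>

definition prime_polys :: "'v set \<Rightarrow> ('v, 'k::field) mpol set" where
  "prime_polys V = {p. \<forall>t\<in>keys p. lookup p t \<in> prime_field \<and> keys t \<subseteq> V}"

lemma single_in_prime_polys: "c \<in> prime_field \<Longrightarrow> keys t \<subseteq> V \<Longrightarrow> single t c \<in> prime_polys V"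
  by (auto simp: prime_polys_def)

lemma subring_set_prime_polys: "subring_set (prime_polys V :: ('v, 'k::field) mpol set)"
proof -
  note R = subring_set_prime_field[where 'k = 'k]
  have add: "p + q \<in> prime_polys V" if "p \<in> prime_polys V" "q \<in> prime_polys V" for p q :: "('v, 'k) mpol"
    unfolding prime_polys_def
  proof safe
    fix t assume t: "t \<in> keys (p + q)"
    have "lookup r s \<in> prime_field" if "r \<in> prime_polys V" for r :: "('v, 'k) mpol" and s
      using that subring_setD(1)[OF R] by (cases "s \<in> keys r") (auto simp: prime_polys_def in_keys_iff)
    then show "lookup (p + q) t \<in> prime_field"
      using that by (auto simp: lookup_add intro: subring_setD[OF R])
    show "x \<in> V" if "x \<in> keys t" for x
      using t \<open>p \<in> _\<close> \<open>q \<in> _\<close> Poly_Mapping.keys_add[of p q] that by (auto simp: prime_polys_def)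
  qed
  have uminus: "- p \<in> prime_polys V" if "p \<in> prime_polys V" for p :: "('v, 'k) mpol"
    using that by (auto simp: prime_polys_def in_keys_iff intro: subring_setD[OF R])
  have sum: "sum f S \<in> prime_polys V" if "\<And>x. x \<in> S \<Longrightarrow> f x \<in> prime_polys V" for f :: "'x \<Rightarrow> ('v, 'k) mpol" and S
    using that
  proof (induction S rule: infinite_finite_induct)
    case (insert x S)
    then show ?case using add by simp
  qed (simp_all add: prime_polys_def)
  have mult: "p * q \<in> prime_polys V" if "p \<in> prime_polys V" "q \<in> prime_polys V" for p q :: "('v, 'k) mpol"
  proof -
    have "p * q = (\<Sum>s\<in>keys p. \<Sum>t\<in>keys q. single (s + t) (lookup p s * lookup q t))"
      by (subst sum_single[of p], subst sum_single[of q]) (simp add: sum_product mult_single)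
    also have "\<dots> \<in> prime_polys V"
    proof (intro sum single_in_prime_polys)
      fix s t assume "s \<in> keys p" "t \<in> keys q"
      then have *: "lookup p s \<in> prime_field" "lookup q t \<in> prime_field" "keys s \<subseteq> V" "keys t \<subseteq> V"
        using that by (auto simp: prime_polys_def)
      show "lookup p s * lookup q t \<in> prime_field" by (intro subring_setD(5)[OF R] *)
      show "keys (s + t) \<subseteq> V" using Poly_Mapping.keys_add[of s t] *(3,4) by blast
    qed
    finally show ?thesis .
  qed
  have "1 \<in> (prime_polys V :: ('v, 'k) mpol set)"
    using single_in_prime_polys[of 1 0 V] subring_setD(2)[OF R] by simp
  moreover have "0 \<in> (prime_polys V :: ('v, 'k) mpol set)" by (simp add: prime_polys_def)
  ultimately show ?thesis unfolding subring_set_def using add uminus mult by blast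
qed

lemma (in ring_map) subring_image: "subring_set R \<Longrightarrow> subring_set (\<phi> ` R)"
  unfolding subring_set_def
  by (auto simp flip: add mult uminus intro!: imageI image_eqI[of 0 \<phi> 0] image_eqI[of 1 \<phi> 1] simp: one)

lemma (in ring_map) hcoef: "\<phi> (hcoef a w t) = hcoef (\<lambda>j. \<phi> (a j)) w t"
  by (simp add: hcoef_def hasse1_def prod mult of_nat power)

lemma subring_set_hcoef: "subring_set R \<Longrightarrow> (\<And>j. a j \<in> R) \<Longrightarrow> hcoef a w t \<in> R"
  unfolding hcoef_def hasse1_def
  by (intro subring_set_prod subring_setD(5) subring_set_of_nat subring_set_power)

text \<open>The exponent \<open>k\<close> is the least order at 0 among the nonzero polynomials;
  after division the one attaining it no longer vanishes at 0.\<close>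

lemma common_X_power:
  fixes \<gamma> :: "'u \<Rightarrow> 'a::idom poly"
  assumes "\<exists>u\<in>U. \<gamma> u \<noteq> 0"
  shows "\<exists>k \<gamma>'. (\<forall>u\<in>U. \<gamma> u = [:0, 1:] ^ k * \<gamma>' u) \<and> (\<exists>u\<in>U. poly (\<gamma>' u) 0 \<noteq> 0)"
proof -
  from assms obtain u1 where "u1 \<in> U \<and> \<gamma> u1 \<noteq> 0" by blast
  from ex_has_least_nat[of "\<lambda>u. u \<in> U \<and> \<gamma> u \<noteq> 0", OF this, of "\<lambda>u. order 0 (\<gamma> u)"]
  obtain u0 where u0: "u0 \<in> U" "\<gamma> u0 \<noteq> 0"
    and min: "\<And>u. u \<in> U \<Longrightarrow> \<gamma> u \<noteq> 0 \<Longrightarrow> order 0 (\<gamma> u0) \<le> order 0 (\<gamma> u)" by blast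
  let ?k = "order 0 (\<gamma> u0)"
  have "\<exists>q. \<gamma> u = [:0, 1:] ^ ?k * q" if "u \<in> U" for u
  proof (cases "\<gamma> u = 0")
    case False
    then have "[:- 0, 1:] ^ ?k dvd \<gamma> u" using min[OF that] by (subst order_divides) auto
    then show ?thesis by (auto simp: dvd_def)
  qed auto
  then obtain \<gamma>' where \<gamma>': "\<And>u. u \<in> U \<Longrightarrow> \<gamma> u = [:0, 1:] ^ ?k * \<gamma>' u" by metis
  have "poly (\<gamma>' u0) 0 \<noteq> 0"
  proof
    assume "poly (\<gamma>' u0) 0 = 0"
    then have "[:- 0, 1:] dvd \<gamma>' u0" by (simp only: poly_eq_0_iff_dvd)
    then have "[:- 0, 1:] ^ ?k * [:- 0, 1:] dvd [:- 0, 1:] ^ ?k * \<gamma>' u0" by (intro mult_dvd_mono dvd_refl)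
    then have "[:- 0, 1:] ^ Suc ?k dvd \<gamma> u0" using \<gamma>'[OF u0(1)] by (simp only: power_Suc2 minus_zero)
    then show False using u0(2) by (subst (asm) order_divides) simp
  qed
  then show ?thesis using \<gamma>' u0(1) by blast
qed

text \<open>A form with prescribed multiplicities at generic points can be chosen with coefficients which
  are polynomials in the coordinates of the points. Substituting the line \<open>b + t (a - b)\<close> for the
  coordinates, dividing by the largest possible power of \<open>t\<close> and putting \<open>t = 0\<close> gives a form with
  the same multiplicities at \<open>b\<close>.\<close>

lemma specialization:
  fixes a b :: "nat \<Rightarrow> 'n::finite \<Rightarrow> 'k::field" and F :: "('n option, 'k) mpol"
  assumes gen: "alg_independent prime_field ({..<n} \<times> UNIV) (\<lambda>(i, j). a i j)"
    and F: "F \<noteq> 0" "homogeneous d F"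
    and z: "\<And>i w. i < n \<Longrightarrow> sum w UNIV < m i \<Longrightarrow> hasse (a i) w F = 0"
  shows "\<exists>G. G \<noteq> 0 \<and> homogeneous d G \<and> (\<forall>i<n. \<forall>w. sum w UNIV < m i \<longrightarrow> hasse (b i) w G = 0)"
proof -
  define V where "V = {..<n} \<times> (UNIV :: 'n set)"
  define U where "U = {t :: 'n option \<Rightarrow>\<^sub>0 nat. monom_deg t = d}"
  define E where "E = (SIGMA i:{..<n}. {w :: 'n \<Rightarrow> nat. sum w UNIV < m i})"
  define P where "P = (prime_polys V :: (nat \<times> 'n, 'k) mpol set)"
  define \<psi> :: "(nat \<times> 'n, 'k) mpol \<Rightarrow> 'k" where "\<psi> = mpol_eval (\<lambda>(i, j). a i j)"
  \<comment> \<open>Substitution of the line joining \<open>b\<close> to \<open>a\<close>: the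
    parameter value 0 gives \<open>b\<close>, the value 1 gives back \<open>a\<close>.\<close>
  define \<theta> :: "(nat \<times> 'n, 'k) mpol \<Rightarrow> 'k poly" where
    "\<theta> = mlin (\<lambda>c. [:c:]) (mon (\<lambda>(i, j). [:b i j, a i j - b i j:]))"
  \<comment> \<open>The matrix of vanishing conditions with indeterminate coordinates: a row
    \<open>e\<close> is a pair of a point and a derivative, a column \<open>t\<close> is the
    monomial whose coefficient is unknown.\<close>
  define H where "H e t = (hcoef (\<lambda>j. var (fst e, j)) (snd e) t :: (nat \<times> 'n, 'k) mpol)" for e t
  have U: "finite U" by (simp add: U_def)
  have E: "finite E" unfolding E_def by (intro finite_SigmaI finite_sum_less) auto
  have P: "subring_set P" unfolding P_def by (rule subring_set_prime_polys)
  interpret \<psi>: ring_map \<psi> unfolding \<psi>_def by (rule ring_map_mpol_eval)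
  interpret \<theta>: ring_map \<theta> unfolding \<theta>_def
    by (rule ring_map.ring_map_mlin_mon[OF ring_map_const_poly])
  have \<psi>_var: "\<psi> (var (i, j)) = a i j" for i j by (simp add: \<psi>_def var_def)
  have \<theta>_var: "\<theta> (var (i, j)) = [:b i j, a i j - b i j:]" for i j
    by (simp add: \<theta>_def var_def ring_map.mlin_single[OF ring_map_const_poly] flip: one_pCons)
  have \<theta>_1: "poly (\<theta> p) 1 = \<psi> p" for p
    by (simp add: \<theta>_def \<psi>_def mpol_eval_mlin mlin_def poly_sum ring_map.mon[OF ring_map_poly] case_prod_unfold)
  have HP: "H e t \<in> P" if "e \<in> E" for e t
    unfolding H_def
  proof (rule subring_set_hcoef[OF P])
    show "var (fst e, j) \<in> P" for j
      unfolding P_def var_def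
      by (rule single_in_prime_polys) (use that subring_setD(2)[OF subring_set_prime_field] in \<open>auto simp: E_def V_def\<close>)
  qed
  have \<psi>H: "\<psi> (H e t) = hcoef (a (fst e)) (snd e) t" for e t
    by (simp add: H_def \<psi>.hcoef \<psi>_var)
  have \<theta>H: "poly (\<theta> (H e t)) 0 = hcoef (b (fst e)) (snd e) t" for e t
    by (simp add: H_def \<theta>.hcoef \<theta>_var ring_map.hcoef[OF ring_map_poly])
  have inj: "p = 0" if "p \<in> P" "\<psi> p = 0" for p
    using gen that unfolding alg_independent_def P_def prime_polys_def \<psi>_def V_def by blast
  \<comment> \<open>The coefficients of \<open>F\<close> are arbitrary elements of the field;
    elimination trades them for values of prime field polynomials at the generic
    coordinates.\<close>
  have "solvable_in (\<psi> ` P) (\<lambda>e t. \<psi> (H e t)) E U"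
  proof (rule solvable_in_subring[OF \<psi>.subring_image[OF P] E U])
    show "solvable_in UNIV (\<lambda>e t. \<psi> (H e t)) E U"
      unfolding solvable_in_def
    proof (intro exI[of _ "lookup F"] conjI ballI)
      obtain t where "t \<in> keys F" using F(1) by (metis keys_eq_empty ex_in_conv)
      then show "\<exists>t\<in>U. lookup F t \<noteq> 0"
        using F(2) by (auto simp: U_def homogeneous_def in_keys_iff)
      fix e assume "e \<in> E"
      then have "hasse (a (fst e)) (snd e) F = 0" by (intro z) (auto simp: E_def)
      then show "(\<Sum>t\<in>U. \<psi> (H e t) * lookup F t) = 0"
        unfolding \<psi>H hasse_homogeneous[OF F(2)] U_def .
    qed simp
  qed (use HP in auto)
  then obtain c where c: "\<And>t. t \<in> U \<Longrightarrow> c t \<in> \<psi> ` P" "\<exists>t\<in>U. c t \<noteq> 0"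
    "\<And>e. e \<in> E \<Longrightarrow> (\<Sum>t\<in>U. \<psi> (H e t) * c t) = 0"
    unfolding solvable_in_def by blast
  from c(1) have "\<forall>t\<in>U. \<exists>p. p \<in> P \<and> c t = \<psi> p" by blast
  then obtain C where C: "\<And>t. t \<in> U \<Longrightarrow> C t \<in> P" "\<And>t. t \<in> U \<Longrightarrow> c t = \<psi> (C t)" by metis
  \<comment> \<open>Injectivity of \<open>\<psi>\<close> on \<open>P\<close> lifts each equation to
    an identity of polynomials, which then survives any substitution.\<close>
  have rel: "(\<Sum>t\<in>U. \<theta> (H e t) * \<theta> (C t)) = 0" if e: "e \<in> E" for e
  proof -
    have "(\<Sum>t\<in>U. H e t * C t) \<in> P"
      by (intro subring_set_sum[OF P] subring_setD(5)[OF P] HP e C)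
    moreover have "\<psi> (\<Sum>t\<in>U. H e t * C t) = 0"
      using c(3)[OF e] by (simp add: \<psi>.sum \<psi>.mult C(2))
    ultimately have "(\<Sum>t\<in>U. H e t * C t) = 0" by (rule inj)
    then have "\<theta> (\<Sum>t\<in>U. H e t * C t) = 0" by simp
    then show ?thesis by (simp add: \<theta>.sum \<theta>.mult)
  qed
  \<comment> \<open>At parameter value 1 these polynomials take the values \<open>c t\<close>, not
    all of which are zero.\<close>
  have "\<exists>t\<in>U. \<theta> (C t) \<noteq> 0"
    using c(2) C(2) by (metis \<theta>_1 poly_0)
  from common_X_power[OF this] obtain k \<gamma> where \<gamma>: "\<And>t. t \<in> U \<Longrightarrow> \<theta> (C t) = [:0, 1:] ^ k * \<gamma> t"
    "\<exists>t\<in>U. poly (\<gamma> t) 0 \<noteq> 0" by blast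
  define G where "G = (\<Sum>t\<in>U. single t (poly (\<gamma> t) 0))"
  have G_lookup: "lookup G t = (if t \<in> U then poly (\<gamma> t) 0 else 0)" for t
    unfolding G_def by (rule lookup_sum_single[OF U])
  have G: "homogeneous d G" unfolding G_def
    by (rule homogeneous_sum, rule homogeneous_single) (simp add: U_def)
  have "hasse (b i) w G = 0" if "i < n" "sum w UNIV < m i" for i w
  proof -
    from that have e: "(i, w) \<in> E" by (simp add: E_def)
    have "[:0, 1:] ^ k * (\<Sum>t\<in>U. \<theta> (H (i, w) t) * \<gamma> t) = (\<Sum>t\<in>U. \<theta> (H (i, w) t) * \<theta> (C t))"
      by (simp add: sum_distrib_left \<gamma>(1) mult_ac)
    then have "(\<Sum>t\<in>U. \<theta> (H (i, w) t) * \<gamma> t) = 0" using rel[OF e] by simp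
    then have "poly (\<Sum>t\<in>U. \<theta> (H (i, w) t) * \<gamma> t) 0 = 0" by simp
    then have "(\<Sum>t\<in>U. hcoef (b i) w t * poly (\<gamma> t) 0) = 0"
      by (simp add: poly_sum \<theta>H)
    then show ?thesis unfolding hasse_homogeneous[OF G] by (simp add: G_lookup U_def)
  qed
  moreover have "G \<noteq> 0" using \<gamma>(2) G_lookup by (metis lookup_zero)
  ultimately show ?thesis using G by blast
qed

subsection \<open>Unisolvent point sets\<close>

abbreviation ev :: "('n \<Rightarrow> 'a::comm_ring_1) \<Rightarrow> ('n option, 'a) mpol \<Rightarrow> 'a" where
  "ev a F \<equiv> mpol_eval (case_option 1 a) F"

lemmas ev_mult = ring_map.mult[OF ring_map_mpol_eval]
  and ev_diff = ring_map.diff[OF ring_map_mpol_eval]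
  and ev_sum = ring_map.sum[OF ring_map_mpol_eval]

lemma ev_var_None: "ev a (var None) = 1"
  by (simp add: var_def)

lemma ev_const_mult: "mpol_eval v (single 0 c * F) = c * mpol_eval v F"
  by (simp add: ev_mult)

lemma lookup_const_mult: "lookup (single 0 c * F) t = c * lookup F t" for c :: "'a::comm_ring_1"
  by (induction F rule: poly_mapping_sum_induct)
     (simp_all add: distrib_left lookup_add mult_single lookup_single mult_when)

lemma vanishing_combination:
  fixes a :: "nat \<Rightarrow> 'n \<Rightarrow> 'k::field"
  assumes "finite U" "finite I" "card I < card U"
  shows "\<exists>F. F \<noteq> 0 \<and> keys F \<subseteq> U \<and> (\<forall>i\<in>I. ev (a i) F = 0)"
proof -
  from solvable_more_unknowns[OF assms(2,1,3), of "\<lambda>i t. mon (case_option 1 (a i)) t"]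
  obtain c where c: "\<exists>t\<in>U. c t \<noteq> 0" "\<And>i. i \<in> I \<Longrightarrow> (\<Sum>t\<in>U. mon (case_option 1 (a i)) t * c t) = 0"
    by blast
  define F where "F = (\<Sum>t\<in>U. single t (c t))"
  have l: "lookup F t = (if t \<in> U then c t else 0)" for t
    unfolding F_def by (rule lookup_sum_single[OF assms(1)])
  have "F \<noteq> 0" using c(1) l by (metis lookup_zero)
  moreover have "keys F \<subseteq> U" using l by (auto simp: in_keys_iff split: if_splits)
  moreover have "ev (a i) F = 0" if "i \<in> I" for i
    using c(2)[OF that] by (simp add: F_def ev_sum mult.commute)
  ultimately show ?thesis by blast
qed

text \<open>Monomials and points are added in pairs. Up to scalars a single combination
  \<open>g\<close> of the enlarged set vanishes at the old points, and the new point is chosen where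
  \<open>g\<close> does not vanish.\<close>

lemma exists_unisolvent:
  fixes U :: "('n::finite option \<Rightarrow>\<^sub>0 nat) set"
  assumes inf: "infinite (UNIV :: 'k::field set)" and "finite U" "U \<subseteq> {t. monom_deg t = d}"
  shows "\<exists>b :: nat \<Rightarrow> 'n \<Rightarrow> 'k. \<forall>F. keys F \<subseteq> U \<longrightarrow> (\<forall>i<card U. ev (b i) F = 0) \<longrightarrow> F = 0"
  using assms(2,3)
proof (induction U rule: finite_induct)
  case empty
  show ?case by auto
next
  case (insert u U)
  then obtain b :: "nat \<Rightarrow> 'n \<Rightarrow> 'k" where
    b: "\<And>F. keys F \<subseteq> U \<Longrightarrow> (\<forall>i<card U. ev (b i) F = 0) \<Longrightarrow> F = 0" by auto
  obtain g :: "('n option, 'k) mpol" where g: "g \<noteq> 0" "keys g \<subseteq> insert u U" "\<And>i. i < card U \<Longrightarrow> ev (b i) g = 0"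
    using vanishing_combination[of "insert u U" "{..<card U}" b] insert by auto
  have gu: "lookup g u \<noteq> 0"
  proof
    assume "lookup g u = 0"
    then have "keys g \<subseteq> U" using g(2) by (auto simp: in_keys_iff)
    then show False using b g by blast
  qed
  have "homogeneous d g" using g(2) insert.prems by (auto simp: homogeneous_def)
  then obtain x where x: "ev x g \<noteq> 0" using form_nonvanishing_point[OF inf g(1)] by blast
  define b' where "b' = b(card U := x)"
  have "F = 0" if F: "keys F \<subseteq> insert u U" "\<And>i. i < card (insert u U) \<Longrightarrow> ev (b' i) F = 0" for F
  proof -
    \<comment> \<open>Subtracting the multiple of \<open>g\<close> that cancels \<open>u\<close>
      leads back to the induction hypothesis, so \<open>F\<close> is a multiple of
      \<open>g\<close>.\<close>
    let ?c = "lookup F u / lookup g u"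
    let ?F = "F - single 0 ?c * g"
    have ev: "ev y ?F = ev y F - ?c * ev y g" for y by (simp add: ev_diff ev_const_mult)
    note lk = lookup_const_mult
    have "keys ?F \<subseteq> U"
    proof
      fix t assume t: "t \<in> keys ?F"
      then have "t \<noteq> u" using gu by (auto simp: in_keys_iff lookup_minus lk)
      moreover have "t \<in> keys F \<or> t \<in> keys g"
        using t by (auto simp: in_keys_iff lookup_minus lk)
      ultimately show "t \<in> U" using F(1) g(2) by blast
    qed
    moreover have "\<forall>i<card U. ev (b i) ?F = 0"
    proof safe
      fix i assume i: "i < card U"
      then have "ev (b i) F = 0" using F(2)[of i] insert.hyps by (simp add: b'_def)
      then show "ev (b i) ?F = 0" using g(3)[OF i] by (simp add: ev)
    qed
    ultimately have Fg: "F = single 0 ?c * g" using b by fastforce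
    have "ev x F = 0" using F(2)[of "card U"] insert.hyps by (simp add: b'_def)
    then have "?c = 0" using x by (subst (asm) Fg) (simp add: ev_const_mult)
    then have "single 0 ?c = (0 :: ('n option, 'k) mpol)" by (simp only: single_zero)
    then show ?thesis using Fg by (metis mult_zero_left)
  qed
  then show ?case by blast
qed

text \<open>A nonzero form through the generic points would specialize to a nonzero form of the same
  degree through the unisolvent points just constructed.\<close>

lemma generic_unisolvent:
  fixes a :: "nat \<Rightarrow> 'n::finite \<Rightarrow> 'k::field" and F :: "('n option, 'k) mpol"
  assumes inf: "infinite (UNIV :: 'k set)"
    and gen: "alg_independent prime_field ({..<n} \<times> UNIV) (\<lambda>(i, j). a i j)"
    and n: "n = card {t :: 'n option \<Rightarrow>\<^sub>0 nat. monom_deg t = s}"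
    and F: "homogeneous s F" "\<And>i. i < n \<Longrightarrow> ev (a i) F = 0"
  shows "F = 0"
proof (rule ccontr)
  assume "F \<noteq> 0"
  obtain b :: "nat \<Rightarrow> 'n \<Rightarrow> 'k" where
    b: "\<And>G. keys G \<subseteq> {t. monom_deg t = s} \<Longrightarrow> (\<forall>i<n. ev (b i) G = 0) \<Longrightarrow> G = 0"
    using exists_unisolvent[OF inf finite_monom_deg, of s] unfolding n by blast
  have w: "sum w UNIV < 1 \<longleftrightarrow> w = (\<lambda>_. 0)" for w :: "'n \<Rightarrow> nat" by (auto simp: fun_eq_iff)
  obtain G where "G \<noteq> 0" "homogeneous s G" "\<forall>i<n. \<forall>w. sum w UNIV < 1 \<longrightarrow> hasse (b i) w G = 0"
    using specialization[OF gen \<open>F \<noteq> 0\<close> F(1), of "\<lambda>_. 1" b] F(2) unfolding w hasse_eval[symmetric] by blast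
  then show False using b[of G] unfolding w by (auto simp: hasse_eval homogeneous_def)
qed

subsection \<open>Homogeneous ideals\<close>

definition hcomp :: "nat \<Rightarrow> ('v, 'a::comm_ring_1) mpol \<Rightarrow> ('v, 'a) mpol" where
  "hcomp T F = (\<Sum>t\<in>{t\<in>keys F. monom_deg t = T}. single t (lookup F t))"

lemma lookup_hcomp: "lookup (hcomp T F) t = (if monom_deg t = T then lookup F t else 0)"
  unfolding hcomp_def by (subst lookup_sum_single) (auto simp: in_keys_iff)

lemma homogeneous_hcomp: "homogeneous T (hcomp T F)"
  by (auto simp: homogeneous_def in_keys_iff lookup_hcomp split: if_splits)

lemma hcomp_add: "hcomp T (F + G) = hcomp T F + hcomp T G"
  by (rule poly_mapping_eqI) (simp add: lookup_hcomp lookup_add)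

lemma hcomp_zero [simp]: "hcomp T 0 = 0"
  by (rule poly_mapping_eqI) (simp add: lookup_hcomp)

lemma hcomp_homogeneous: "homogeneous d F \<Longrightarrow> hcomp T F = (if d = T then F else 0)"
  by (rule poly_mapping_eqI) (auto simp: lookup_hcomp homogeneous_def in_keys_iff)

lemma hcomp_mult:
  assumes "homogeneous d G"
  shows "hcomp T (F * G) = (if d \<le> T then hcomp (T - d) F * G else 0)"
proof (induction F rule: poly_mapping_sum_induct)
  case (single t c)
  have "homogeneous (monom_deg t + d) (single t c * G)"
    by (intro homogeneous_mult homogeneous_single assms) simp
  moreover have "homogeneous (monom_deg t) (single t c)" by (simp add: homogeneous_single)
  ultimately show ?case by (auto simp: hcomp_homogeneous)
qed (simp_all add: hcomp_add distrib_right)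

lemma sum_hcomp: "F = (\<Sum>T\<in>monom_deg ` keys F. hcomp T F)"
proof (rule poly_mapping_eqI)
  fix t
  have "lookup (\<Sum>T\<in>monom_deg ` keys F. hcomp T F) t =
      (\<Sum>T\<in>monom_deg ` keys F. if monom_deg t = T then lookup F t else 0)"
    by (simp add: lookup_sum lookup_hcomp)
  also have "\<dots> = lookup F t" by (auto simp: in_keys_iff)
  finally show "lookup F t = lookup (\<Sum>T\<in>monom_deg ` keys F. hcomp T F) t" ..
qed

lemma hcomp_in_ideal_gen:
  assumes "F \<in> ideal_gen S" and S: "\<And>x. x \<in> S \<Longrightarrow> \<exists>d. homogeneous d x"
  shows "hcomp T F \<in> ideal_gen S"
  using assms(1)
proof (induction rule: ideal_gen_induct)
  case (gen c x)
  then obtain d where "homogeneous d x" using S by blast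
  then show ?case using gen by (auto simp: hcomp_mult intro: ideal_gen_mult ideal_gen_base)
qed (auto simp: hcomp_add intro: ideal_gen_add)

lemma ideal_gen_times:
  assumes "f \<in> ideal_gen A" "g \<in> ideal_gen B"
  shows "f * g \<in> ideal_gen {a * b |a b. a \<in> A \<and> b \<in> B}" (is "_ \<in> ideal_gen ?AB")
  using assms(1)
proof (induction rule: ideal_gen_induct)
  case (gen c x)
  from assms(2) show ?case
  proof (induction rule: ideal_gen_induct)
    case (gen d y)
    then have "(c * d) * (x * y) \<in> ideal_gen ?AB"
      using \<open>x \<in> A\<close> by (intro ideal_gen_mult ideal_gen_base) blast
    then show ?case by (simp add: mult_ac)
  qed (simp_all add: distrib_left ideal_gen_add)
qed (simp_all add: distrib_right ideal_gen_add)

definition power_gens :: "'a::comm_ring_1 set \<Rightarrow> nat \<Rightarrow> 'a set" where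
  "power_gens S m = {prod_list xs |xs. set xs \<subseteq> S \<and> length xs = m}"

lemma ideal_power_gens: "ideal_power (ideal_gen S) m = ideal_gen (power_gens S m)"
proof
  show "ideal_power (ideal_gen S) m \<subseteq> ideal_gen (power_gens S m)"
  proof (induction m)
    case 0
    have "1 \<in> ideal_gen (power_gens S 0)" by (rule ideal_gen_base) (simp add: power_gens_def)
    then show ?case using ideal_gen_mult[of 1 "power_gens S 0"] by force
  next
    case (Suc m)
    have "{a * b |a b. a \<in> S \<and> b \<in> power_gens S m} \<subseteq> power_gens S (Suc m)"
    proof safe
      fix a b assume "a \<in> S" "b \<in> power_gens S m"
      then obtain xs where "b = prod_list xs" "set xs \<subseteq> S" "length xs = m"
        unfolding power_gens_def by blast
      then show "a * b \<in> power_gens S (Suc m)" unfolding power_gens_def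
        using \<open>a \<in> S\<close> by (intro CollectI exI[of _ "a # xs"]) simp
    qed
    then have "ideal_gen {a * b |a b. a \<in> S \<and> b \<in> power_gens S m} \<subseteq> ideal_gen (power_gens S (Suc m))"
      by (intro ideal_gen_minimal is_ideal_gen) (auto intro: ideal_gen_base)
    then have "f * g \<in> ideal_gen (power_gens S (Suc m))"
      if "f \<in> ideal_gen S" "g \<in> ideal_power (ideal_gen S) m" for f g
      using ideal_gen_times[of f S g "power_gens S m"] that Suc.IH by blast
    then show ?case unfolding ideal_power.simps ideal_mult_def
      by (intro ideal_gen_minimal is_ideal_gen) blast
  qed
  show "ideal_gen (power_gens S m) \<subseteq> ideal_power (ideal_gen S) m"
  proof (rule ideal_gen_minimal[OF _ is_ideal_power], safe)
    fix x assume "x \<in> power_gens S m"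
    then obtain xs where "x = prod_list xs" "set xs \<subseteq> S" "length xs = m"
      unfolding power_gens_def by blast
    then show "x \<in> ideal_power (ideal_gen S) m"
      using prod_list_in_ideal_power[of xs "ideal_gen S"] by (auto intro: ideal_gen_base)
  qed
qed

text \<open>A power of an ideal generated by forms is generated by products of forms. This reduces
  the containment of a symbolic power in an ordinary power to forms.\<close>

lemma hcomp_in_ideal_power:
  fixes Z :: "('k::field, 'n) proj set"
  assumes "F \<in> ideal_power (ideal_of Z) m"
  shows "hcomp T F \<in> ideal_power (ideal_of Z) m"
proof -
  have "\<exists>d. homogeneous d (prod_list xs)" if "\<And>x. x \<in> set xs \<Longrightarrow> \<exists>d. homogeneous d x"
    for xs :: "('n option, 'k) mpol list"
    using that
  proof (induction xs)
    case Nil show ?case using homogeneous_one by (intro exI[of _ 0]) simp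
  next
    case (Cons x xs)
    from Cons.prems obtain d where "homogeneous d x" by fastforce
    moreover obtain e where "homogeneous e (prod_list xs)" using Cons by auto
    ultimately show ?case using homogeneous_mult[of d x e "prod_list xs"] by auto
  qed
  then show ?thesis
    using assms unfolding ideal_of_def ideal_power_gens
    by (elim hcomp_in_ideal_gen) (auto simp: power_gens_def subset_iff)
qed

definition order_ge :: "nat \<Rightarrow> ('v, 'a::comm_ring_1) mpol set" where
  "order_ge k = {F. \<forall>t\<in>keys F. k \<le> monom_deg t}"

lemma order_ge_mult: "F \<in> order_ge k \<Longrightarrow> G \<in> order_ge l \<Longrightarrow> F * G \<in> order_ge (k + l)"
  using Poly_Mapping.keys_mult[of F G] by (fastforce simp: order_ge_def monom_deg_add intro: add_mono)

lemma is_ideal_order_ge: "is_ideal (order_ge k :: ('v, 'a::comm_ring_1) mpol set)"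
  unfolding is_ideal_def
proof safe
  show "0 \<in> order_ge k" by (simp add: order_ge_def)
  show "F + G \<in> order_ge k" if "F \<in> order_ge k" "G \<in> order_ge k" for F G :: "('v, 'a) mpol"
    using that Poly_Mapping.keys_add[of F G] by (auto simp: order_ge_def)
  show "F * G \<in> order_ge k" if "G \<in> order_ge k" for F G :: "('v, 'a) mpol"
    using order_ge_mult[of F 0 G k] that by (simp add: order_ge_def)
qed

lemma ideal_power_order_ge:
  assumes "I \<subseteq> order_ge k"
  shows "ideal_power I m \<subseteq> order_ge (m * k)"
proof (induction m)
  case 0 show ?case by (simp add: order_ge_def)
next
  case (Suc m)
  show ?case unfolding ideal_power.simps ideal_mult_def
    by (rule ideal_gen_minimal[OF _ is_ideal_order_ge])
       (use assms Suc order_ge_mult[of _ k _ "m * k"] in auto)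
qed

lemma form_ideal_power_degree:
  assumes "I \<subseteq> order_ge k" "F \<in> ideal_power I m" "F \<noteq> 0" "homogeneous d F"
  shows "m * k \<le> d"
proof -
  obtain t where "t \<in> keys F" using assms(3) by (metis keys_eq_empty ex_in_conv)
  moreover have "F \<in> order_ge (m * k)" using ideal_power_order_ge[OF assms(1), of m] assms(2) by blast
  ultimately show ?thesis using assms(4) by (auto simp: order_ge_def homogeneous_def)
qed

text \<open>One factor \<open>f\<close> is given to each of the \<open>r\<close> factors from
  \<open>P\<close>. It is meant for a separating form \<open>f\<close> and the ideal
  \<open>P\<close> of a single point.\<close>

lemma ideal_power_mult_subset:
  assumes I: "is_ideal I" and f: "\<And>x. x \<in> P \<Longrightarrow> f * x \<in> I" and "G \<in> ideal_power P r"
  shows "f ^ r * G \<in> ideal_power I r"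
  using assms(3)
proof (induction r arbitrary: G)
  case (Suc r)
  from Suc.prems have "G \<in> ideal_gen {x * y |x y. x \<in> P \<and> y \<in> ideal_power P r}"
    by (simp add: ideal_mult_def)
  then show ?case
  proof (induction rule: ideal_gen_induct)
    case (gen c x)
    then obtain p g where x: "x = p * g" "p \<in> P" "g \<in> ideal_power P r" by blast
    have "(f * p) * (f ^ r * g) \<in> ideal_power I (Suc r)"
      by (intro ideal_power_SucI f x Suc.IH)
    then have "c * ((f * p) * (f ^ r * g)) \<in> ideal_power I (Suc r)"
      by (rule is_idealD(3)[OF is_ideal_power])
    moreover have "f ^ Suc r * (c * x) = c * ((f * p) * (f ^ r * g))"
      by (simp add: x(1) mult_ac)
    ultimately show ?case by (simp only:)
  next
    case zero
    show ?case using is_idealD(1)[OF is_ideal_power, of I "Suc r"] by (simp del: ideal_power.simps)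
  next
    case (add x y)
    then show ?case unfolding distrib_left by (rule is_idealD(2)[OF is_ideal_power])
  qed
qed simp

subsection \<open>Divisibility by \<open>x\<^sub>0\<close>\<close>

lemma lookup_minus_nat: "lookup (s - t) i = lookup s i - lookup t i" for s t :: "'v \<Rightarrow>\<^sub>0 nat"
  by (simp add: minus_poly_mapping.rep_eq)

lemma single_add_minus: "0 < lookup t i \<Longrightarrow> single i 1 + (t - single i 1) = t" for t :: "'v \<Rightarrow>\<^sub>0 nat"
  by (rule poly_mapping_eqI) (auto simp: lookup_add lookup_minus_nat lookup_single when_def)

lemma monom_deg_minus_single:
  assumes "0 < lookup t i"
  shows "monom_deg (t - single i 1) = monom_deg t - 1"
  using monom_deg_add[of "single i 1" "t - single i 1"] unfolding single_add_minus[OF assms] monom_deg_single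
  by linarith

lemma lookup_var_mult:
  "lookup (var i * F) t = (if lookup t i = 0 then 0 else lookup F (t - single i 1))"
proof (induction F rule: poly_mapping_sum_induct)
  case (single s c)
  have "single i 1 + s = t \<longleftrightarrow> lookup t i \<noteq> 0 \<and> s = t - single i 1"
    using single_add_minus[of t i] by (auto simp: lookup_add)
  then show ?case by (auto simp: var_mult_single lookup_single when_def)
qed (auto simp: distrib_left lookup_add)

lemma var_mult_cancel:
  assumes "var i * F = var i * (G :: ('v, 'a::comm_ring_1) mpol)"
  shows "F = G"
proof (rule poly_mapping_eqI)
  fix t
  have "lookup (var i * F) (single i 1 + t) = lookup (var i * G) (single i 1 + t)" using assms by simp
  then show "lookup F t = lookup G t" by (simp add: lookup_var_mult lookup_add)
qed

lemma var_power_mult_eq_0: "var i ^ k * F = 0 \<Longrightarrow> F = (0 :: ('v, 'a::comm_ring_1) mpol)"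
proof (induction k)
  case (Suc k)
  from Suc.prems have "var i * (var i ^ k * F) = var i * 0" by (simp add: mult.assoc)
  then have "var i ^ k * F = 0" by (rule var_mult_cancel)
  then show ?case by (rule Suc.IH)
qed simp

lemma divisible_by_var:
  fixes F :: "('v, 'a::comm_ring_1) mpol"
  assumes F: "homogeneous (Suc d) F" and z: "\<And>t. lookup t i = 0 \<Longrightarrow> lookup F t = 0"
  shows "\<exists>G. homogeneous d G \<and> F = var i * G"
proof (intro exI conjI)
  let ?G = "\<Sum>t\<in>keys F. single (t - single i 1) (lookup F t)"
  have pos: "0 < lookup t i" if "t \<in> keys F" for t using z[of t] that by (auto simp: in_keys_iff)
  show "homogeneous d ?G"
  proof (rule homogeneous_sum, rule homogeneous_single)
    show "monom_deg (t - single i 1) = d" if "t \<in> keys F" for t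
      using F that monom_deg_minus_single[OF pos[OF that]] by (simp add: homogeneous_def)
  qed
  have "var i * ?G = (\<Sum>t\<in>keys F. single (single i 1 + (t - single i 1)) (lookup F t))"
    by (simp only: sum_distrib_left var_mult_single)
  also have "\<dots> = (\<Sum>t\<in>keys F. single t (lookup F t))"
    by (intro sum.cong refl) (simp only: single_add_minus pos)
  also have "\<dots> = F" by (rule sum_single[symmetric])
  finally show "F = var i * ?G" ..
qed

subsection \<open>Powers of the ideal of a unisolvent point set\<close>

text \<open>Evaluation of forms of degree \<open>s\<close> at the points is an injective linear map
  between spaces of equal dimension. This is the source both of the separating forms and of the
  generators in degree \<open>s + 1\<close>.\<close>

locale unisolvent_points =
  fixes a :: "nat \<Rightarrow> 'n::finite \<Rightarrow> 'k::field" and n s :: nat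
  assumes card_monoms: "n = card {t :: 'n option \<Rightarrow>\<^sub>0 nat. monom_deg t = s}"
    and unisolvent: "homogeneous s F \<Longrightarrow> (\<And>i. i < n \<Longrightarrow> ev (a i) F = 0) \<Longrightarrow> F = 0"
begin

definition I :: "('n option, 'k) mpol set" where
  "I = ideal_of ((\<lambda>i. affine_point (a i)) ` {..<n})"

lemma is_ideal_I: "is_ideal I"
  by (simp add: I_def is_ideal_of)

lemma I_subset: "i < n \<Longrightarrow> I \<subseteq> point_ideal (a i)"
  unfolding I_def ideal_of_def point_ideal_def
  by (rule ideal_gen_minimal[OF _ is_ideal_gen]) (auto intro!: ideal_gen_base)

lemma ev_I: "F \<in> I \<Longrightarrow> i < n \<Longrightarrow> ev (a i) F = 0"
  using I_subset mpol_eval_point_ideal by blast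

lemma form_in_I: "homogeneous d F \<Longrightarrow> (\<And>i. i < n \<Longrightarrow> ev (a i) F = 0) \<Longrightarrow> F \<in> I"
  unfolding I_def ideal_of_def by (rule ideal_gen_base) (auto simp: vanishes_at_affine_point)

text \<open>Multiplication by a power of \<open>x\<^sub>0\<close>, which takes the value 1 at every
  point, raises the degree to \<open>s\<close>.\<close>

lemma form_in_I_low_degree:
  assumes "homogeneous d F" "d \<le> s" "\<And>i. i < n \<Longrightarrow> ev (a i) F = 0"
  shows "F = 0"
proof -
  have "homogeneous (s - d + d) (var None ^ (s - d) * F)"
    using homogeneous_power[OF homogeneous_var, of "s - d" None] assms(1) by (intro homogeneous_mult) simp_all
  then have "var None ^ (s - d) * F = 0"
    using assms by (intro unisolvent) (simp_all add: ev_mult)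
  then show ?thesis by (rule var_power_mult_eq_0)
qed

section \<open>Generators of the ideal in degree \<open>s + 1\<close>\<close>

definition pure :: "('n option \<Rightarrow>\<^sub>0 nat) set" where
  "pure = {t. lookup t None = 0}"

definition pures :: "('n option \<Rightarrow>\<^sub>0 nat) set" where
  "pures = {t. monom_deg t = Suc s \<and> lookup t None = 0}"

text \<open>The monomial \<open>u\<close> and the \<open>n\<close> multiples of
  \<open>x\<^sub>0\<close> in degree \<open>s + 1\<close> give \<open>n + 1\<close> unknowns for
  \<open>n\<close> conditions. If \<open>u\<close> did not occur in the solution, division by
  \<open>x\<^sub>0\<close> would leave a form of degree \<open>s\<close> through all points, which
  is zero.\<close>

lemma exists_generator:
  assumes u: "u \<in> pures"
  shows "\<exists>g. homogeneous (Suc s) g \<and> g \<in> I \<and> (\<exists>q. homogeneous s q \<and> g = single u 1 + var None * q)"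
proof -
  let ?S = "{t :: 'n option \<Rightarrow>\<^sub>0 nat. monom_deg t = s}"
  let ?U = "insert u ((+) (single None 1) ` ?S)"
  have not_in: "u \<notin> (+) (single None 1) ` ?S" using u by (auto simp: pures_def lookup_add)
  have "card ((+) (single None 1) ` ?S) = n"
    unfolding card_monoms by (rule card_image) (auto intro: inj_onI)
  then have "card {..<n} < card ?U" using not_in by simp
  then obtain F where F: "F \<noteq> 0" "keys F \<subseteq> ?U" "\<forall>i\<in>{..<n}. ev (a i) F = 0"
    using vanishing_combination[of ?U "{..<n}" a] by auto
  have hom: "homogeneous (Suc s) F"
    using F(2) u by (auto simp: homogeneous_def pures_def monom_deg_add)
  have pure_F: "lookup F t = 0" if "lookup t None = 0" "t \<noteq> u" for t
  proof -
    have "t \<notin> ?U" using that by (auto simp: lookup_add)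
    then show ?thesis using F(2) by (auto simp: in_keys_iff)
  qed
  have Fu: "lookup F u \<noteq> 0"
  proof
    assume "lookup F u = 0"
    then have "lookup F t = 0" if "lookup t None = 0" for t using pure_F that by (cases "t = u") auto
    from divisible_by_var[OF hom this] obtain q where q: "homogeneous s q" "F = var None * q" by blast
    then have "q = 0" using F(3) by (intro unisolvent) (auto simp: ev_mult ev_var_None)
    then show False using q F(1) by simp
  qed
  define g where "g = single 0 (inverse (lookup F u)) * F"
  have g: "homogeneous (Suc s) g" unfolding g_def by (rule homogeneous_const_mult[OF hom])
  have "g \<in> I" using F(3) by (intro form_in_I[OF g]) (simp add: g_def ev_const_mult)
  have hom1: "homogeneous (Suc s) (g - single u 1)"
    using g u by (intro homogeneous_diff homogeneous_single) (auto simp: pures_def)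
  have "lookup (g - single u 1) t = 0" if "lookup t None = 0" for t
    using pure_F[OF that] Fu by (cases "t = u") (simp_all add: g_def lookup_minus lookup_const_mult lookup_single when_def)
  from divisible_by_var[OF hom1 this]
  obtain q where q: "homogeneous s q" "g - single u 1 = var None * q" by blast
  from q(2) have "g = single u 1 + var None * q" by (metis add.commute diff_add_cancel)
  then show ?thesis using g \<open>g \<in> I\<close> q(1) by blast
qed

definition gen :: "('n option \<Rightarrow>\<^sub>0 nat) \<Rightarrow> ('n option, 'k) mpol" where
  "gen u = (SOME g. homogeneous (Suc s) g \<and> g \<in> I \<and> (\<exists>q. homogeneous s q \<and> g = single u 1 + var None * q))"

lemma gen:
  assumes "u \<in> pures"
  shows "homogeneous (Suc s) (gen u)" "gen u \<in> I" "\<exists>q. homogeneous s q \<and> gen u = single u 1 + var None * q"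
proof -
  have "homogeneous (Suc s) (gen u) \<and> gen u \<in> I \<and> (\<exists>q. homogeneous s q \<and> gen u = single u 1 + var None * q)"
    unfolding gen_def by (rule someI_ex[OF exists_generator[OF assms]])
  then show "homogeneous (Suc s) (gen u)" "gen u \<in> I" "\<exists>q. homogeneous s q \<and> gen u = single u 1 + var None * q"
    by blast+
qed

lemma gen_nonzero: "u \<in> pures \<Longrightarrow> gen u \<noteq> 0"
proof -
  assume u: "u \<in> pures"
  then obtain q where "gen u = single u 1 + var None * q" using gen(3) by blast
  then have "lookup (gen u) u = 1" using u by (simp add: lookup_add lookup_var_mult pures_def)
  then show ?thesis by auto
qed

section \<open>Separating forms and saturation\<close>

lemma exists_separator:
  assumes "i < n"
  shows "\<exists>f. homogeneous s f \<and> ev (a i) f = 1 \<and> (\<forall>l<n. l \<noteq> i \<longrightarrow> ev (a l) f = 0)"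
proof -
  let ?S = "{t :: 'n option \<Rightarrow>\<^sub>0 nat. monom_deg t = s}"
  have "card ({..<n} - {i}) < card ?S" using assms by (simp add: card_monoms)
  then obtain F where F: "F \<noteq> 0" "keys F \<subseteq> ?S" "\<forall>l\<in>{..<n} - {i}. ev (a l) F = 0"
    using vanishing_combination[of ?S "{..<n} - {i}" a] by auto
  have hom: "homogeneous s F" using F(2) by (auto simp: homogeneous_def)
  have "ev (a i) F \<noteq> 0" using unisolvent[OF hom] F(1,3) by (metis DiffI lessThan_iff singletonD)
  then show ?thesis using F(3) homogeneous_const_mult[OF hom]
    by (intro exI[of _ "single 0 (inverse (ev (a i) F)) * F"]) (simp add: ev_const_mult)
qed

text \<open>The separators \<open>f\<^sub>i\<close> sum to \<open>x\<^sub>0\<^sup>s\<close>, and \<open>f\<^sub>i\<^sup>r\<close> multiplies the symbolic power into \<open>I\<^sup>r\<close>.\<close>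

lemma symbolic_power_saturated:
  assumes F: "\<And>i. i < n \<Longrightarrow> F \<in> ideal_power (point_ideal (a i)) r"
  shows "\<exists>k. var None ^ k * F \<in> ideal_power I r"
proof -
  have "\<forall>i. \<exists>f. i < n \<longrightarrow> homogeneous s f \<and> ev (a i) f = 1 \<and> (\<forall>l<n. l \<noteq> i \<longrightarrow> ev (a l) f = 0)"
    using exists_separator by blast
  then obtain f where f: "\<And>i. i < n \<Longrightarrow> homogeneous s (f i)" "\<And>i. i < n \<Longrightarrow> ev (a i) (f i) = 1"
    "\<And>i l. i < n \<Longrightarrow> l < n \<Longrightarrow> l \<noteq> i \<Longrightarrow> ev (a l) (f i) = 0" by metis
  define J where "J = {h. h * F \<in> ideal_power I r}"
  have J: "is_ideal J"
    unfolding is_ideal_def J_def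
    by (auto simp: distrib_right mult.assoc intro: is_idealD[OF is_ideal_power])
  have "f i ^ r \<in> J" if i: "i < n" for i
    unfolding J_def
  proof (intro CollectI ideal_power_mult_subset[OF is_ideal_I])
    fix x assume "x \<in> point_ideal (a i)"
    then have "x \<in> ideal_gen (range (linform (a i)))" by (simp add: point_ideal_eq)
    then show "f i * x \<in> I"
    proof (induction rule: ideal_gen_induct)
      case (gen c x)
      then obtain j where x: "x = linform (a i) j" by blast
      have "f i * x \<in> I"
      proof (rule form_in_I)
        show "homogeneous (s + 1) (f i * x)" unfolding x by (intro homogeneous_mult f i homogeneous_linform)
        have "ev (a i) x = 0" unfolding x by (rule mpol_eval_point_ideal[OF linform_in_point_ideal])
        then show "ev (a l) (f i * x) = 0" if "l < n" for l
          using f(3)[OF i that] by (cases "l = i") (simp_all add: ev_mult)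
      qed
      then have "c * (f i * x) \<in> I" by (rule is_idealD(3)[OF is_ideal_I])
      then show ?case by (simp add: mult_ac)
    qed (auto simp: distrib_left intro: is_idealD[OF is_ideal_I])
  qed (rule F[OF i])
  \<comment> \<open>The ideal \<open>J\<close> of multipliers contains a power of each separator,
    hence a power of their sum.\<close>
  then have "\<exists>m. (sum f {..<n}) ^ m \<in> J" by (intro radical_sum[OF J]) auto
  then obtain m where m: "(sum f {..<n}) ^ m \<in> J" by blast
  \<comment> \<open>Both forms have degree \<open>s\<close> and take the value 1 at every
    point.\<close>
  have "sum f {..<n} - var None ^ s = 0"
  proof (rule unisolvent)
    show "homogeneous s (sum f {..<n} - var None ^ s)"
      using homogeneous_power[OF homogeneous_var, of s None] f(1)
      by (intro homogeneous_diff homogeneous_sum) auto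
    fix i assume i: "i < n"
    have "(\<Sum>l<n. ev (a i) (f l)) = (\<Sum>l<n. if l = i then 1 else 0)"
      by (rule sum.cong) (use f i in auto)
    then show "ev (a i) (sum f {..<n} - var None ^ s) = 0"
      using i by (simp add: ev_diff ev_sum ring_map.power[OF ring_map_mpol_eval] ev_var_None)
  qed
  then have "var None ^ (s * m) \<in> J" using m by (simp add: power_mult)
  then show ?thesis by (auto simp: J_def)
qed

text \<open>Congruences are taken modulo this ideal and not modulo \<open>x\<^sub>0\<close> alone,
  since the cofactor of \<open>x\<^sub>0\<close> must lie in \<open>I\<^sup>r\<close> when
  \<open>x\<^sub>0\<close> is finally cancelled.\<close>

definition XI :: "nat \<Rightarrow> ('n option, 'k) mpol set" where
  "XI r = {var None * f |f. f \<in> ideal_power I r}"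

lemma XI_I: "f \<in> ideal_power I r \<Longrightarrow> var None * f \<in> XI r"
  by (auto simp: XI_def)

lemma is_ideal_XI: "is_ideal (XI r)"
  unfolding is_ideal_def
proof safe
  show "0 \<in> XI r" using XI_I[OF is_idealD(1)[OF is_ideal_power], of r] by simp
  show "x + y \<in> XI r" if "x \<in> XI r" "y \<in> XI r" for x y
  proof -
    from that obtain f g where "x = var None * f" "y = var None * g" "f \<in> ideal_power I r" "g \<in> ideal_power I r"
      unfolding XI_def by blast
    then show ?thesis using XI_I[of "f + g" r] is_idealD(2)[OF is_ideal_power[of I r], of f g] by (simp add: distrib_left)
  qed
  show "c * x \<in> XI r" if "x \<in> XI r" for c x
  proof -
    from that obtain f where "x = var None * f" "f \<in> ideal_power I r" unfolding XI_def by blast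
    then show ?thesis using XI_I[of "c * f" r] is_idealD(3)[OF is_ideal_power[of I r], of f c] by (simp add: mult_ac)
  qed
qed

lemma XI_mult_gen: "x \<in> XI r \<Longrightarrow> g \<in> I \<Longrightarrow> g * x \<in> XI (Suc r)"
proof -
  assume "x \<in> XI r" "g \<in> I"
  then obtain f where f: "x = var None * f" "f \<in> ideal_power I r" unfolding XI_def by blast
  then have "var None * (g * f) \<in> XI (Suc r)" using \<open>g \<in> I\<close> by (intro XI_I ideal_power_SucI)
  then show ?thesis by (simp add: f(1) mult_ac)
qed

section \<open>Products of generators and the exchange of variables\<close>

lemma split_monomial:
  fixes W :: "'n option \<Rightarrow>\<^sub>0 nat"
  shows "d \<le> monom_deg W \<Longrightarrow> \<exists>u v. u + v = W \<and> monom_deg u = d"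
proof (induction d)
  case 0
  show ?case by (intro exI[of _ 0] exI[of _ W]) simp
next
  case (Suc d)
  then obtain u v where uv: "u + v = W" "monom_deg u = d" by auto
  then have "monom_deg v \<noteq> 0" using Suc.prems by (auto simp: monom_deg_add)
  then obtain i where "lookup v i \<noteq> 0" by (auto simp: monom_deg_UNIV)
  then have "single i 1 + (v - single i 1) = v" by (intro single_add_minus) simp
  then have "(u + single i 1) + (v - single i 1) = W" using uv(1) by (simp add: add.assoc)
  moreover have "monom_deg (u + single i 1) = Suc d" using uv by (simp add: monom_deg_add)
  ultimately show ?case by blast
qed

lemma factor_monomial:
  assumes "W \<in> pure" "monom_deg W = r * Suc s + k"
  shows "\<exists>us z. length us = r \<and> set us \<subseteq> pures \<and> z \<in> pure \<and> monom_deg z = k \<and> sum_list us + z = W"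
  using assms
proof (induction r arbitrary: W)
  case 0
  then show ?case by (intro exI[of _ "[]"] exI[of _ W]) simp
next
  case (Suc r)
  then have "Suc s \<le> monom_deg W" by simp
  from split_monomial[OF this] obtain u v where uv: "u + v = W" "monom_deg u = Suc s" by blast
  then have "u \<in> pures" "v \<in> pure" using Suc.prems(1) by (auto simp: pure_def pures_def lookup_add)
  moreover have "monom_deg v = r * Suc s + k" using uv Suc.prems(2) by (simp add: monom_deg_add flip: uv(1))
  ultimately obtain us z where "length us = r" "set us \<subseteq> pures" "z \<in> pure" "monom_deg z = k" "sum_list us + z = v"
    using Suc.IH by blast
  with uv \<open>u \<in> pures\<close> show ?case by (intro exI[of _ "u # us"] exI[of _ z]) (simp add: add.assoc)
qed

definition gens :: "('n option \<Rightarrow>\<^sub>0 nat) list \<Rightarrow> ('n option, 'k) mpol" where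
  "gens us = prod_list (map gen us)"

lemma gens_Cons: "gens (u # us) = gen u * gens us"
  by (simp add: gens_def)

lemma gens_in_ideal_power: "set us \<subseteq> pures \<Longrightarrow> gens us \<in> ideal_power I (length us)"
  unfolding gens_def using prod_list_in_ideal_power[of "map gen us" I] gen(2) by auto

lemma homogeneous_gens: "set us \<subseteq> pures \<Longrightarrow> homogeneous (length us * Suc s) (gens us)"
proof (induction us)
  case (Cons u us)
  then have "homogeneous (Suc s + length us * Suc s) (gen u * gens us)"
    by (intro homogeneous_mult gen) auto
  then show ?case by (simp add: gens_Cons algebra_simps)
qed (simp add: gens_def)

lemma gens_mod_var: "set us \<subseteq> pures \<Longrightarrow> \<exists>q. gens us = single (sum_list us) 1 + var None * q"
proof (induction us)
  case Nil
  show ?case by (intro exI[of _ 0]) (simp add: gens_def)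
next
  case (Cons u us)
  then obtain q where q: "gens us = single (sum_list us) 1 + var None * q" by auto
  obtain q' where q': "gen u = single u 1 + var None * q'" using gen(3)[of u] Cons.prems by auto
  have "gens (u # us) = single (sum_list (u # us)) 1 +
      var None * (q' * single (sum_list us) 1 + q * single u 1 + var None * q * q')"
    unfolding gens_Cons q q' by (simp add: algebra_simps mult_single)
  then show ?case by blast
qed

text \<open>Each generator is a monomial modulo \<open>x\<^sub>0\<close>, so a product of generators
  has exactly one monomial free of \<open>x\<^sub>0\<close>.\<close>

lemma lookup_gens_pure:
  assumes "set us \<subseteq> pures" "lookup W None = 0"
  shows "lookup (single z c * gens us) W = (c when sum_list us + z = W)"
proof -
  obtain q where "gens us = single (sum_list us) 1 + var None * q" using gens_mod_var[OF assms(1)] by blast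
  then have "single z c * gens us = single (sum_list us + z) c + var None * (single z c * q)"
    by (simp add: distrib_left mult_single add.commute mult_ac)
  then show ?thesis using assms(2) by (simp add: lookup_add lookup_var_mult lookup_single)
qed

text \<open>Lifts the linear syzygies of the monomials of degree \<open>s + 1\<close> to the generators.\<close>

lemma syzygy_lift:
  assumes u: "u \<in> pures" and v: "v \<in> pures" and uv: "single j 1 + u = single i 1 + v"
  shows "\<exists>q\<in>I. var j * gen u - var i * gen v = var None * q"
proof -
  let ?H = "var j * gen u - var i * gen v"
  have H: "?H \<in> I" by (intro is_idealD[OF is_ideal_I] gen u v)
  have hom: "homogeneous (Suc (Suc s)) ?H"
    using homogeneous_mult[OF homogeneous_var gen(1)[OF u], of j] homogeneous_mult[OF homogeneous_var gen(1)[OF v], of i]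
    by (intro homogeneous_diff) simp_all
  obtain q q' where "gen u = single u 1 + var None * q" "gen v = single v 1 + var None * q'"
    using gen(3) u v by blast
  then have "?H = var None * (var j * q - var i * q')"
    using uv by (simp add: algebra_simps var_mult_single)
  then have "lookup ?H t = 0" if "lookup t None = 0" for t
    using that by (simp add: lookup_var_mult)
  from divisible_by_var[OF hom this] obtain q where q: "homogeneous (Suc s) q" "?H = var None * q"
    by blast
  \<comment> \<open>Division by \<open>x\<^sub>0\<close> preserves vanishing at the points, where
    \<open>x\<^sub>0\<close> is 1.\<close>
  have "q \<in> I"
  proof (rule form_in_I[OF q(1)])
    fix l assume "l < n"
    then have "ev (a l) (var None * q) = 0" using ev_I[OF H] q(2) by simp
    then show "ev (a l) q = 0" by (simp add: ev_mult ev_var_None)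
  qed
  with q(2) show ?thesis by blast
qed

lemma sum_list_pure: "set us \<subseteq> pures \<Longrightarrow> lookup (sum_list us) None = 0"
  by (induction us) (auto simp: lookup_add pures_def)

lemma monom_deg_sum_list: "set us \<subseteq> pures \<Longrightarrow> monom_deg (sum_list us) = length us * Suc s"
  by (induction us) (auto simp: monom_deg_add pures_def)

lemma exists_larger_exponent:
  fixes u v :: "'n option \<Rightarrow>\<^sub>0 nat"
  assumes "monom_deg u = monom_deg v" "u \<noteq> v"
  shows "\<exists>i. lookup v i < lookup u i"
proof (rule ccontr)
  assume *: "\<not> ?thesis"
  have "lookup u i = lookup v i" for i
    by (rule sum_mono_inv[of "lookup u" UNIV "lookup v"]) (use * assms(1) in \<open>auto simp: monom_deg_UNIV not_less\<close>)
  then show False using assms(2) by (auto intro: poly_mapping_eqI)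
qed

text \<open>Variables are exchanged between the generators through the nonconstant monomial \<open>z\<close>, one linear
  syzygy at a time.\<close>

lemma exchange:
  assumes "length us = r" "set us \<subseteq> pures" "z \<in> pure" "monom_deg z \<noteq> 0"
    and "length us' = r" "set us' \<subseteq> pures" "z' \<in> pure" "sum_list us + z = sum_list us' + z'"
  shows "single z 1 * gens us - single z' 1 * gens us' \<in> XI r"
  using assms
proof (induction r arbitrary: us z us' z')
  case 0
  then show ?case using is_idealD(1)[OF is_ideal_XI] by simp
next
  case (Suc r)
  from Suc.prems obtain u' vs' where us': "us' = u' # vs'" "length vs' = r" "u' \<in> pures" "set vs' \<subseteq> pures"
    by (cases us') auto
  \<comment> \<open>An inner induction transforms the head \<open>u\<close> into the head
    \<open>u'\<close> of the target; its measure is the total excess of the exponents of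
    \<open>u\<close> over those of \<open>u'\<close>. Once the heads agree, the outer induction
    handles the remaining \<open>r\<close> generators.\<close>
  have "single z 1 * gens (u # vs) - single z' 1 * gens us' \<in> XI (Suc r)"
    if "u \<in> pures" "set vs \<subseteq> pures" "length vs = r" "z \<in> pure" "monom_deg z \<noteq> 0"
      "u + sum_list vs + z = sum_list us' + z'" for u vs z
    using that
  proof (induction "\<Sum>i\<in>UNIV. lookup u i - lookup u' i" arbitrary: u vs z rule: less_induct)
    case less
    show ?case
    proof (cases "u = u'")
      case True
      have "u + (sum_list vs + z) = u + (sum_list vs' + z')"
        using less.prems(6) by (simp add: us' True add.assoc)
      then have "sum_list vs + z = sum_list vs' + z'" by simp
      then have "single z 1 * gens vs - single z' 1 * gens vs' \<in> XI r"
        using less.prems us' Suc.prems by (intro Suc.IH)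
      then have "gen u * (single z 1 * gens vs - single z' 1 * gens vs') \<in> XI (Suc r)"
        by (intro XI_mult_gen gen less.prems)
      then show ?thesis by (simp add: us'(1) True gens_Cons right_diff_distrib mult_ac)
    next
      case False
      have deg: "monom_deg u = monom_deg u'" using less.prems(1) us'(3) by (simp add: pures_def)
      obtain i where i: "lookup u' i < lookup u i"
        using exists_larger_exponent[OF deg False] by blast
      obtain j where j: "lookup u j < lookup u' j"
        using exists_larger_exponent[of u' u] deg False by auto
      \<comment> \<open>In the head the variable \<open>i\<close> is in excess and \<open>j\<close>
        is missing. Both sides have the same total exponents, so the missing \<open>j\<close> must
        occur in \<open>?W\<close>.\<close>
      let ?W = "sum_list vs + z"
      have "lookup (u + ?W) j = lookup (sum_list us' + z') j" using less.prems(6) by (simp add: add.assoc)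
      then have Wj: "0 < lookup ?W j" using j by (simp add: lookup_add us'(1)) linarith
      have "lookup u None = 0" "lookup u' None = 0" using less.prems(1) us'(3) by (auto simp: pures_def)
      then have ne: "i \<noteq> None" "j \<noteq> None" using i j by (metis not_less_zero)+
      have "?W \<in> pure" using less.prems by (simp add: pure_def lookup_add sum_list_pure)
      then have "?W - single j 1 \<in> pure" by (simp add: pure_def lookup_minus_nat)
      \<comment> \<open>Here \<open>z\<close> must be nonconstant: after \<open>j\<close> is taken
        out, the degree still suffices for \<open>r\<close> factors of degree
        \<open>s + 1\<close>.\<close>
      moreover have "monom_deg (?W - single j 1) = r * Suc s + (monom_deg z - 1)"
        using monom_deg_minus_single[OF Wj] less.prems by (simp add: monom_deg_add monom_deg_sum_list)
      ultimately obtain ws y where ws: "length ws = r" "set ws \<subseteq> pures" "y \<in> pure" "sum_list ws + y = ?W - single j 1"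
        using factor_monomial by blast
      have Wy: "sum_list ws + (single j 1 + y) = ?W"
        using single_add_minus[OF Wj] ws(4) by (metis add.left_commute)
      have "single z 1 * gens vs - single (single j 1 + y) 1 * gens ws \<in> XI r"
        using less.prems ws ne Wy by (intro Suc.IH) (auto simp: pure_def lookup_add lookup_single)
      then have "gen u * (single z 1 * gens vs - single (single j 1 + y) 1 * gens ws) \<in> XI (Suc r)"
        by (intro XI_mult_gen gen less.prems)
      then have 1: "single z 1 * gens (u # vs) - single (single j 1 + y) 1 * gens (u # ws) \<in> XI (Suc r)"
        by (simp add: gens_Cons right_diff_distrib mult_ac)
      \<comment> \<open>The head with one \<open>i\<close> traded for \<open>j\<close>, which lowers
        the excess over \<open>u'\<close>.\<close>
      define v where "v = single j 1 + (u - single i 1)"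
      have ui: "single i 1 + (u - single i 1) = u" using i by (intro single_add_minus) simp
      have uv: "single j 1 + u = single i 1 + v" unfolding v_def by (metis add.left_commute ui)
      have v: "v \<in> pures" using less.prems(1) ne i monom_deg_minus_single[of u i]
        by (auto simp: v_def pures_def monom_deg_add lookup_add lookup_minus_nat lookup_single)
      obtain q where q: "q \<in> I" "var j * gen u - var i * gen v = var None * q"
        using syzygy_lift[OF less.prems(1) v uv] by blast
      have "q * gens ws \<in> ideal_power I (Suc r)"
        using ideal_power_SucI[OF q(1) gens_in_ideal_power[OF ws(2)]] unfolding ws(1) .
      then have "var None * (single y 1 * (q * gens ws)) \<in> XI (Suc r)"
        by (rule XI_I[OF is_idealD(3)[OF is_ideal_power]])
      also have "var None * (single y 1 * (q * gens ws)) =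
          single y 1 * gens ws * (var j * gen u - var i * gen v)"
        unfolding q(2) by (simp add: mult_ac)
      also have "\<dots> = (var j * single y 1) * gens (u # ws) - (var i * single y 1) * gens (v # ws)"
        by (simp add: gens_Cons algebra_simps)
      finally have 2: "single (single j 1 + y) 1 * gens (u # ws) - single (single i 1 + y) 1 * gens (v # ws) \<in> XI (Suc r)"
        unfolding var_mult_single .
      have 3: "single (single i 1 + y) 1 * gens (v # ws) - single z' 1 * gens us' \<in> XI (Suc r)"
      proof (rule less.hyps)
        have v_lookup: "lookup v k = (if k = j then 1 else 0) + (lookup u k - (if k = i then 1 else 0))" for k
          by (simp add: v_def lookup_add lookup_minus_nat lookup_single when_def)
        show "(\<Sum>k\<in>UNIV. lookup v k - lookup u' k) < (\<Sum>k\<in>UNIV. lookup u k - lookup u' k)"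
        proof (rule sum_strict_mono_ex1)
          show "\<forall>k\<in>UNIV. lookup v k - lookup u' k \<le> lookup u k - lookup u' k"
            using j by (auto simp: v_lookup)
          show "\<exists>k\<in>UNIV. lookup v k - lookup u' k < lookup u k - lookup u' k"
            using i j by (intro bexI[of _ i]) (auto simp: v_lookup)
        qed simp
        show "v + sum_list ws + (single i 1 + y) = sum_list us' + z'"
        proof -
          have "v + sum_list ws + (single i 1 + y) = (single i 1 + v) + (sum_list ws + y)"
            by (simp add: add_ac)
          also have "\<dots> = u + (sum_list ws + (single j 1 + y))" unfolding uv[symmetric] by (simp add: add_ac)
          also have "\<dots> = sum_list us' + z'" unfolding Wy using less.prems(6) by (simp add: add.assoc)
          finally show ?thesis .
        qed
        show "single i 1 + y \<in> pure" using ws(3) ne by (simp add: pure_def lookup_add lookup_single)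
      qed (use v ws in \<open>simp_all add: monom_deg_add\<close>)
      show ?thesis
        using is_idealD(2)[OF is_ideal_XI is_idealD(2)[OF is_ideal_XI 1 2] 3] by simp
    qed
  qed
  moreover obtain u vs where "us = u # vs" using Suc.prems(1) by (cases us) auto
  ultimately show ?case using Suc.prems by (auto simp: add.assoc)
qed

text \<open>An arbitrary lift of the monomial \<open>W\<close> to \<open>I\<^sup>r\<close>. By
  \<open>exchange\<close> two lifts agree modulo \<open>XI r\<close> as soon as the degree of
  \<open>W\<close> exceeds \<open>r * Suc s\<close>.\<close>

definition lead :: "nat \<Rightarrow> ('n option \<Rightarrow>\<^sub>0 nat) \<Rightarrow> ('n option, 'k) mpol" where
  "lead r W = (SOME F. \<exists>us z. length us = r \<and> set us \<subseteq> pures \<and> z \<in> pure \<and> sum_list us + z = W \<and>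
     F = single z 1 * gens us)"

lemma lead:
  assumes "W \<in> pure" "r * Suc s \<le> monom_deg W"
  obtains us z where "length us = r" "set us \<subseteq> pures" "z \<in> pure" "sum_list us + z = W"
    "lead r W = single z 1 * gens us"
proof -
  have "monom_deg W = r * Suc s + (monom_deg W - r * Suc s)" using assms(2) by simp
  from factor_monomial[OF assms(1) this]
  have "\<exists>F us z. length us = r \<and> set us \<subseteq> pures \<and> z \<in> pure \<and> sum_list us + z = W \<and> F = single z 1 * gens us"
    by blast
  from someI_ex[OF this] show ?thesis using that unfolding lead_def by blast
qed

lemma lead_in_ideal_power:
  assumes "W \<in> pure" "r * Suc s \<le> monom_deg W"
  shows "lead r W \<in> ideal_power I r"
  using lead[OF assms] gens_in_ideal_power is_idealD(3)[OF is_ideal_power] by metis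

lemma lookup_lead:
  assumes "W \<in> pure" "r * Suc s \<le> monom_deg W" "lookup W' None = 0"
  shows "lookup (lead r W) W' = (1 when W = W')"
  using lead[OF assms(1,2)] lookup_gens_pure[OF _ assms(3)] by metis

lemma homogeneous_lead:
  assumes "W \<in> pure" "r * Suc s \<le> monom_deg W"
  shows "homogeneous (monom_deg W) (lead r W)"
proof -
  from lead[OF assms] obtain us z where us: "length us = r" "set us \<subseteq> pures" "z \<in> pure" "sum_list us + z = W"
    "lead r W = single z 1 * gens us" .
  have "homogeneous (monom_deg z + length us * Suc s) (single z 1 * gens us)"
    by (intro homogeneous_mult homogeneous_single homogeneous_gens us) simp
  moreover have "monom_deg z + length us * Suc s = monom_deg W"
    using us(4) monom_deg_sum_list[OF us(2)] by (auto simp: monom_deg_add)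
  ultimately show ?thesis using us(5) by simp
qed

section \<open>Leading parts and cancellation of \<open>x\<^sub>0\<close>\<close>

definition pure_deg :: "nat \<Rightarrow> ('n option \<Rightarrow>\<^sub>0 nat) set" where
  "pure_deg T = {W. monom_deg W = T \<and> W \<in> pure}"

lemma finite_pure_deg: "finite (pure_deg T)"
  by (rule finite_subset[OF _ finite_monom_deg[of T]]) (auto simp: pure_deg_def)

definition lead_part :: "nat \<Rightarrow> nat \<Rightarrow> ('n option, 'k) mpol \<Rightarrow> ('n option, 'k) mpol" where
  "lead_part r T F = (\<Sum>W\<in>pure_deg T. single 0 (lookup F W) * lead r W)"

lemma lead_part_add: "lead_part r T (F + G) = lead_part r T F + lead_part r T G"
  by (simp add: lead_part_def lookup_add single_add distrib_right sum.distrib)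

lemma lookup_lead_part:
  assumes "r * Suc s \<le> T" "W \<in> pure_deg T"
  shows "lookup (lead_part r T F) W = lookup F W"
proof -
  have "lookup (lead_part r T F) W = (\<Sum>W'\<in>pure_deg T. if W' = W then lookup F W' else 0)"
    unfolding lead_part_def lookup_sum lookup_const_mult
    using assms by (intro sum.cong) (auto simp: lookup_lead pure_deg_def pure_def)
  then show ?thesis using assms(2) finite_pure_deg by simp
qed

lemma homogeneous_lead_part: "r * Suc s \<le> T \<Longrightarrow> homogeneous T (lead_part r T F)"
  unfolding lead_part_def
  by (intro homogeneous_sum homogeneous_const_mult) (auto simp: pure_deg_def intro: homogeneous_lead)

lemma lead_part_in_ideal_power: "r * Suc s \<le> T \<Longrightarrow> lead_part r T F \<in> ideal_power I r"
  unfolding lead_part_def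
  by (intro is_ideal_sum is_idealD(3) is_ideal_power lead_in_ideal_power) (auto simp: pure_deg_def)

text \<open>Induction on the degree: subtracting lifts of the monomials free of
  \<open>x\<^sub>0\<close> leaves a multiple of \<open>x\<^sub>0\<close>, whose cofactor vanishes at
  the points and has smaller degree. In degree at most \<open>s\<close> only zero vanishes at all
  points.\<close>

lemma I_generators: "I = ideal_gen (gen ` pures)"
proof
  show "ideal_gen (gen ` pures) \<subseteq> I"
    by (rule ideal_gen_minimal[OF _ is_ideal_I]) (auto intro: gen)
  have "F \<in> ideal_gen (gen ` pures)" if "homogeneous d F" "\<And>i. i < n \<Longrightarrow> ev (a i) F = 0" for d F
    using that
  proof (induction d arbitrary: F)
    case 0
    then have "F = 0" by (intro form_in_I_low_degree[of 0]) auto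
    then show ?case by simp
  next
    case (Suc d)
    show ?case
    proof (cases "Suc d \<le> s")
      case True
      then have "F = 0" using Suc.prems by (intro form_in_I_low_degree[of "Suc d"]) auto
      then show ?thesis by simp
    next
      case False
      then have le: "1 * Suc s \<le> Suc d" by simp
      let ?L = "lead_part 1 (Suc d) F"
      have hom: "homogeneous (Suc d) (F - ?L)"
        by (intro homogeneous_diff Suc.prems homogeneous_lead_part le)
      have "lookup (F - ?L) W = 0" if "lookup W None = 0" for W
      proof (cases "monom_deg W = Suc d")
        case True
        then show ?thesis using that lookup_lead_part[OF le, of W F]
          by (simp add: lookup_minus pure_deg_def pure_def)
      next
        case False
        then show ?thesis using hom by (auto simp: homogeneous_def in_keys_iff)
      qed
      from divisible_by_var[OF hom this] obtain G where G: "homogeneous d G" "F - ?L = var None * G" by blast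
      have L: "?L \<in> I" using lead_part_in_ideal_power[OF le, of F] ideal_power_1[OF is_ideal_I] by simp
      have "ev (a i) G = 0" if "i < n" for i
      proof -
        have "ev (a i) (F - ?L) = 0" using Suc.prems(2)[OF that] ev_I[OF L that] by (simp add: ev_diff)
        then show ?thesis unfolding G(2) by (simp add: ev_mult ev_var_None)
      qed
      then have "var None * G \<in> ideal_gen (gen ` pures)" by (intro ideal_gen_mult Suc.IH G)
      moreover have "lead 1 W \<in> ideal_gen (gen ` pures)" if "W \<in> pure_deg (Suc d)" for W
      proof -
        have "W \<in> pure" "1 * Suc s \<le> monom_deg W" using that le by (auto simp: pure_deg_def)
        from lead[OF this] obtain us z where us: "length us = 1" "set us \<subseteq> pures" "lead 1 W = single z 1 * gens us" .
        then obtain u where "us = [u]" by (auto simp: length_Suc_conv)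
        then show ?thesis using us by (auto simp: gens_def intro: ideal_gen_mult ideal_gen_base)
      qed
      then have "?L \<in> ideal_gen (gen ` pures)"
        unfolding lead_part_def by (intro is_ideal_sum is_ideal_gen ideal_gen_mult)
      ultimately have "var None * G + ?L \<in> ideal_gen (gen ` pures)" by (rule ideal_gen_add)
      then show ?thesis by (simp flip: G(2))
    qed
  qed
  then show "I \<subseteq> ideal_gen (gen ` pures)"
    unfolding I_def ideal_of_def
    by (intro ideal_gen_minimal is_ideal_gen) (auto simp: vanishes_at_affine_point)
qed

lemma ideal_power_I: "ideal_power I r = ideal_gen {gens us |us. set us \<subseteq> pures \<and> length us = r}"
proof -
  have "\<exists>us. xs = map gen us \<and> set us \<subseteq> pures" if "set xs \<subseteq> gen ` pures" for xs
    using that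
  proof (induction xs)
    case (Cons x xs)
    then obtain u us where "x = gen u" "u \<in> pures" "xs = map gen us" "set us \<subseteq> pures" by auto
    then show ?case by (intro exI[of _ "u # us"]) simp
  qed simp
  then have "power_gens (gen ` pures) r = {gens us |us. set us \<subseteq> pures \<and> length us = r}"
    unfolding power_gens_def gens_def by (force simp: subset_iff)
  then show ?thesis using ideal_power_gens[of "gen ` pures" r] by (simp add: I_generators)
qed

text \<open>A monomial times \<open>r\<close> generators has the wrong degree, contains
  \<open>x\<^sub>0\<close>, or lifts a monomial free of \<open>x\<^sub>0\<close>; in the last case
  \<open>exchange\<close> compares it with the chosen lift. The strict bound on \<open>T\<close>
  supplies the nonconstant monomial which \<open>exchange\<close> requires.\<close>

lemma reduction:
  assumes F: "F \<in> ideal_power I r" and T: "r * Suc s < T"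
  shows "hcomp T F - lead_part r T F \<in> XI r"
proof -
  note XI = is_idealD[OF is_ideal_XI]
  have add: "hcomp T (F + G) - lead_part r T (F + G) \<in> XI r"
    if "hcomp T F - lead_part r T F \<in> XI r" "hcomp T G - lead_part r T G \<in> XI r" for F G
    using XI(2)[OF that] by (simp add: hcomp_add lead_part_add algebra_simps)
  have zero: "hcomp T 0 - lead_part r T 0 \<in> XI r"
    using XI(1) by (simp add: lead_part_def)
  have base: "hcomp T (single z c * gens us) - lead_part r T (single z c * gens us) \<in> XI r"
    if us: "set us \<subseteq> pures" "length us = r" for z c us
  proof -
    let ?G = "single z c * gens us"
    have hom: "homogeneous (monom_deg z + r * Suc s) ?G"
      using homogeneous_gens[OF us(1)] us(2) by (intro homogeneous_mult homogeneous_single) auto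
    have lk: "lookup ?G W = (c when sum_list us + z = W)" if "W \<in> pure_deg T" for W
      using lookup_gens_pure[OF us(1)] that by (simp add: pure_deg_def pure_def)
    consider "monom_deg z + r * Suc s \<noteq> T" | "monom_deg z + r * Suc s = T" "z \<in> pure"
      | "monom_deg z + r * Suc s = T" "0 < lookup z None" unfolding pure_def by auto
    then show ?thesis
    proof cases
      case 1
      have "lookup ?G W = 0" if "W \<in> pure_deg T" for W
        using lk[OF that] that 1 monom_deg_sum_list[OF us(1)] us(2)
        by (auto simp: pure_deg_def monom_deg_add when_def)
      then have "lead_part r T ?G = 0" by (simp add: lead_part_def)
      then show ?thesis using XI(1) 1 by (simp add: hcomp_homogeneous[OF hom])
    next
      case 2
      let ?W = "sum_list us + z"
      have W: "?W \<in> pure_deg T"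
        using 2 sum_list_pure[OF us(1)] monom_deg_sum_list[OF us(1)] us(2)
        by (simp add: pure_deg_def pure_def lookup_add monom_deg_add)
      have "lead_part r T ?G = (\<Sum>W\<in>pure_deg T. if W = ?W then single 0 c * lead r W else 0)"
        unfolding lead_part_def by (rule sum.cong) (auto simp: lk when_def)
      then have eq: "lead_part r T ?G = single 0 c * lead r ?W" using W finite_pure_deg by simp
      have "?W \<in> pure" "r * Suc s \<le> monom_deg ?W" using W T by (auto simp: pure_deg_def)
      from lead[OF this] obtain us' z' where us': "length us' = r" "set us' \<subseteq> pures" "z' \<in> pure"
        "sum_list us' + z' = ?W" "lead r ?W = single z' 1 * gens us'" .
      have "single z 1 * gens us - single z' 1 * gens us' \<in> XI r"
        by (rule exchange) (use us us' 2 T in auto)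
      then have *: "single 0 c * (single z 1 * gens us - single z' 1 * gens us') \<in> XI r" by (rule XI(3))
      have "single z c = single 0 c * single z 1" by (simp add: mult_single)
      then have "?G = single 0 c * (single z 1 * gens us)" by (simp only: mult.assoc)
      moreover have "hcomp T ?G = ?G" using 2(1) by (simp add: hcomp_homogeneous[OF hom])
      ultimately show ?thesis using * unfolding eq us'(5) right_diff_distrib by (simp only:)
    next
      case 3
      have "lookup ?G W = 0" if "W \<in> pure_deg T" for W
        using lk[OF that] that 3(2) by (auto simp: pure_deg_def pure_def lookup_add when_def)
      then have "lead_part r T ?G = 0" by (simp add: lead_part_def)
      moreover have "var None * (single (z - single None 1) c * gens us) \<in> XI r"
        using gens_in_ideal_power[OF us(1)] us(2) by (intro XI_I is_idealD(3)[OF is_ideal_power]) simp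
      moreover have "var None * (single (z - single None 1) c * gens us) = ?G"
        unfolding mult.assoc[symmetric] var_mult_single single_add_minus[OF 3(2)] ..
      ultimately show ?thesis using 3(1) by (simp add: hcomp_homogeneous[OF hom])
    qed
  qed
  from F have "F \<in> ideal_gen {gens us |us. set us \<subseteq> pures \<and> length us = r}" by (simp add: ideal_power_I)
  then show ?thesis
  proof (induction rule: ideal_gen_induct)
    case (gen c x)
    then obtain us where us: "x = gens us" "set us \<subseteq> pures" "length us = r" by blast
    show ?case unfolding us(1)
      by (induction c rule: poly_mapping_sum_induct) (use zero add base us in \<open>simp_all add: distrib_right\<close>)
  qed (use zero add in auto)
qed

text \<open>Since \<open>var None * F\<close> has no monomial free of \<open>x\<^sub>0\<close>, its
  leading part is zero and \<open>reduction\<close> places it in \<open>XI r\<close>. Its degree is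
  \<open>t + 1\<close>, which turns the bound on \<open>t\<close> into the strict one of
  \<open>reduction\<close>.\<close>

lemma ideal_power_descend:
  assumes F: "homogeneous t F" "var None * F \<in> ideal_power I r" and t: "r * Suc s \<le> t"
  shows "F \<in> ideal_power I r"
proof -
  have hom: "homogeneous (Suc t) (var None * F)" using homogeneous_mult[OF homogeneous_var F(1)] by simp
  have "lead_part r (Suc t) (var None * F) = 0"
    unfolding lead_part_def by (rule sum.neutral) (auto simp: pure_deg_def pure_def lookup_var_mult)
  then have "var None * F \<in> XI r"
    using reduction[OF F(2), of "Suc t"] t by (simp add: hcomp_homogeneous[OF hom])
  then obtain f where "var None * F = var None * f" "f \<in> ideal_power I r" unfolding XI_def by blast
  then show ?thesis using var_mult_cancel by metis
qed

theorem symbolic_power_subset: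
  assumes "homogeneous t F" "r * Suc s \<le> t" "\<And>i. i < n \<Longrightarrow> F \<in> ideal_power (point_ideal (a i)) r"
  shows "F \<in> ideal_power I r"
proof -
  have "F \<in> ideal_power I r" if "var None ^ k * F \<in> ideal_power I r" for k
    using that
  proof (induction k)
    case (Suc k)
    have "homogeneous (k + t) (var None ^ k * F)"
      using homogeneous_mult[OF homogeneous_power[OF homogeneous_var] assms(1), of k None] by simp
    then have "var None ^ k * F \<in> ideal_power I r"
      by (rule ideal_power_descend) (use Suc.prems assms(2) in \<open>simp_all add: mult.assoc\<close>)
    then show ?case by (rule Suc.IH)
  qed simp
  then show ?thesis using symbolic_power_saturated assms(3) by blast
qed

lemma I_order_ge: "I \<subseteq> order_ge (Suc s)"
  unfolding I_generators
  by (rule ideal_gen_minimal[OF _ is_ideal_order_ge])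
     (use gen(1) in \<open>auto simp: order_ge_def homogeneous_def\<close>)

end

subsection \<open>Multiplicities and symbolic powers at generic points\<close>

lemma point_ideal_order_ge: "point_ideal a \<subseteq> order_ge 1" for a :: "'n::finite \<Rightarrow> 'k::field"
  unfolding point_ideal_eq
  by (rule ideal_gen_minimal[OF _ is_ideal_order_ge])
     (use homogeneous_linform in \<open>fastforce simp: order_ge_def homogeneous_def\<close>)

text \<open>A nonzero form of degree \<open>d\<close> lies in no power of the point ideal beyond the
  \<open>d\<close>-th, so the maximum defining the multiplicity is over a finite set.\<close>

lemma mult_at_affine_point:
  fixes F :: "('n::finite option, 'k::field) mpol"
  assumes F: "F \<noteq> 0" "homogeneous d F"
  shows "F \<in> ideal_power (point_ideal a) (mult_at (affine_point a) F)"
    and "F \<in> ideal_power (point_ideal a) m \<Longrightarrow> m \<le> mult_at (affine_point a) F"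
    and "mult_at (affine_point a) F \<le> d"
proof -
  let ?M = "{m. F \<in> ideal_power (point_ideal a) m}"
  have le: "?M \<subseteq> {..d}"
    using form_ideal_power_degree[OF point_ideal_order_ge _ F] by auto
  then have fin: "finite ?M" by (rule finite_subset) simp
  have ne: "?M \<noteq> {}" by (auto intro: exI[of _ 0])
  have eq: "mult_at (affine_point a) F = Max ?M" by (simp add: mult_at_def point_ideal_def)
  show "F \<in> ideal_power (point_ideal a) (mult_at (affine_point a) F)"
    using Max_in[OF fin ne] eq by simp
  then show "mult_at (affine_point a) F \<le> d" using le by blast
  show "m \<le> mult_at (affine_point a) F" if "F \<in> ideal_power (point_ideal a) m"
    unfolding eq using that by (intro Max_ge fin) simp
qed

locale generic_config = unisolvent_points a n s
  for a :: "nat \<Rightarrow> 'n::finite \<Rightarrow> 'k::field" and n s :: nat +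
  assumes generic: "alg_independent prime_field ({..<n} \<times> UNIV) (\<lambda>(i, j). a i j)"
    and inj: "inj_on (\<lambda>i. affine_point (a i)) {..<n}"
begin

definition Z :: "('k, 'n) proj set" where
  "Z = (\<lambda>i. affine_point (a i)) ` {..<n}"

definition mlt :: "('n option, 'k) mpol \<Rightarrow> nat \<Rightarrow> nat" where
  "mlt F i = mult_at (affine_point (a i)) F"

lemma n_pos: "0 < n"
proof -
  have "single None s \<in> {t :: 'n option \<Rightarrow>\<^sub>0 nat. monom_deg t = s}" by simp
  then show ?thesis unfolding card_monoms by (metis card_gt_0_iff finite_monom_deg empty_iff)
qed

lemma sum_mult_at: "(\<Sum>P\<in>Z. mult_at P F) = sum (mlt F) {..<n}"
  unfolding Z_def sum.reindex[OF inj] by (simp add: mlt_def)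

lemma symbolic_power_iff:
  "F \<in> symbolic_power Z m \<longleftrightarrow> (\<forall>i<n. F \<in> ideal_power (point_ideal (a i)) m)"
  by (auto simp: symbolic_power_def Z_def point_ideal_def)

lemma ideal_of_Z: "ideal_of Z = I"
  by (simp add: Z_def I_def)

lemma mlt_pos:
  assumes "F \<noteq> 0" "homogeneous d F" "i < n"
  shows "0 < mlt F i \<longleftrightarrow> vanishes_at F (affine_point (a i))"
proof -
  have "F \<in> point_ideal (a i) \<longleftrightarrow> F \<in> ideal_power (point_ideal (a i)) (Suc 0)"
    by (simp only: ideal_power_1[OF is_ideal_point_ideal])
  also have "\<dots> \<longleftrightarrow> Suc 0 \<le> mlt F i"
  proof
    show "F \<in> ideal_power (point_ideal (a i)) (Suc 0)" if "Suc 0 \<le> mlt F i"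
      using mult_at_affine_point(1)[OF assms(1,2), of "a i"] ideal_power_antimono[OF that]
      unfolding mlt_def by (rule subsetD[rotated])
  qed (unfold mlt_def, rule mult_at_affine_point(2)[OF assms(1,2)])
  finally show ?thesis
    unfolding point_ideal_iff[OF assms(2)] vanishes_at_affine_point[OF assms(2)] Suc_le_eq by blast
qed

section \<open>Ratios of degree to total multiplicity\<close>

definition ratios :: "real set" where
  "ratios = {real d / real (sum (mlt F) {..<n}) |d F.
     F \<noteq> 0 \<and> homogeneous d F \<and> 0 < sum (mlt F) {..<n}}"

lemma seshadri_inf_ratios: "seshadri_inf Z = Inf ratios"
proof -
  have "(\<exists>P\<in>Z. vanishes_at F P) \<longleftrightarrow> 0 < sum (mlt F) {..<n}" if "F \<noteq> 0" "homogeneous d F" for d F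
  proof -
    have "(\<exists>P\<in>Z. vanishes_at F P) \<longleftrightarrow> (\<exists>i<n. 0 < mlt F i)"
      using mlt_pos[OF that] by (auto simp: Z_def)
    also have "\<dots> \<longleftrightarrow> sum (mlt F) {..<n} \<noteq> 0" by auto
    finally show ?thesis unfolding neq0_conv .
  qed
  then show ?thesis unfolding seshadri_inf_def ratios_def sum_mult_at
    by (intro arg_cong[of _ _ Inf] Collect_cong) blast
qed

text \<open>No multiplicity exceeds the degree. This keeps the infimum of the ratios
  positive.\<close>

lemma ratios_lower_bound: "x \<in> ratios \<Longrightarrow> 1 / real n \<le> x"
proof -
  assume "x \<in> ratios"
  then obtain d F where x: "x = real d / real (sum (mlt F) {..<n})"
    and F: "F \<noteq> 0" "homogeneous d F" "0 < sum (mlt F) {..<n}" unfolding ratios_def by blast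
  have "sum (mlt F) {..<n} \<le> (\<Sum>i<n. d)"
    unfolding mlt_def by (intro sum_mono mult_at_affine_point(3) F)
  then have "sum (mlt F) {..<n} \<le> n * d" by simp
  then have "real (sum (mlt F) {..<n}) \<le> real n * real d" unfolding of_nat_mult[symmetric] of_nat_le_iff .
  then show ?thesis using F(3) n_pos by (simp add: x field_simps del: of_nat_sum)
qed

lemma ratio_I:
  assumes F: "F \<noteq> 0" "homogeneous d F" and m: "0 < m" "\<And>i. i < n \<Longrightarrow> F \<in> ideal_power (point_ideal (a i)) m"
  shows "\<exists>x\<in>ratios. x \<le> real d / (real n * real m)"
proof -
  let ?M = "sum (mlt F) {..<n}"
  have "(\<Sum>i<n. m) \<le> ?M"
    unfolding mlt_def by (intro sum_mono mult_at_affine_point(2)[OF F] m) simp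
  then have M: "n * m \<le> ?M" by simp
  then have "0 < ?M" using n_pos m(1) by (metis nat_0_less_mult_iff less_le_trans)
  then have "real d / real ?M \<in> ratios" unfolding ratios_def using F by blast
  moreover have "real d / real ?M \<le> real d / (real n * real m)"
    using M n_pos m(1) \<open>0 < ?M\<close> unfolding of_nat_mult[symmetric]
    by (intro divide_left_mono mult_pos_pos) (simp_all only: of_nat_le_iff of_nat_0_le_iff of_nat_0_less_iff nat_0_less_mult_iff simp_thms)
  ultimately show ?thesis by blast
qed

lemma exists_pure_generator: "\<exists>F. F \<noteq> 0 \<and> homogeneous (Suc s) F \<and> F \<in> I"
proof -
  obtain j :: 'n where True by blast
  have "single (Some j) (Suc s) \<in> pures" by (simp add: pures_def lookup_single)
  then show ?thesis using gen gen_nonzero by blast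
qed

lemma exists_ratio: "\<exists>x\<in>ratios. x \<le> real (Suc s) / real n"
proof -
  obtain F where F: "F \<noteq> 0" "homogeneous (Suc s) F" "F \<in> I" using exists_pure_generator by blast
  have "F \<in> ideal_power (point_ideal (a i)) 1" if "i < n" for i
    using I_subset[OF that] F(3) ideal_power_1[OF is_ideal_point_ideal, of "a i"] by auto
  then show ?thesis using ratio_I[OF F(1,2), of 1] by simp
qed

lemma bdd_below_ratios: "bdd_below ratios"
  using ratios_lower_bound by (rule bdd_belowI)

lemma Inf_ratios_le: "x \<in> ratios \<Longrightarrow> Inf ratios \<le> x"
  by (rule cInf_lower[OF _ bdd_below_ratios])

lemma Inf_ratios_pos: "0 < Inf ratios"
proof -
  have "ratios \<noteq> {}" using exists_ratio by blast
  then have "1 / real n \<le> Inf ratios" using ratios_lower_bound by (rule cInf_greatest)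
  moreover have "0 < 1 / real n" using n_pos by simp
  ultimately show ?thesis by linarith
qed

text \<open>Permuting generic points is a specialization, so the product of the forms obtained from the
  cyclic shifts has the same multiplicity at every point.\<close>

lemma symmetrization:
  assumes F: "F \<noteq> 0" "homogeneous d F"
  shows "\<exists>G. G \<noteq> 0 \<and> homogeneous (n * d) G \<and> (\<forall>i<n. G \<in> ideal_power (point_ideal (a i)) (sum (mlt F) {..<n}))"
proof -
  \<comment> \<open>\<open>\<tau> k\<close> is the cyclic shift by \<open>k\<close> and
    \<open>\<sigma> k\<close> its inverse. For fixed \<open>l\<close> the map from \<open>k\<close>
    to \<open>\<sigma> k l\<close> is an involution, so the multiplicities of the product at the
    point \<open>l\<close> add up to the full sum.\<close>
  define \<tau> where "\<tau> k i = (if i + k < n then i + k else i + k - n)" for k i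
  define \<sigma> where "\<sigma> k l = (if k \<le> l then l - k else l + n - k)" for k l
  have \<sigma>: "\<sigma> k l < n" "\<tau> k (\<sigma> k l) = l" "\<sigma> (\<sigma> k l) l = k" if "k < n" "l < n" for k l
    using that by (auto simp: \<sigma>_def \<tau>_def)
  have "\<exists>G. G \<noteq> 0 \<and> homogeneous d G \<and> (\<forall>l<n. G \<in> ideal_power (point_ideal (a l)) (mlt F (\<sigma> k l)))"
    if k: "k < n" for k
  proof -
    have "hasse (a i) w F = 0" if "i < n" "sum w UNIV < mlt F i" for i w
      using hasse_ideal_power mult_at_affine_point(1)[OF F] that(2) unfolding mlt_def by blast
    from specialization[OF generic F this, where b = "\<lambda>i. a (\<tau> k i)"]
    obtain G where G: "G \<noteq> 0" "homogeneous d G"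
      "\<And>i w. i < n \<Longrightarrow> sum w UNIV < mlt F i \<Longrightarrow> hasse (a (\<tau> k i)) w G = 0" by blast
    have "G \<in> ideal_power (point_ideal (a l)) (mlt F (\<sigma> k l))" if "l < n" for l
      unfolding ideal_power_point_iff[OF G(2)] using G(3)[of "\<sigma> k l"] \<sigma>[OF k that] by simp
    then show ?thesis using G(1,2) by blast
  qed
  then obtain G where G: "\<And>k. k < n \<Longrightarrow> G k \<noteq> 0" "\<And>k. k < n \<Longrightarrow> homogeneous d (G k)"
    "\<And>k l. k < n \<Longrightarrow> l < n \<Longrightarrow> G k \<in> ideal_power (point_ideal (a l)) (mlt F (\<sigma> k l))" by metis
  have "prod G {..<n} \<in> ideal_power (point_ideal (a l)) (sum (mlt F) {..<n})" if l: "l < n" for l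
  proof -
    have "(\<Sum>k<n. mlt F (\<sigma> k l)) = sum (mlt F) {..<n}"
      by (rule sum.reindex_bij_witness[of _ "\<lambda>k. \<sigma> k l" "\<lambda>k. \<sigma> k l"]) (use \<sigma> l in auto)
    then show ?thesis
      using prod_in_ideal_power[of "{..<n}" G "point_ideal (a l)" "\<lambda>k. mlt F (\<sigma> k l)"] G(3) l by simp
  qed
  moreover have "prod G {..<n} \<noteq> 0" by (rule form_prod_nonzero[of _ _ "\<lambda>_. d"]) (use G in auto)
  moreover have "homogeneous (n * d) (prod G {..<n})"
    using homogeneous_prod[of "{..<n}" "\<lambda>_. d" G] G(2) by simp
  ultimately show ?thesis by blast
qed

section \<open>The value of the resurgence\<close>

lemma symbolic_power_subset_power:
  assumes m: "0 < m" and mr: "real r * real (Suc s) < real m * (real n * Inf ratios)"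
  shows "symbolic_power Z m \<subseteq> ideal_power (ideal_of Z) r"
proof
  fix F assume F: "F \<in> symbolic_power Z m"
  \<comment> \<open>The generators of degree \<open>s + 1\<close> give
    \<open>n * Inf ratios \<le> s + 1\<close>, hence \<open>r \<le> m\<close>; this allows passing
    from the \<open>m\<close>-th to the \<open>r\<close>-th powers of the point ideals.\<close>
  obtain x where "x \<in> ratios" "x \<le> real (Suc s) / real n" using exists_ratio by blast
  then have "Inf ratios \<le> real (Suc s) / real n" using Inf_ratios_le by force
  then have "real n * Inf ratios \<le> real (Suc s)" using n_pos by (simp add: field_simps)
  then have "real m * (real n * Inf ratios) \<le> real m * real (Suc s)" by (intro mult_left_mono) auto
  with mr have "real r * real (Suc s) < real m * real (Suc s)" by linarith
  then have rm: "r \<le> m" by (simp del: of_nat_Suc)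
  have "hcomp T F \<in> ideal_power I r" for T
  proof (cases "hcomp T F = 0")
    case True
    then show ?thesis using is_idealD(1)[OF is_ideal_power] by simp
  next
    case False
    have sym: "hcomp T F \<in> ideal_power (point_ideal (a i)) m" if "i < n" for i
      using F that hcomp_in_ideal_power unfolding symbolic_power_iff point_ideal_def by blast
    obtain x where x: "x \<in> ratios" "x \<le> real T / (real n * real m)"
      using ratio_I[OF False homogeneous_hcomp m sym] by blast
    then have "Inf ratios \<le> real T / (real n * real m)" using Inf_ratios_le[OF x(1)] by linarith
    then have "real m * (real n * Inf ratios) \<le> real T" using n_pos m by (simp add: field_simps)
    with mr have "real (r * Suc s) < real T" unfolding of_nat_mult by linarith
    then have "r * Suc s \<le> T" by (simp only: of_nat_less_iff)
    then show ?thesis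
      using symbolic_power_subset[OF homogeneous_hcomp] sym ideal_power_antimono[OF rm] by blast
  qed
  then have "(\<Sum>T\<in>monom_deg ` keys F. hcomp T F) \<in> ideal_power I r"
    by (intro is_ideal_sum is_ideal_power)
  then show "F \<in> ideal_power (ideal_of Z) r" using sum_hcomp[of F] by (simp add: ideal_of_Z)
qed

lemma resurgence_le: "resurgence Z \<le> ereal (real (Suc s) / (real n * Inf ratios))"
  unfolding resurgence_def
proof (rule Sup_least)
  fix y
  assume "y \<in> {ereal (real m / real r) |m r. m \<ge> 1 \<and> r \<ge> 1 \<and>
    \<not> symbolic_power Z m \<subseteq> ideal_power (ideal_of Z) r}"
  then obtain m r where y: "y = ereal (real m / real r)"
    and mr: "1 \<le> m" "1 \<le> r" "\<not> symbolic_power Z m \<subseteq> ideal_power (ideal_of Z) r" by blast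
  then have "real m * (real n * Inf ratios) \<le> real r * real (Suc s)"
    using symbolic_power_subset_power[of m r] by force
  then show "y \<le> ereal (real (Suc s) / (real n * Inf ratios))"
    using mr Inf_ratios_pos n_pos by (simp add: y field_simps)
qed

lemma resurgence_ge:
  assumes "x \<in> ratios"
  shows "ereal (real (Suc s) / (real n * x)) \<le> resurgence Z"
proof -
  from assms obtain d F where x: "x = real d / real (sum (mlt F) {..<n})"
    and F: "F \<noteq> 0" "homogeneous d F" "0 < sum (mlt F) {..<n}" unfolding ratios_def by blast
  define M where "M = sum (mlt F) {..<n}"
  define D where "D = n * d"
  obtain G where G: "G \<noteq> 0" "homogeneous D G" "\<And>i. i < n \<Longrightarrow> G \<in> ideal_power (point_ideal (a i)) M"
    using symmetrization[OF F(1,2)] unfolding M_def D_def by blast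
  have "0 < 1 / real n" using n_pos by simp
  then have "0 < x" using ratios_lower_bound[OF assms] by linarith
  then have "0 < d" unfolding x by (cases "d = 0") simp_all
  then have D: "0 < D" using n_pos by (simp add: D_def)
  have bound: "ereal (real M / (real D / real (Suc s) + inverse (real (Suc k)))) \<le> resurgence Z" for k
  proof -
    let ?T = "Suc k"
    \<comment> \<open>The least \<open>r\<close> for which the degree \<open>D * ?T\<close> is too
      small for a nonzero form in \<open>I\<^sup>r\<close>.\<close>
    define r where "r = (D * ?T) div Suc s + 1"
    have r: "D * ?T < r * Suc s" "1 \<le> r"
      unfolding r_def using dividend_less_times_div[of "Suc s" "D * ?T"] by (auto simp: algebra_simps)
    have GT: "G ^ ?T \<noteq> 0" "homogeneous (?T * D) (G ^ ?T)"
      using form_prod_nonzero[of "{..<?T}" "\<lambda>_. G" "\<lambda>_. D"] homogeneous_power[OF G(2), of ?T] G by simp_all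
    have "G ^ ?T \<in> symbolic_power Z (M * ?T)"
      unfolding symbolic_power_iff using G(3) power_in_ideal_power by blast
    moreover have "G ^ ?T \<notin> ideal_power (ideal_of Z) r"
      using form_ideal_power_degree[OF I_order_ge _ GT, of r] r(1) unfolding ideal_of_Z by (auto simp: mult.commute)
    ultimately have "\<not> symbolic_power Z (M * ?T) \<subseteq> ideal_power (ideal_of Z) r" by blast
    moreover have "1 \<le> M * ?T" using F(3) by (simp add: M_def)
    ultimately have le: "ereal (real (M * ?T) / real r) \<le> resurgence Z"
      unfolding resurgence_def using r(2) by (intro Sup_upper) blast
    have "real (D * ?T div Suc s) \<le> real (D * ?T) / real (Suc s)" by (rule of_nat_div_le_of_nat)
    then have "real r \<le> real (D * ?T) / real (Suc s) + 1" by (simp add: r_def)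
    then have "real (M * ?T) / (real (D * ?T) / real (Suc s) + 1) \<le> real (M * ?T) / real r"
      using r(2) by (intro divide_left_mono) (auto intro!: mult_pos_pos add_nonneg_pos)
    \<comment> \<open>Dividing numerator and denominator by \<open>?T\<close> isolates the rounding
      error as a summand tending to 0.\<close>
    moreover have "real (M * ?T) / (real (D * ?T) / real (Suc s) + 1) = real M / (real D / real (Suc s) + inverse (real ?T))"
      unfolding of_nat_mult using D by (simp add: divide_simps del: of_nat_Suc)
    ultimately have "ereal (real M / (real D / real (Suc s) + inverse (real ?T))) \<le> ereal (real (M * ?T) / real r)"
      by simp
    then show ?thesis using le by (rule order_trans)
  qed
  have "(\<lambda>k. ereal (real M / (real D / real (Suc s) + inverse (real (Suc k)))))
      \<longlonglongrightarrow> ereal (real M / (real D / real (Suc s) + 0))"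
    using D by (intro tendsto_ereal tendsto_divide tendsto_add tendsto_const LIMSEQ_inverse_real_of_nat) simp
  then have "ereal (real M / (real D / real (Suc s) + 0)) \<le> resurgence Z"
    by (rule LIMSEQ_le_const2) (use bound in blast)
  moreover have "real M / (real D / real (Suc s) + 0) = real (Suc s) / (real n * x)"
    by (simp add: x D_def field_simps flip: M_def)
  ultimately show ?thesis by simp
qed

text \<open>The infimum need not be attained. A smaller supremum would be a positive real number,
  and a ratio close enough to the infimum would contradict \<open>resurgence_ge\<close>.\<close>

theorem resurgence_eq: "resurgence Z = ereal (real (Suc s) / (real n * Inf ratios))"
proof (rule antisym[OF resurgence_le], rule ccontr)
  let ?\<rho> = "resurgence Z" and ?e = "real (Suc s)"
  assume "\<not> ereal (?e / (real n * Inf ratios)) \<le> ?\<rho>"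
  then have less: "?\<rho> < ereal (?e / (real n * Inf ratios))" by simp
  obtain x0 where x0: "x0 \<in> ratios" using exists_ratio by blast
  have pos: "0 < x" if "x \<in> ratios" for x
    using Inf_ratios_le[OF that] Inf_ratios_pos by linarith
  have "0 < ?e / (real n * x0)" using pos[OF x0] n_pos by simp
  then have rho0: "0 < ?\<rho>" using resurgence_ge[OF x0] by (meson ereal_less(2) less_le_trans)
  with less obtain c where c: "?\<rho> = ereal c" by (cases ?\<rho>) auto
  with rho0 less have c0: "0 < c" "c < ?e / (real n * Inf ratios)" by simp_all
  then have "Inf ratios < ?e / (real n * c)" using n_pos Inf_ratios_pos by (simp add: field_simps)
  then obtain x where x: "x \<in> ratios" "x < ?e / (real n * c)"
    using cInf_lessD[of ratios] x0 by blast
  then have "c < ?e / (real n * x)" using c0(1) n_pos pos[OF x(1)] by (simp add: field_simps)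
  with resurgence_ge[OF x(1)] c show False by simp
qed

text \<open>Root and power cancel because the infimum is positive.\<close>

lemma seshadri_pow_eq: "seshadri_pow Z = Inf ratios"
proof (cases "CARD('n) = 1")
  case True
  then show ?thesis by (simp add: seshadri_pow_def seshadri_inf_ratios)
next
  case False
  then have "0 < CARD('n) - 1" using zero_less_card_finite[where 'a = 'n] by linarith
  then show ?thesis using False Inf_ratios_pos
    by (simp add: seshadri_pow_def seshadri_def seshadri_inf_ratios real_root_pow_pos2)
qed

end

subsection \<open>The plane: a square number of points\<close>

text \<open>The argument \<open>field_type\<close> ties the coefficient field to the locale, as the
  types of \<open>j1\<close> and \<open>j2\<close> do not mention it.\<close>

locale plane =
  fixes j1 j2 :: "'n::finite" and field_type :: "'k::field itself"
  assumes coords: "(UNIV :: 'n set) = {j1, j2}" "j1 \<noteq> j2"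
begin

definition pt :: "'k \<Rightarrow> 'k \<Rightarrow> 'n \<Rightarrow> 'k" where
  "pt x y j = (if j = j1 then x else y)"

lemma pt_simps [simp]: "pt x y j1 = x" "pt x y j2 = y"
  using coords(2) by (auto simp: pt_def)

lemma sum_coords: "sum f (UNIV :: 'n set) = f j1 + f j2"
  using coords(2) unfolding coords(1) by simp

lemma prod_coords: "prod f (UNIV :: 'n set) = f j1 * f j2"
  using coords(2) unfolding coords(1) by simp

lemma linform_pt: "linform (pt x y) j1 = linform (pt x 0) j1"
  by (simp add: linform_def)

text \<open>Restriction to the line on which the coordinate \<open>j1\<close> equals
  \<open>x\<close>; the coordinate \<open>j2\<close> becomes the polynomial variable.\<close>

definition restr :: "'k \<Rightarrow> ('n option, 'k) mpol \<Rightarrow> 'k poly" where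
  "restr x = mlin (\<lambda>c. [:c:]) (mon (case_option 1 (\<lambda>j. if j = j1 then [:x:] else [:0, 1:])))"

lemma ring_map_restr: "ring_map (restr x)"
  unfolding restr_def by (rule ring_map.ring_map_mlin_mon[OF ring_map_const_poly])

lemma restr_simps:
  "restr x (single 0 c) = [:c:]" "restr x (var None) = 1" "restr x (linform (pt x y) j1) = 0"
  "restr x (linform (pt x y) j2) = [:- y, 1:]"
proof -
  interpret ring_map "restr x" by (rule ring_map_restr)
  show *: "restr x (single 0 c) = [:c:]" "restr x (var None) = 1" for c
    by (simp_all add: restr_def var_def ring_map.mlin_single[OF ring_map_const_poly] flip: one_pCons)
  have "restr x (var (Some j)) = (if j = j1 then [:x:] else [:0, 1:])" for j
    by (simp add: restr_def var_def ring_map.mlin_single[OF ring_map_const_poly] flip: one_pCons)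
  then show "restr x (linform (pt x y) j1) = 0" "restr x (linform (pt x y) j2) = [:- y, 1:]"
    using coords(2) by (simp_all add: linform_def diff mult *)
qed

lemma degree_restr:
  assumes "homogeneous d F"
  shows "degree (restr x F) \<le> d"
  unfolding restr_def mlin_def
proof (rule degree_sum_le)
  fix t assume "t \<in> keys F"
  then have "lookup t (Some j2) \<le> d"
    using assms by (auto simp: homogeneous_def monom_deg_option sum_coords)
  moreover have "[:lookup F t:] * mon (case_option 1 (\<lambda>j. if j = j1 then [:x:] else [:0, 1:])) t =
      smult (lookup F t * x ^ lookup t (Some j1)) ([:0, 1:] ^ lookup t (Some j2))"
    using coords(2) by (subst mon_superset[of UNIV]) (simp_all add: prod_option prod_coords poly_const_pow mult.commute[of "lookup F t"])
  ultimately show "degree ([:lookup F t:] * mon (case_option 1 (\<lambda>j. if j = j1 then [:x:] else [:0, 1:])) t) \<le> d"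
    by (simp add: degree_linear_power order_trans[OF degree_smult_le])
qed simp

lemma restr_taylor:
  assumes "homogeneous d F"
  shows "restr x F = (\<Sum>w\<in>PiE UNIV (\<lambda>_. {..d}). [:hasse (pt x y) w F:] * (0 ^ w j1 * [:- y, 1:] ^ w j2))"
proof -
  interpret ring_map "restr x" by (rule ring_map_restr)
  show ?thesis
    by (subst hasse_taylor[OF assms, of "pt x y"])
       (simp add: sum mult power prod prod_coords restr_simps)
qed

text \<open>On the line only the Taylor terms with \<open>w j1 = 0\<close> survive, and of these
  only the ones with \<open>w j2 \<ge> m\<close> have a nonzero coefficient.\<close>

lemma restr_divisible:
  assumes "homogeneous d F" "\<And>w. sum w UNIV < m \<Longrightarrow> hasse (pt x y) w F = 0"
  shows "[:- y, 1:] ^ m dvd restr x F"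
  unfolding restr_taylor[OF assms(1), of x y]
proof (rule dvd_sum)
  fix w :: "'n \<Rightarrow> nat"
  consider "w j1 \<noteq> 0" | "w j1 = 0" "w j2 < m" | "m \<le> w j2" by linarith
  then show "[:- y, 1:] ^ m dvd [:hasse (pt x y) w F:] * (0 ^ w j1 * [:- y, 1:] ^ w j2)"
  proof cases
    case 2
    then show ?thesis using assms(2)[of w] by (simp add: sum_coords)
  next
    case 3
    then show ?thesis by (intro dvd_mult le_imp_power_dvd)
  qed (simp add: power_0_left)
qed

text \<open>Bezout for a line: a nonzero polynomial of degree at most \<open>d\<close> cannot have
  \<open>q\<close> distinct roots of multiplicity at least \<open>m\<close> each.\<close>

lemma restr_eq_0:
  assumes F: "homogeneous d F" and Y: "inj_on Y {..<q}" and m: "d < q * m"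
    and z: "\<And>j w. j < q \<Longrightarrow> sum w UNIV < m \<Longrightarrow> hasse (pt x (Y j)) w F = 0"
  shows "restr x F = 0"
proof (rule ccontr)
  let ?p = "restr x F"
  assume p: "?p \<noteq> 0"
  have m0: "0 < m" using m by (cases m) auto
  have dvd: "[:- Y j, 1:] ^ m dvd ?p" if "j < q" for j
    by (rule restr_divisible[OF F]) (use z that in auto)
  have root: "poly ?p (Y j) = 0" if "j < q" for j
    using dvd[OF that] m0 by (metis dvd_power dvd_trans poly_eq_0_iff_dvd)
  have "q * m = (\<Sum>y\<in>Y ` {..<q}. m)" using card_image[OF Y] by simp
  also have "\<dots> \<le> (\<Sum>y\<in>Y ` {..<q}. order y ?p)"
    using dvd p by (intro sum_mono) (auto simp: order_divides)
  also have "\<dots> \<le> (\<Sum>y | poly ?p y = 0. order y ?p)"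
    using root p by (intro sum_mono2 poly_roots_finite) auto
  also have "\<dots> \<le> degree ?p" by (rule sum_order_le_degree[OF p])
  also have "\<dots> \<le> d" by (rule degree_restr[OF F])
  finally show False using m by simp
qed

text \<open>The Taylor coefficients with \<open>w j1 = 0\<close> at a point of the line are the
  coefficients of the restriction. When they vanish, every remaining term contains the equation of
  the line.\<close>

lemma restr_0_imp_divisible:
  assumes F: "homogeneous d F" "F \<noteq> 0" and r: "restr x F = 0"
  shows "\<exists>G e. d = Suc e \<and> homogeneous e G \<and> F = linform (pt x 0) j1 * G"
proof -
  let ?W = "PiE UNIV (\<lambda>_. {..d}) :: ('n \<Rightarrow> nat) set"
  let ?l = "linform (pt x 0)"
  let ?c = "\<lambda>w. single 0 (hasse (pt x 0) w F) * var None ^ (d - sum w UNIV)"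
  have fin: "finite ?W" by (rule finite_PiE) auto
  have zero: "hasse (pt x 0) w F = 0" if w: "w \<in> ?W" "w j1 = 0" for w
  proof -
    have "coeff (restr x F) (w j2) = (\<Sum>v\<in>?W. if v = w then hasse (pt x 0) w F else 0)"
      unfolding restr_taylor[OF F(1), of x 0] coeff_sum
    proof (rule sum.cong)
      fix v assume "v \<in> ?W"
      have eq: "v = w \<longleftrightarrow> v j1 = 0 \<and> v j2 = w j2"
      proof
        assume *: "v j1 = 0 \<and> v j2 = w j2"
        show "v = w"
        proof
          fix j
          have "j \<in> {j1, j2}" using coords(1) by auto
          then show "v j = w j" using * w(2) by auto
        qed
      qed (use w(2) in auto)
      show "coeff ([:hasse (pt x 0) v F:] * (0 ^ v j1 * [:- 0, 1:] ^ v j2)) (w j2) = (if v = w then hasse (pt x 0) w F else 0)"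
      proof (cases "v = w")
        case True
        then show ?thesis using w(2) by (simp add: monom_altdef[symmetric, of 1, simplified])
      next
        case False
        then show ?thesis using eq by (cases "v j1 = 0") (simp_all add: power_0_left monom_altdef[symmetric, of 1, simplified])
      qed
    qed simp
    then show ?thesis using r w(1) fin by simp
  qed
  let ?G = "\<Sum>w\<in>?W. if w j1 = 0 then 0 else ?c w * (?l j1 ^ (w j1 - 1) * ?l j2 ^ w j2)"
  have "F = (\<Sum>w\<in>?W. ?c w * (?l j1 ^ w j1 * ?l j2 ^ w j2))"
    using hasse_taylor[OF F(1), of "pt x 0"] by (simp add: prod_coords)
  also have "\<dots> = ?G * ?l j1"
    unfolding sum_distrib_right
  proof (rule sum.cong)
    fix w assume w: "w \<in> ?W"
    show "?c w * (?l j1 ^ w j1 * ?l j2 ^ w j2) = (if w j1 = 0 then 0 else ?c w * (?l j1 ^ (w j1 - 1) * ?l j2 ^ w j2)) * ?l j1"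
    proof (cases "w j1")
      case 0
      then show ?thesis using zero[OF w] by simp
    qed (simp add: mult_ac)
  qed simp
  finally have "F = ?G * ?l j1" .
  \<comment> \<open>Passing to the component of degree \<open>d - 1\<close> avoids checking that
    \<open>?G\<close> is homogeneous.\<close>
  then have "hcomp d F = (if 1 \<le> d then hcomp (d - 1) ?G * ?l j1 else 0)"
    using hcomp_mult[OF homogeneous_linform, of d ?G "pt x 0" j1] by simp
  then have *: "F = (if 1 \<le> d then hcomp (d - 1) ?G * ?l j1 else 0)"
    using F(1) by (simp add: hcomp_homogeneous)
  then have "1 \<le> d" using F(2) by (cases "1 \<le> d") auto
  then show ?thesis using *
    by (intro exI[of _ "hcomp (d - 1) ?G"] exI[of _ "d - 1"]) (simp add: homogeneous_hcomp mult.commute)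
qed

text \<open>At a point of the line its equation is a local coordinate, so division costs one order
  of vanishing.\<close>

lemma hasse_quotient_same:
  assumes "\<And>w. sum w UNIV < m \<Longrightarrow> hasse (pt x y) w (linform (pt x 0) j1 * G) = 0" "sum w UNIV < m - 1"
  shows "hasse (pt x y) w G = 0"
proof -
  have "sum (w(j1 := Suc (w j1))) UNIV < m" using assms(2) coords(2) by (simp add: sum_coords)
  from assms(1)[OF this] show ?thesis
    unfolding linform_pt[of x y, symmetric] hasse_linform by simp
qed

text \<open>Off the line its equation is a local coordinate plus the nonzero constant
  \<open>x' - x\<close>, hence a local unit, and no order is lost. The induction on
  \<open>w j1\<close> disposes of the local coordinate.\<close>

lemma hasse_quotient_other:
  assumes "x' \<noteq> x" "\<And>w. sum w UNIV < m \<Longrightarrow> hasse (pt x' y) w (linform (pt x 0) j1 * G) = 0" "sum w UNIV < m"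
  shows "hasse (pt x' y) w G = 0"
  using assms(3)
proof (induction "w j1" arbitrary: w)
  case (0 w)
  have eq: "linform (pt x 0) j1 * G = linform (pt x' y) j1 * G + single 0 (x' - x) * (var None * G)"
    by (simp add: linform_def single_diff algebra_simps)
  show ?case
    using assms(2)[OF 0(2)] assms(1) 0(1)[symmetric]
    unfolding eq hasse_add hasse_const_mult hasse_var_None hasse_linform by simp
next
  case (Suc l w)
  have eq: "linform (pt x 0) j1 * G = linform (pt x' y) j1 * G + single 0 (x' - x) * (var None * G)"
    by (simp add: linform_def single_diff algebra_simps)
  have "hasse (pt x' y) (w(j1 := w j1 - 1)) G = 0"
    using Suc(2,3) coords(2) by (intro Suc(1)) (simp_all add: sum_coords)
  then have "hasse (pt x' y) w (linform (pt x' y) j1 * G) = 0"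
    by (simp only: hasse_linform if_cancel)
  then show ?case
    using assms(2)[OF Suc(3)] assms(1)
    unfolding eq hasse_add hasse_const_mult hasse_var_None by simp
qed

text \<open>If \<open>\<Sum>\<^sub>i \<mu>\<^sub>i > d\<close>, some column has more than \<open>d\<close> zeros, so its line splits off; this lowers both
  \<open>d\<close> and \<open>\<Sum>\<^sub>i \<mu>\<^sub>i\<close> by one.\<close>

lemma grid_form_zero:
  fixes q :: nat
  assumes "homogeneous d F" "inj_on X {..<q}" "inj_on Y {..<q}" "d < sum \<mu> {..<q}"
    "\<And>i j w. i < q \<Longrightarrow> j < q \<Longrightarrow> sum w UNIV < \<mu> i \<Longrightarrow> hasse (pt (X i) (Y j)) w F = 0"
  shows "F = 0"
  using assms(1,4,5)
proof (induction d arbitrary: F \<mu>)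
  case 0
  show ?case
  proof (rule ccontr)
    assume "F \<noteq> 0"
    obtain i where i: "i < q" "0 < \<mu> i"
      using 0(2) by (metis lessThan_iff neq0_conv sum.neutral)
    have "restr (X i) F = 0"
      by (rule restr_eq_0[OF 0(1) assms(3), of "\<mu> i"]) (use i 0(3) in auto)
    then show False using restr_0_imp_divisible[OF 0(1) \<open>F \<noteq> 0\<close>] by blast
  qed
next
  case (Suc d)
  show ?case
  proof (rule ccontr)
    assume F: "F \<noteq> 0"
    \<comment> \<open>Averaging: if \<open>q * \<mu> i \<le> d + 1\<close> held for all
      \<open>q\<close> columns, summation would give
      \<open>sum \<mu> {..<q} \<le> d + 1\<close>.\<close>
    have "\<exists>i<q. Suc d < q * \<mu> i"
    proof (rule ccontr)
      assume "\<not> ?thesis"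
      then have "(\<Sum>i<q. q * \<mu> i) \<le> (\<Sum>i<q. Suc d)"
        by (intro sum_mono) (meson lessThan_iff not_less)
      then have "q * sum \<mu> {..<q} \<le> q * Suc d" by (simp add: sum_distrib_left)
      moreover have "0 < q" using Suc.prems(2) by (cases q) auto
      ultimately have "sum \<mu> {..<q} \<le> Suc d" by (simp only: mult_le_cancel1)
      then show False using Suc.prems(2) by simp
    qed
    then obtain i where i: "i < q" "Suc d < q * \<mu> i" by blast
    have "restr (X i) F = 0"
      by (rule restr_eq_0[OF Suc.prems(1) assms(3) i(2)]) (use i Suc.prems(3) in auto)
    then obtain G where G: "homogeneous d G" "F = linform (pt (X i) 0) j1 * G"
      using restr_0_imp_divisible[OF Suc.prems(1) F] by auto
    have pos: "0 < \<mu> i" using i(2) by (cases "\<mu> i") auto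
    have "G = 0"
    proof (rule Suc.IH[OF G(1)])
      have "sum \<mu> {..<q} = \<mu> i + sum \<mu> ({..<q} - {i})" by (rule sum.remove) (use i in auto)
      moreover have "sum (\<mu>(i := \<mu> i - 1)) {..<q} = (\<mu>(i := \<mu> i - 1)) i + sum (\<mu>(i := \<mu> i - 1)) ({..<q} - {i})"
        by (rule sum.remove) (use i in auto)
      moreover have "sum (\<mu>(i := \<mu> i - 1)) ({..<q} - {i}) = sum \<mu> ({..<q} - {i})" by (rule sum.cong) auto
      ultimately show "d < sum (\<mu>(i := \<mu> i - 1)) {..<q}" using Suc.prems(2) pos by simp
      fix i' j and w :: "'n \<Rightarrow> nat"
      assume ij: "i' < q" "j < q" "sum w UNIV < (\<mu>(i := \<mu> i - 1)) i'"
      show "hasse (pt (X i') (Y j)) w G = 0"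
      proof (cases "i' = i")
        case True
        then show ?thesis
          using hasse_quotient_same[of "\<mu> i" "X i" "Y j" G w] Suc.prems(3)[OF i(1) ij(2)] ij(3) unfolding G(2) by simp
      next
        case False
        then have "X i' \<noteq> X i" using assms(2) i(1) ij(1) by (auto dest: inj_onD)
        then show ?thesis
          using hasse_quotient_other[of "X i'" "X i" "\<mu> i'" "Y j" G w] Suc.prems(3)[OF ij(1,2)] ij(3) False unfolding G(2) by simp
      qed
    qed
    then show False using F G(2) by simp
  qed
qed

section \<open>Dimension counts in the plane\<close>

lemma card_coords: "CARD('n) = 2"
  unfolding card_2_iff using coords by blast

lemma two_times_choose_two: "2 * ((k + 2) choose k) = (k + 2) * (k + 1)"
proof -
  have "(k + 2) choose k = (k + 2) choose 2" using binomial_symmetric[of k "k + 2"] by simp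
  also have "\<dots> = (k + 2) * (k + 1) div 2" by (simp add: choose_two)
  finally show ?thesis by simp
qed

lemma two_times_card_monoms: "2 * card {t :: 'n option \<Rightarrow>\<^sub>0 nat. monom_deg t = k} = (k + 2) * (k + 1)"
  unfolding card_monom_deg using two_times_choose_two[of k] by (simp add: card_coords)

text \<open>A derivative of order at most \<open>m\<close> is completed to a monomial of degree
  \<open>m\<close> by a suitable exponent of \<open>x\<^sub>0\<close>.\<close>

lemma two_times_card_conditions: "2 * card {w :: 'n \<Rightarrow> nat. sum w UNIV < Suc m} \<le> (m + 2) * (m + 1)"
proof -
  have "{w :: 'n \<Rightarrow> nat. sum w UNIV < Suc m} \<subseteq>
    (\<lambda>t j. lookup t (Some j)) ` {t :: 'n option \<Rightarrow>\<^sub>0 nat. monom_deg t = m}"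
  proof
    fix w :: "'n \<Rightarrow> nat" assume "w \<in> {w. sum w UNIV < Suc m}"
    then have w: "w j1 + w j2 \<le> m" by (simp add: sum_coords)
    let ?t = "Abs_poly_mapping (case_option (m - (w j1 + w j2)) w)"
    have "lookup ?t = case_option (m - (w j1 + w j2)) w" by (rule lookup_Abs_poly_mapping) simp
    then have "w = (\<lambda>j. lookup ?t (Some j))" "monom_deg ?t = m"
      using w by (simp_all add: monom_deg_option sum_coords)
    then show "w \<in> (\<lambda>t j. lookup t (Some j)) ` {t :: 'n option \<Rightarrow>\<^sub>0 nat. monom_deg t = m}" by blast
  qed
  from surj_card_le[OF finite_monom_deg this]
  have "card {w :: 'n \<Rightarrow> nat. sum w UNIV < Suc m} \<le> card {t :: 'n option \<Rightarrow>\<^sub>0 nat. monom_deg t = m}" .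
  then show ?thesis using two_times_card_monoms[of m] by linarith
qed

end

locale plane_config = generic_config a n s + plane j1 j2 "TYPE('k)"
  for a :: "nat \<Rightarrow> 'n::finite \<Rightarrow> 'k::field" and n s :: nat and j1 j2 :: 'n +
  fixes q :: nat
  assumes square: "n = q * q" and infinite_field: "infinite (UNIV :: 'k set)"
begin

lemma q_pos: "0 < q"
  using n_pos square by (cases q) auto

lemma degree_ge_of_multiplicity:
  assumes F: "F \<noteq> 0" "homogeneous d F" "\<And>i. i < n \<Longrightarrow> F \<in> ideal_power (point_ideal (a i)) m"
  shows "q * m \<le> d"
proof (rule ccontr)
  assume less: "\<not> ?thesis"
  obtain X :: "nat \<Rightarrow> 'k" where "inj X" using infinite_countable_subset[OF infinite_field] by blast
  then have X: "inj_on X {..<q}" by (rule inj_on_subset) simp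
  have "hasse (a i) w F = 0" if "i < n" "sum w UNIV < m" for i w
    using hasse_ideal_power[OF F(3)] that by blast
  \<comment> \<open>The point with number \<open>i\<close> is moved to column \<open>i div q\<close>
    and row \<open>i mod q\<close> of the grid.\<close>
  then have "\<exists>G. G \<noteq> 0 \<and> homogeneous d G \<and>
    (\<forall>i<n. \<forall>w. sum w UNIV < m \<longrightarrow> hasse (pt (X (i div q)) (X (i mod q))) w G = 0)"
    by (rule specialization[OF generic F(1,2), where m = "\<lambda>_. m"])
  then obtain G where G: "G \<noteq> 0" "homogeneous d G"
    "\<And>i w. i < n \<Longrightarrow> sum w UNIV < m \<Longrightarrow> hasse (pt (X (i div q)) (X (i mod q))) w G = 0" by metis
  have "G = 0"
  proof (rule grid_form_zero[OF G(2) X X, of "\<lambda>_. m"])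
    show "d < (\<Sum>i<q. m)" using less by simp
    fix i j w assume ij: "i < q" "j < q" "sum w (UNIV :: 'n set) < m"
    have "i * q + j < n"
    proof -
      have "i * q + j < Suc i * q" using ij by simp
      also have "\<dots> \<le> q * q" using ij by (intro mult_right_mono) auto
      finally show ?thesis by (simp add: square)
    qed
    from G(3)[OF this ij(3)] show "hasse (pt (X i) (X j)) w G = 0" using ij by simp
  qed
  then show False using G(1) by simp
qed

lemma ratio_ge: "x \<in> ratios \<Longrightarrow> 1 / real q \<le> x"
proof -
  assume "x \<in> ratios"
  then obtain d F where x: "x = real d / real (sum (mlt F) {..<n})"
    and F: "F \<noteq> 0" "homogeneous d F" "0 < sum (mlt F) {..<n}" unfolding ratios_def by blast
  define M where "M = sum (mlt F) {..<n}"
  obtain G where "G \<noteq> 0" "homogeneous (n * d) G" "\<And>i. i < n \<Longrightarrow> G \<in> ideal_power (point_ideal (a i)) M"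
    using symmetrization[OF F(1,2)] unfolding M_def by blast
  from degree_ge_of_multiplicity[OF this] have "M \<le> q * d" using q_pos by (simp add: square)
  then have "real M \<le> real q * real d" unfolding of_nat_mult[symmetric] of_nat_le_iff .
  then show ?thesis using F(3) q_pos unfolding x M_def[symmetric] by (simp add: field_simps)
qed

lemma ratio_le: "\<exists>x\<in>ratios. x \<le> 1 / real q + inverse (real (Suc k)) * (1 / real q)"
proof -
  let ?m = "Suc k"
  \<comment> \<open>Degree \<open>q * (m + 1)\<close> instead of \<open>q * m\<close> gives room for
    the count: twice the number of conditions is at most
    \<open>n (m + 1)\<^sup>2 = d\<^sup>2\<close>, which is less than \<open>(d + 2) (d + 1)\<close>.
    The price is an excess of \<open>1 / (q m)\<close> over \<open>1 / q\<close>.\<close>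
  let ?d = "q * Suc ?m"
  let ?U = "{t :: 'n option \<Rightarrow>\<^sub>0 nat. monom_deg t = ?d}"
  let ?C = "{w :: 'n \<Rightarrow> nat. sum w UNIV < ?m}"
  have "2 * (n * card ?C) \<le> n * ((k + 2) * (k + 1))"
    using two_times_card_conditions[of k] by (metis mult.left_commute mult_le_mono2)
  also have "\<dots> \<le> n * (Suc ?m * Suc ?m)" by (intro mult_le_mono) auto
  also have "\<dots> = ?d * ?d" unfolding square by (simp only: mult_ac)
  also have "\<dots> < (?d + 2) * (?d + 1)" by simp
  finally have card: "card ({..<n} \<times> ?C) < card ?U"
    unfolding two_times_card_monoms[symmetric] card_cartesian_product by simp
  have "finite ({..<n} \<times> ?C)" by (intro finite_cartesian_product finite_sum_less finite_lessThan)
  from solvable_more_unknowns[OF this finite_monom_deg card, of "\<lambda>e t. hcoef (a (fst e)) (snd e) t"]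
  obtain c where c: "\<exists>t\<in>?U. c t \<noteq> 0"
    "\<And>e. e \<in> {..<n} \<times> ?C \<Longrightarrow> (\<Sum>t\<in>?U. hcoef (a (fst e)) (snd e) t * c t) = 0"
    by blast
  define F where "F = (\<Sum>t\<in>?U. single t (c t))"
  have lk: "lookup F t = (if t \<in> ?U then c t else 0)" for t
    unfolding F_def by (rule lookup_sum_single[OF finite_monom_deg])
  have hom: "homogeneous ?d F" unfolding F_def by (intro homogeneous_sum homogeneous_single) simp
  have "F \<noteq> 0" using c(1) lk by (metis lookup_zero)
  have "F \<in> ideal_power (point_ideal (a i)) ?m" if "i < n" for i
    unfolding ideal_power_point_iff[OF hom] hasse_homogeneous[OF hom] using c(2)[of "(i, w)" for w] that by (simp add: lk)
  then obtain x where "x \<in> ratios" "x \<le> real ?d / (real n * real ?m)"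
    using ratio_I[OF \<open>F \<noteq> 0\<close> hom, of ?m] by auto
  moreover have "real ?d / (real n * real ?m) = 1 / real q + inverse (real ?m) * (1 / real q)"
  proof -
    have "Q * (M + 1) / (Q * Q * M) = 1 / Q + inverse M * (1 / Q)" if "0 < Q" "0 < M" for Q M :: real
      using that by (simp add: field_simps)
    from this[of "real q" "real ?m"] have "real q * (real ?m + 1) / (real q * real q * real ?m) =
        1 / real q + inverse (real ?m) * (1 / real q)"
      using q_pos by (simp only: of_nat_0_less_iff zero_less_Suc)
    moreover have "real ?d = real q * (real ?m + 1)" "real n = real q * real q"
      unfolding square of_nat_mult by simp_all
    ultimately show ?thesis by (simp only:)
  qed
  ultimately show ?thesis by auto
qed

lemma Inf_ratios: "Inf ratios = 1 / real q"
proof (rule antisym)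
  have L: "(\<lambda>k. 1 / real q + inverse (real (Suc k)) * (1 / real q)) \<longlonglongrightarrow> 1 / real q + 0 * (1 / real q)"
    by (intro tendsto_intros LIMSEQ_inverse_real_of_nat)
  have "Inf ratios \<le> 1 / real q + inverse (real (Suc k)) * (1 / real q)" for k
    using ratio_le[of k] Inf_ratios_le by force
  then have "Inf ratios \<le> 1 / real q + 0 * (1 / real q)"
    by (intro LIMSEQ_le_const[OF L]) blast
  then show "Inf ratios \<le> 1 / real q" by simp
  show "1 / real q \<le> Inf ratios"
    using exists_ratio ratio_ge by (intro cInf_greatest) auto
qed

theorem resurgence_square: "resurgence Z = ereal (real (Suc s) / sqrt (real n))"
proof -
  have "real n * Inf ratios = real q" unfolding Inf_ratios using q_pos by (simp add: square)
  moreover have "sqrt (real n) = real q" by (simp add: square)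
  ultimately show ?thesis using resurgence_eq by simp
qed

end

theorem corollary1p3p1:
  fixes N s n :: nat
    and p :: "nat \<Rightarrow> ('k::alg_closed_field, 'n::finite) proj"
    and Z :: "('k, 'n) proj set"
  assumes "N = CARD('n)"
    and "n = (s + N) choose N"
    and "inj_on p {..<n}"
    and "generic_points n p"
    and "Z = p ` {..<n}"
  shows "resurgence Z = ereal (real (s + 1) / (real n * seshadri_pow Z)) \<and>
    (N = 2 \<and> is_square n \<longrightarrow>
       resurgence Z = ereal (real (s + 1) / sqrt (real n)) \<and>
       real (s + 1) / sqrt (real n) = sqrt 2 * sqrt (real (s + 1) / real (s + 2)))"
proof -
  obtain a :: "nat \<Rightarrow> 'n \<Rightarrow> 'k" where p: "\<And>i. i < n \<Longrightarrow> p i = affine_point (a i)"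
    and gen: "alg_independent prime_field ({..<n} \<times> UNIV) (\<lambda>(i, j). a i j)"
    using assms(4) unfolding generic_points_def by blast
  have inj: "inj_on (\<lambda>i. affine_point (a i)) {..<n}"
    using assms(3) p by (auto simp: inj_on_def)
  have card: "n = card {t :: 'n option \<Rightarrow>\<^sub>0 nat. monom_deg t = s}"
    unfolding card_monom_deg assms(1,2) using binomial_symmetric[of s "s + CARD('n)"] by simp
  \<comment> \<open>Algebraic closedness enters through the infinitude of the field, which provides
    the unisolvent points to specialize to.\<close>
  interpret generic_config a n s
    by unfold_locales (use card gen inj generic_unisolvent[OF infinite_alg_closed gen card] in auto)
  have Z: "Z = local.Z"
    unfolding assms(5) Z_def using p by (intro image_cong) auto
  have 1: "resurgence Z = ereal (real (s + 1) / (real n * seshadri_pow Z))"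
    using resurgence_eq unfolding Z seshadri_pow_eq by simp
  have 2: "resurgence Z = ereal (real (s + 1) / sqrt (real n))" if "N = 2" "is_square n"
  proof -
    from that(1) obtain j1 j2 :: 'n where j: "UNIV = {j1, j2}" "j1 \<noteq> j2"
      unfolding assms(1) card_2_iff by blast
    from that(2) obtain q where q: "n = q * q"
      by (auto simp: is_nth_power_def power2_eq_square)
    interpret plane_config a n s j1 j2 q
      by unfold_locales (use j q infinite_alg_closed in auto)
    show ?thesis using resurgence_square unfolding Z by simp
  qed
  have 3: "real (s + 1) / sqrt (real n) = sqrt 2 * sqrt (real (s + 1) / real (s + 2))" if "N = 2"
  proof -
    have "2 * n = (s + 2) * (s + 1)" unfolding assms(2) that choose_two by simp
    then have "2 * real n = real (s + 2) * real (s + 1)" by (metis of_nat_mult of_nat_numeral)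
    then have n: "real n = real (s + 2) * real (s + 1) / 2" by simp
    have "real (s + 1) / sqrt (real n) = sqrt (real (s + 1) ^ 2 / real n)"
      by (simp add: real_sqrt_divide)
    also have "real (s + 1) ^ 2 / real n = 2 * (real (s + 1) / real (s + 2))"
      unfolding n by (simp add: power2_eq_square)
    finally show ?thesis by (simp only: real_sqrt_mult)
  qed
  show ?thesis using 1 2 3 by blast
qed

end
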